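(* Let $s,q$ be positive integers with $q<s$. Let $g:[-\pi,\pi]\to\mathbb{C}^{s\times s}$ be Hermitian positive definite almost everywhere and let $f:[-\pi,\pi]\to\mathbb{C}^{q\times s}$, where all entries of $f$ and $g$ belong to $L^1([-\pi,\pi])$. Then $$\{T_n(f)\,T_n^{-1}(g)\,T_n(f^* )\}_n\sim_{\sigma}(f\cdot g^{-1}\cdot f^*,[-\pi,\pi])$$ and $$\{T_n(f)\,T_n^{-1}(g)\,T_n(f^* )\}_n\sim_{\lambda}(f\cdot g^{-1}\cdot f^*,[-\pi,\pi]),$$ where $T_n^{-1}(g):=(T_n(g))^{-1}$, $f^*(\theta):=(f(\theta))^*$ is the pointwise conjugate transpose, and products and inverses of symbols are taken pointwise.
   Context: Block Toeplitz matrices: for positive integers $a,b$ (possibly $a\neq b$) and a function $\varphi:[-\pi,\pi]\to\mathbb{C}^{a\times b}$ with entries in $L^1([-\pi,\pi])$, the Fourier coefficients are $t_j:=\frac{1}{2\pi}\int_{-\pi}^{\pi}\varphi(\theta)e^{-\mathbf{i}j\theta}\,\mathrm{d}\theta\in\mathbb{C}^{a\times b}$ (component-wise integrals, $j\in\mathbb{Z}$), and for $n\in\mathbb{N}$ the matrix $T_n(\varphi):=[t_{i-k}]_{i,k=1}^{n}$ is the $an\times bn$ block Toeplitz matrix generated by $\varphi$. Distributions: let $\varphi:[\alpha,\beta]\to\mathbb{C}^{r\times r}$ be a measurable matrix-valued function with eigenvalues $\lambda_i(\varphi)$ and singular values $\sigma_i(\varphi)$, $i=1,\dots,r$, and let $\{A_n\}_n$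 be a sequence of square matrices with $A_n$ of size $d_n$, $d_n\to\infty$ as $n\to\infty$, with eigenvalues $\lambda_j(A_n)$ and singular values $\sigma_j(A_n)$, $j=1,\dots,d_n$. One writes $\{A_n\}_n\sim_\lambda(\varphi,[\alpha,\beta])$ if $$\lim_{n\to\infty}\frac{1}{d_n}\sum_{j=1}^{d_n}F(\lambda_j(A_n))=\frac{1}{\beta-\alpha}\int_\alpha^\beta\frac{\sum_{i=1}^{r}F(\lambda_i(\varphi(t)))}{r}\,\mathrm{d}t$$ for every continuous function $F$ with compact support, and $\{A_n\}_n\sim_\sigma(\varphi,[\alpha,\beta])$ if the same relation holds, for every continuous function $F$ with compact support, with $\lambda_j(A_n)$ and $\lambda_i(\varphi(t))$ replaced by $\sigma_j(A_n)$ and $\sigma_i(\varphi(t))$. *)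

theory Defs
  imports
    "HOL-Analysis.Analysis"
    "Jordan_Normal_Form.Gauss_Jordan_Elimination"
    "Jordan_Normal_Form.Schur_Decomposition"
    "Jordan_Normal_Form.Char_Poly"
begin

(* Matrices are those of Jordan_Normal_Form (dimensions are natural numbers, indices start
   at 0), since the sizes of the Toeplitz matrices grow with n. *)

text \<open>The library inverse is partial; a matrix without inverse is sent to a zero matrix, so that
  pointwise inverses of symbols are total functions. For a symbol that is invertible almost
  everywhere this choice only matters on a null set.\<close>

definition mat_inv :: "'a::field mat \<Rightarrow> 'a mat" where
  "mat_inv A = (case mat_inverse A of
     Some B \<Rightarrow> B
   | None \<Rightarrow> 0\<^sub>m (dim_col A) (dim_row A))"

text \<open>For a Hermitian matrix \<open>v\<^sup>* A v\<close> is real, so taking the real part loses nothing.\<close>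

definition hermitian_pos_def :: "complex mat \<Rightarrow> bool" where
  "hermitian_pos_def A \<longleftrightarrow>
     mat_adjoint A = A \<and>
     (\<forall>v \<in> carrier_vec (dim_row A). v \<noteq> 0\<^sub>v (dim_row A) \<longrightarrow> Re ((A *\<^sub>v v) \<bullet>c v) > 0)"

text \<open>Both spectra are multisets, i.e. eigenvalues are counted with algebraic multiplicity. The
  singular values are the square roots of the eigenvalues of \<open>A\<^sup>* A\<close>, which are real and
  nonnegative.\<close>

definition eigvals :: "complex mat \<Rightarrow> complex multiset" where
  "eigvals A = proots (char_poly A)"

definition singvals :: "complex mat \<Rightarrow> real multiset" where
  "singvals A = image_mset (\<lambda>z. sqrt (Re z)) (eigvals (mat_adjoint A * A))"

definition L1_symbol :: "nat \<Rightarrow> nat \<Rightarrow> (real \<Rightarrow> complex mat) \<Rightarrow> bool" where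
  "L1_symbol a b \<phi> \<longleftrightarrow>
     (\<forall>\<theta> \<in> {-pi..pi}. \<phi> \<theta> \<in> carrier_mat a b) \<and>
     (\<forall>i<a. \<forall>j<b. integrable (lebesgue_on {-pi..pi}) (\<lambda>\<theta>. \<phi> \<theta> $$ (i, j)))"

definition fourier_coeff :: "nat \<Rightarrow> nat \<Rightarrow> (real \<Rightarrow> complex mat) \<Rightarrow> int \<Rightarrow> complex mat" where
  "fourier_coeff a b \<phi> j = mat a b (\<lambda>(k, l).
     1 / (2 * of_real pi) *
     (\<integral>\<theta>. \<phi> \<theta> $$ (k, l) * exp (- (\<i> * of_int j * of_real \<theta>)) \<partial>lebesgue_on {-pi..pi}))"

text \<open>Row \<open>i\<close> lies in block row \<open>i div a\<close>, at position \<open>i mod a\<close> inside the block; likewise for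
  columns with \<open>b\<close>.\<close>

definition block_toeplitz ::
  "nat \<Rightarrow> nat \<Rightarrow> nat \<Rightarrow> (real \<Rightarrow> complex mat) \<Rightarrow> complex mat" where
  "block_toeplitz a b n \<phi> = mat (a * n) (b * n) (\<lambda>(i, k).
     fourier_coeff a b \<phi> (int (i div a) - int (k div b)) $$ (i mod a, k mod b))"

text \<open>The common form of the two distribution relations; \<open>spec\<close> is \<open>eigvals\<close> or \<open>singvals\<close>. The
  first four conjuncts are the conditions under which the relations are introduced. In particular,
  measurability of \<open>\<phi>\<close> rules out that the integral has its default value 0.\<close>

definition distributed_as ::
  "(complex mat \<Rightarrow> 'x::topological_space multiset) \<Rightarrow> (nat \<Rightarrow> complex mat) \<Rightarrow>
   nat \<Rightarrow> (real \<Rightarrow> complex mat) \<Rightarrow> real \<Rightarrow> real \<Rightarrow> bool" where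
  "distributed_as spec A r \<phi> \<alpha> \<beta> \<longleftrightarrow>
     (\<forall>t \<in> {\<alpha>..\<beta>}. \<phi> t \<in> carrier_mat r r) \<and>
     (\<forall>i<r. \<forall>j<r. (\<lambda>t. \<phi> t $$ (i, j)) \<in> borel_measurable (lebesgue_on {\<alpha>..\<beta>})) \<and>
     (\<forall>n. square_mat (A n)) \<and>
     filterlim (\<lambda>n. dim_row (A n)) at_top sequentially \<and>
     (\<forall>F :: 'x \<Rightarrow> complex.
        continuous_on UNIV F \<and> compact (closure {x. F x \<noteq> 0}) \<longrightarrow>
        (\<lambda>n. 1 / of_nat (dim_row (A n)) * (\<Sum>x\<in>#spec (A n). F x)) \<longlonglongrightarrow>
        1 / of_real (\<beta> - \<alpha>) *
          (\<integral>t. (\<Sum>x\<in>#spec (\<phi> t). F x) / of_nat r \<partial>lebesgue_on {\<alpha>..\<beta>}))"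

definition eigval_distributed ::
  "(nat \<Rightarrow> complex mat) \<Rightarrow> nat \<Rightarrow> (real \<Rightarrow> complex mat) \<Rightarrow> real \<Rightarrow> real \<Rightarrow> bool" where
  "eigval_distributed = distributed_as eigvals"

definition singval_distributed ::
  "(nat \<Rightarrow> complex mat) \<Rightarrow> nat \<Rightarrow> (real \<Rightarrow> complex mat) \<Rightarrow> real \<Rightarrow> real \<Rightarrow> bool" where
  "singval_distributed = distributed_as singvals"

end

theory Submission
  imports Defs
begin

text \<open>Put \<open>A\<^sub>n = T\<^sub>n(f) T\<^sub>n(g)\<^sup>-\<^sup>1 T\<^sub>n(f\<^sup>*)\<close> and \<open>a = f g\<^sup>-\<^sup>1 f\<^sup>*\<close>.
Since \<open>T\<^sub>n(f\<^sup>*)\<close> is the adjoint of \<open>T\<^sub>n(f)\<close> and \<open>T\<^sub>n(g)\<close> is Hermitian positive definite,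
\<open>A\<^sub>n\<close> is a Schur complement \<open>F G\<^sup>-\<^sup>1 F\<^sup>*\<close> and is positive semidefinite. Its singular values
are its eigenvalues, so both relations say the same thing, and it suffices to know the limits of
the traces of the resolvents \<open>(x + A\<^sub>n)\<^sup>-\<^sup>1\<close> for real \<open>x > 0\<close>: linear combinations of the functions
\<open>1/(x+t)\<close> approximate, uniformly on \<open>t \<ge> 0\<close>, the powers of \<open>u = 1/(1+t)\<close>, and by Weierstrass every
continuous function of compact support.

The entries of the symbols are only integrable, the inverse of \<open>g\<close> may even fail to be integrable, and
Toeplitz matrices are not multiplicative. Three ideas overcome this.

First, Toeplitz matrices are asymptotically multiplicative in a weak sense: for integrable \<open>k\<close>,
bounded \<open>h\<close> and any \<open>X\<^sub>n\<close> of bounded operator norm, the trace of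
\<open>X\<^sub>n (T\<^sub>n(k) T\<^sub>n(h) - T\<^sub>n(kh))\<close> is \<open>o(n)\<close>. The trace is bounded by a multiple of
\<open>n\<close> times the \<open>L\<^sup>1\<close> norm of \<open>k\<close>, trigonometric polynomials are dense in \<open>L\<^sup>1\<close>, and for
\<open>k(\<theta>) = exp(\<i>m\<theta>)\<close> the difference has at most \<open>2|m|\<close> nonzero rows.

Second, the resolvent \<open>R = (x + F G\<^sup>-\<^sup>1 F\<^sup>*)\<^sup>-\<^sup>1\<close> and \<open>V = R F G\<^sup>-\<^sup>1\<close> solve the linear
system \<open>V G = R F\<close>, \<open>V F\<^sup>* + x R = 1\<close>, and \<open>R \<le> 1/x\<close>, while \<open>V\<close> is bounded as soon as
\<open>G \<ge> \<epsilon>\<close>. The symbols \<open>r\<close> and \<open>v\<close> built in the same way from \<open>g(\<theta>)\<close> and \<open>f(\<theta>)\<close> solve the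
pointwise system. Hence, if \<open>g \<ge> \<epsilon>\<close>, then \<open>T\<^sub>n(r) - R\<close> is a sum of three expressions of the kind
above, with \<open>R\<close> and \<open>V\<close> in the place of \<open>X\<^sub>n\<close>, and its trace is \<open>o(n)\<close>
(lemma \<open>shifted_resolvent_limit\<close>).

Third, replacing \<open>g\<close> by \<open>g + \<epsilon>\<close> costs little, uniformly in \<open>n\<close>: the trace of the resolvent
increases, and \<open>x\<close> times the increase is at most \<open>\<epsilon> tr (G + \<epsilon>)\<^sup>-\<^sup>1\<close> (lemma
\<open>tr_schur_res_shift\<close>). Divided by \<open>n\<close>, this bound tends to the mean over \<open>\<theta>\<close> of
\<open>\<epsilon> tr (g + \<epsilon>)\<^sup>-\<^sup>1\<close>, which vanishes as \<open>\<epsilon> \<rightarrow> 0\<close> by dominated convergence, because \<open>g\<close> is positive definite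
almost everywhere. The same estimate holds for the symbols, so the limit \<open>\<epsilon> \<rightarrow> 0\<close> may be taken on
both sides (theorem \<open>resolvent_trace_limit\<close>).\<close>

section \<open>Fourier coefficients of scalar symbols\<close>

abbreviation (input) circ :: "real measure" where "circ \<equiv> lebesgue_on {-pi..pi}"

definition ek :: "int \<Rightarrow> real \<Rightarrow> complex" where
  "ek m \<theta> = exp (\<i> * of_int m * of_real \<theta>)"

definition fc :: "(real \<Rightarrow> complex) \<Rightarrow> int \<Rightarrow> complex" where
  "fc u j = 1 / (2 * of_real pi) * (\<integral>\<theta>. u \<theta> * ek (- j) \<theta> \<partial>circ)"

lemma ek_add: "ek (m + n) \<theta> = ek m \<theta> * ek n \<theta>"
  by (simp add: ek_def algebra_simps exp_add)

lemma ek_0 [simp]: "ek 0 \<theta> = 1"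
  by (simp add: ek_def)

lemma ek_cis: "ek m \<theta> = cis (of_int m * \<theta>)"
  by (simp add: ek_def cis_conv_exp algebra_simps)

lemma norm_ek [simp]: "cmod (ek m \<theta>) = 1"
  by (simp add: ek_cis)

lemma cnj_ek: "cnj (ek m \<theta>) = ek (- m) \<theta>"
  by (simp add: ek_cis cis_cnj)

lemma finite_measure_circ: "finite_measure circ"
  by (rule finite_measure_lebesgue_on) simp

lemma measure_circ: "measure circ (space circ) = 2 * pi"
  by (simp add: measure_restrict_space)

lemma continuous_borel_circ:
  fixes u :: "real \<Rightarrow> 'a::euclidean_space"
  shows "continuous_on UNIV u \<Longrightarrow> u \<in> borel_measurable circ"
  by (meson continuous_imp_measurable_on_sets_lebesgue continuous_on_subset fmeasurableD
      lmeasurable_interval(1) cbox_interval subset_UNIV)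

lemma ek_measurable [measurable]: "ek m \<in> borel_measurable circ"
  unfolding ek_def by (intro continuous_borel_circ continuous_intros)

lemma integrable_bounded_circ:
  fixes h :: "real \<Rightarrow> complex"
  assumes "h \<in> borel_measurable circ" "\<And>\<theta>. \<theta> \<in> {-pi..pi} \<Longrightarrow> cmod (h \<theta>) \<le> H"
  shows "integrable circ h"
  by (rule finite_measure.integrable_const_bound[OF finite_measure_circ, of _ H])
     (use assms in \<open>auto intro!: AE_I2\<close>)

lemma integrable_mult_bdd:
  fixes u h :: "real \<Rightarrow> complex"
  assumes u: "integrable circ u" and h: "h \<in> borel_measurable circ"
    and H: "\<And>\<theta>. \<theta> \<in> {-pi..pi} \<Longrightarrow> cmod (h \<theta>) \<le> H"
  shows "integrable circ (\<lambda>\<theta>. u \<theta> * h \<theta>)"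
proof (rule Bochner_Integration.integrable_bound[of _ "\<lambda>\<theta>. H * cmod (u \<theta>)"])
  show "integrable circ (\<lambda>\<theta>. H * cmod (u \<theta>))"
    using u by auto
  show "(\<lambda>\<theta>. u \<theta> * h \<theta>) \<in> borel_measurable circ"
    using u h by measurable
  show "AE \<theta> in circ. norm (u \<theta> * h \<theta>) \<le> norm (H * cmod (u \<theta>))"
  proof (rule AE_I2)
    fix \<theta> assume "\<theta> \<in> space circ"
    then have "cmod (h \<theta>) \<le> H" using H by auto
    then have "cmod (h \<theta>) \<le> \<bar>H\<bar>" by linarith
    then show "norm (u \<theta> * h \<theta>) \<le> norm (H * cmod (u \<theta>))"
      by (simp add: norm_mult abs_mult mult.commute mult_right_mono)
  qed
qed

lemma integrable_mult_ek:
  assumes "integrable circ u" shows "integrable circ (\<lambda>\<theta>. u \<theta> * ek m \<theta>)"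
  by (rule integrable_mult_bdd[OF assms, of _ 1]) auto

lemma fc_add:
  assumes "integrable circ u" "integrable circ v"
  shows "fc (\<lambda>\<theta>. u \<theta> + v \<theta>) j = fc u j + fc v j"
  using integrable_mult_ek[OF assms(1), of "-j"] integrable_mult_ek[OF assms(2), of "-j"]
  by (simp add: fc_def distrib_right distrib_left Bochner_Integration.integral_add)

lemma fc_cmult: "fc (\<lambda>\<theta>. c * u \<theta>) j = c * fc u j"
  by (simp add: fc_def mult.assoc)

lemma fc_sum:
  assumes "finite A" "\<And>a. a \<in> A \<Longrightarrow> integrable circ (u a)"
  shows "fc (\<lambda>\<theta>. \<Sum>a\<in>A. u a \<theta>) j = (\<Sum>a\<in>A. fc (u a) j)"
proof -
  have "(\<integral>\<theta>. (\<Sum>a\<in>A. u a \<theta> * ek (-j) \<theta>) \<partial>circ) = (\<Sum>a\<in>A. \<integral>\<theta>. u a \<theta> * ek (-j) \<theta> \<partial>circ)"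
    by (rule Bochner_Integration.integral_sum) (use assms integrable_mult_ek in auto)
  then show ?thesis by (simp add: fc_def sum_distrib_right sum_distrib_left)
qed

lemma integral_ek: "(\<integral>\<theta>. ek m \<theta> \<partial>circ) = (if m = 0 then 2 * of_real pi else 0)"
proof (cases "m = 0")
  case True
  then show ?thesis by (simp add: measure_circ[simplified] scaleR_conv_of_real)
next
  case False
  let ?F = "\<lambda>x::real. ek m x / (\<i> * of_int m)"
  have "(?F has_vector_derivative ek m x) (at x within {-pi..pi})" for x
  proof -
    have "((\<lambda>z. exp (\<i> * of_int m * z) / (\<i> * of_int m)) has_field_derivative ek m x) (at (of_real x))"
      by (rule derivative_eq_intros refl | simp add: False ek_def)+
    then show ?thesis
      unfolding ek_def
      by (rule has_vector_derivative_at_within[OF has_vector_derivative_real_field])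
  qed
  then have "(ek m has_integral (?F pi - ?F (-pi))) {-pi..pi}"
    by (intro fundamental_theorem_of_calculus) auto
  moreover have "?F pi = ?F (-pi)"
  proof -
    have "ek (2*m) pi = 1"
      by (simp add: ek_cis complex_eq_iff) (metis cos_int_2pin sin_int_2pin mult.commute mult.left_commute)
    then have "ek m pi * ek m pi = 1" by (simp add: ek_add[symmetric])
    then have "ek m pi = ek m (-pi)"
      by (metis (no_types, lifting) cnj_ek ek_cis mult_minus_left mult_minus_right mult.right_neutral 
          complex_norm_square norm_ek of_real_1 one_power2 mult_cancel_left norm_zero zero_neq_one of_int_minus)
    then show ?thesis by simp
  qed
  ultimately have "integral {-pi..pi} (ek m) = 0" by (simp add: integral_unique)
  moreover have "integrable circ (ek m)" by (rule integrable_bounded_circ[of _ 1]) auto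
  ultimately show ?thesis using False by (simp add: lebesgue_integral_eq_integral)
qed

lemma fc_ek: "fc (ek m) j = (if j = m then 1 else 0)"
  by (simp add: fc_def ek_add[symmetric] integral_ek)

lemma fc_ek_mult: "fc (\<lambda>\<theta>. ek m \<theta> * u \<theta>) j = fc u (j - m)"
proof -
  have "ek m \<theta> * u \<theta> * ek (- j) \<theta> = u \<theta> * ek (- (j - m)) \<theta>" for \<theta>
  proof -
    have "ek m \<theta> * ek (- j) \<theta> = ek (- (j - m)) \<theta>" by (simp add: ek_add[symmetric])
    then show ?thesis by (metis mult.assoc mult.commute)
  qed
  then show ?thesis by (simp only: fc_def)
qed

text \<open>Trigonometric polynomials whose coefficients are indexed by an arbitrary set: frequencies may then
be shifted or negated by changing \<open>\<sigma>\<close>.\<close>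

definition trigp :: "('i \<Rightarrow> int) \<Rightarrow> 'i set \<Rightarrow> ('i \<Rightarrow> complex) \<Rightarrow> real \<Rightarrow> complex" where
  "trigp \<sigma> I v \<theta> = (\<Sum>i\<in>I. v i * ek (\<sigma> i) \<theta>)"

lemma trigp_measurable [measurable]: "trigp \<sigma> I v \<in> borel_measurable circ"
  unfolding trigp_def by measurable

lemma norm_trigp_le: "cmod (trigp \<sigma> I v \<theta>) \<le> (\<Sum>i\<in>I. cmod (v i))"
  unfolding trigp_def by (rule order_trans[OF norm_sum]) (simp add: norm_mult)

text \<open>The bridge between matrices and symbols: inserting the integral for each coefficient turns the
bilinear form of a Toeplitz matrix into an integral of the symbol against two trigonometric
polynomials.\<close>

lemma toeplitz_form:
  assumes "integrable circ u" "finite I" "finite J"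
  shows "(\<Sum>i\<in>I. \<Sum>l\<in>J. v i * fc u (\<sigma> i - \<tau> l) * w l) =
    1 / (2 * of_real pi) * (\<integral>\<theta>. u \<theta> * (trigp (\<lambda>i. - \<sigma> i) I v \<theta> * trigp \<tau> J w \<theta>) \<partial>circ)"
proof -
  have e: "u \<theta> * (trigp (\<lambda>i. - \<sigma> i) I v \<theta> * trigp \<tau> J w \<theta>)
     = (\<Sum>i\<in>I. \<Sum>l\<in>J. v i * w l * (u \<theta> * ek (- (\<sigma> i - \<tau> l)) \<theta>))" for \<theta>
  proof -
    have "u \<theta> * (trigp (\<lambda>i. - \<sigma> i) I v \<theta> * trigp \<tau> J w \<theta>)
      = (\<Sum>i\<in>I. \<Sum>l\<in>J. u \<theta> * ((v i * ek (- \<sigma> i) \<theta>) * (w l * ek (\<tau> l) \<theta>)))"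
      unfolding trigp_def sum_product by (simp only: sum_distrib_left)
    also have "\<dots> = (\<Sum>i\<in>I. \<Sum>l\<in>J. v i * w l * (u \<theta> * ek (- (\<sigma> i - \<tau> l)) \<theta>))"
      using ek_add[of "- \<sigma> _" "\<tau> _" \<theta>] by (intro sum.cong refl) (simp add: algebra_simps)
    finally show ?thesis .
  qed
  have "(\<integral>\<theta>. (\<Sum>i\<in>I. \<Sum>l\<in>J. v i * w l * (u \<theta> * ek (- (\<sigma> i - \<tau> l)) \<theta>)) \<partial>circ)
     = (\<Sum>i\<in>I. \<Sum>l\<in>J. v i * w l * (\<integral>\<theta>. u \<theta> * ek (- (\<sigma> i - \<tau> l)) \<theta> \<partial>circ))"
    using assms by (subst Bochner_Integration.integral_sum
        | auto intro!: Bochner_Integration.integrable_sum integrable_mult_right integrable_mult_ek)+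
  then show ?thesis
    unfolding e fc_def
    by (simp add: sum_distrib_left sum_distrib_right algebra_simps sum_divide_distrib)
qed

lemma parseval:
  assumes "finite I" "inj_on \<sigma> I"
  shows "(\<integral>\<theta>. (cmod (trigp \<sigma> I v \<theta>))\<^sup>2 \<partial>circ) = 2 * pi * (\<Sum>i\<in>I. (cmod (v i))\<^sup>2)"
proof -
  have int1: "integrable circ (\<lambda>\<theta>. 1 :: complex)" by (rule integrable_bounded_circ[of _ 1]) auto
  have fc1: "fc (\<lambda>\<theta>. 1) j = (if j = 0 then 1 else 0)" for j
    using fc_ek[of 0 j] by (simp add: fc_def)
  have c: "cnj (trigp \<sigma> I v \<theta>) = trigp (\<lambda>i. - \<sigma> i) I (\<lambda>i. cnj (v i)) \<theta>" for \<theta>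
    by (simp add: trigp_def cnj_ek)
  have "(\<Sum>i\<in>I. \<Sum>l\<in>I. cnj (v i) * fc (\<lambda>\<theta>. 1) (\<sigma> i - \<sigma> l) * v l) =
    1 / (2 * of_real pi) * (\<integral>\<theta>. of_real ((cmod (trigp \<sigma> I v \<theta>))\<^sup>2) \<partial>circ)"
    unfolding toeplitz_form[OF int1 assms(1) assms(1)] c[symmetric]
    by (simp only: complex_norm_square mult_1 mult.commute[of "cnj _"])
  moreover have "(\<Sum>i\<in>I. \<Sum>l\<in>I. cnj (v i) * fc (\<lambda>\<theta>. 1) (\<sigma> i - \<sigma> l) * v l)
     = (\<Sum>i\<in>I. of_real ((cmod (v i))\<^sup>2))"
  proof (rule sum.cong[OF refl])
    fix i assume i: "i \<in> I"
    have "(\<Sum>l\<in>I. cnj (v i) * fc (\<lambda>\<theta>. 1) (\<sigma> i - \<sigma> l) * v l) = (\<Sum>l\<in>I. if i = l then cnj (v i) * v l else 0)"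
      using i assms(2) by (intro sum.cong refl) (auto simp: fc1 inj_on_def)
    also have "\<dots> = of_real ((cmod (v i))\<^sup>2)"
      using i assms(1) by (subst sum.delta') (simp_all add: complex_norm_square[symmetric] mult.commute[of "cnj _"])
    finally show "(\<Sum>l\<in>I. cnj (v i) * fc (\<lambda>\<theta>. 1) (\<sigma> i - \<sigma> l) * v l) = of_real ((cmod (v i))\<^sup>2)" .
  qed
  ultimately have "complex_of_real (\<Sum>i\<in>I. (cmod (v i))\<^sup>2)
     = 1 / (2 * of_real pi) * of_real (\<integral>\<theta>. (cmod (trigp \<sigma> I v \<theta>))\<^sup>2 \<partial>circ)"
    by (simp only: integral_complex_of_real of_real_sum)
  also have "\<dots> = of_real (1 / (2 * pi) * (\<integral>\<theta>. (cmod (trigp \<sigma> I v \<theta>))\<^sup>2 \<partial>circ))"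
    by (simp only: of_real_mult of_real_divide of_real_1 of_real_numeral)
  finally have "(\<Sum>i\<in>I. (cmod (v i))\<^sup>2) = 1 / (2 * pi) * (\<integral>\<theta>. (cmod (trigp \<sigma> I v \<theta>))\<^sup>2 \<partial>circ)"
    by (simp only: of_real_eq_iff)
  then show ?thesis by (simp add: field_simps)
qed

section \<open>Bounded bilinear forms\<close>

definition l2 :: "'i set \<Rightarrow> ('i \<Rightarrow> complex) \<Rightarrow> real" where
  "l2 I v = L2_set (\<lambda>i. cmod (v i)) I"

lemma l2_nonneg [simp]: "0 \<le> l2 I v"
  by (simp add: l2_def)

lemma l2_sq: "(l2 I v)\<^sup>2 = (\<Sum>i\<in>I. (cmod (v i))\<^sup>2)"
  unfolding l2_def L2_set_def by (simp add: sum_nonneg)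

text \<open>The constant \<open>C\<close> bounds the operator norm of the matrix \<open>X\<close>. The bilinear form is
used, without conjugation, since it restricts to submatrices and transposes at no cost.\<close>

definition bform :: "'i set \<Rightarrow> 'j set \<Rightarrow> ('i \<Rightarrow> 'j \<Rightarrow> complex) \<Rightarrow> real \<Rightarrow> bool" where
  "bform I J X C \<longleftrightarrow> 0 \<le> C \<and>
     (\<forall>v w. cmod (\<Sum>i\<in>I. \<Sum>j\<in>J. v i * X i j * w j) \<le> C * l2 I v * l2 J w)"

lemma bformD: "bform I J X C \<Longrightarrow> cmod (\<Sum>i\<in>I. \<Sum>j\<in>J. v i * X i j * w j) \<le> C * l2 I v * l2 J w"
  by (simp add: bform_def)

lemma cauchy_schwarz_l2: "cmod (\<Sum>i\<in>I. v i * w i) \<le> l2 I v * l2 I w"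
proof -
  have "cmod (\<Sum>i\<in>I. v i * w i) \<le> (\<Sum>i\<in>I. \<bar>cmod (v i)\<bar> * \<bar>cmod (w i)\<bar>)"
    by (rule order_trans[OF norm_sum]) (simp add: norm_mult)
  also have "\<dots> \<le> l2 I v * l2 I w" unfolding l2_def by (rule L2_set_mult_ineq)
  finally show ?thesis .
qed

lemma bform_apply:
  assumes "bform I J X C"
  shows "l2 I (\<lambda>i. \<Sum>j\<in>J. X i j * w j) \<le> C * l2 J w"
proof -
  define y where "y = (\<lambda>i. \<Sum>j\<in>J. X i j * w j)"
  have "(\<Sum>i\<in>I. \<Sum>j\<in>J. cnj (y i) * X i j * w j) = of_real ((l2 I y)\<^sup>2)"
  proof -
    have "(\<Sum>i\<in>I. \<Sum>j\<in>J. cnj (y i) * X i j * w j) = (\<Sum>i\<in>I. cnj (y i) * y i)"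
      by (simp add: y_def sum_distrib_left mult.assoc del: cnj_sum)
    then show ?thesis unfolding l2_sq of_real_sum complex_norm_square by (simp add: mult.commute)
  qed
  then have "(l2 I y)\<^sup>2 \<le> C * l2 I (\<lambda>i. cnj (y i)) * l2 J w"
    using bformD[OF assms, of "\<lambda>i. cnj (y i)" w] by (simp add: norm_power)
  then have "l2 I y * l2 I y \<le> l2 I y * (C * l2 J w)"
    by (simp add: l2_def power2_eq_square algebra_simps)
  moreover have "0 \<le> C * l2 J w" using assms by (simp add: bform_def)
  ultimately have "l2 I y \<le> C * l2 J w"
    by (cases "l2 I y = 0") (auto simp: mult_le_cancel_left less_le)
  then show ?thesis by (simp add: y_def)
qed

lemma bformI_apply:
  assumes "0 \<le> C" "\<And>w. l2 I (\<lambda>i. \<Sum>j\<in>J. X i j * w j) \<le> C * l2 J w"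
  shows "bform I J X C"
  unfolding bform_def
proof (intro conjI allI)
  fix v w
  have "cmod (\<Sum>i\<in>I. \<Sum>j\<in>J. v i * X i j * w j) = cmod (\<Sum>i\<in>I. v i * (\<Sum>j\<in>J. X i j * w j))"
    by (simp add: sum_distrib_left mult.assoc)
  also have "\<dots> \<le> l2 I v * l2 I (\<lambda>i. \<Sum>j\<in>J. X i j * w j)" by (rule cauchy_schwarz_l2)
  also have "\<dots> \<le> l2 I v * (C * l2 J w)" by (rule mult_left_mono[OF assms(2)]) simp
  finally show "cmod (\<Sum>i\<in>I. \<Sum>j\<in>J. v i * X i j * w j) \<le> C * l2 I v * l2 J w" by (simp add: algebra_simps)
qed (rule assms)

lemma bform_comp:
  assumes X: "bform I J X C" and Y: "bform J K Y D"
  shows "bform I K (\<lambda>i k. \<Sum>j\<in>J. X i j * Y j k) (C * D)"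
proof (rule bformI_apply)
  have CD: "0 \<le> C" "0 \<le> D" using X Y by (auto simp: bform_def)
  then show "0 \<le> C * D" by simp
  fix w
  have "(\<Sum>k\<in>K. (\<Sum>j\<in>J. X i j * Y j k) * w k) = (\<Sum>j\<in>J. X i j * (\<Sum>k\<in>K. Y j k * w k))" for i
    by (simp add: sum_distrib_left sum_distrib_right mult.assoc) (rule sum.swap)
  then have "l2 I (\<lambda>i. \<Sum>k\<in>K. (\<Sum>j\<in>J. X i j * Y j k) * w k) \<le> C * l2 J (\<lambda>j. \<Sum>k\<in>K. Y j k * w k)"
    using bform_apply[OF X] by simp
  also have "\<dots> \<le> C * (D * l2 K w)" by (rule mult_left_mono[OF bform_apply[OF Y] CD(1)])
  finally show "l2 I (\<lambda>i. \<Sum>k\<in>K. (\<Sum>j\<in>J. X i j * Y j k) * w k) \<le> C * D * l2 K w" by simp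
qed

lemma bform_transpose: 
  assumes "bform I J X C" shows "bform J I (\<lambda>j i. X i j) C"
  unfolding bform_def
proof (intro conjI allI)
  show "0 \<le> C" using assms by (simp add: bform_def)
  fix v w
  have "(\<Sum>j\<in>J. \<Sum>i\<in>I. v j * X i j * w i) = (\<Sum>i\<in>I. \<Sum>j\<in>J. w i * X i j * v j)"
    by (subst sum.swap) (simp add: ac_simps)
  then show "cmod (\<Sum>j\<in>J. \<Sum>i\<in>I. v j * X i j * w i) \<le> C * l2 J v * l2 I w"
    using bformD[OF assms, of w v] by (simp add: ac_simps)
qed

lemma bform_row:
  assumes "bform I J X C" "finite I" "i \<in> I"
  shows "l2 J (X i) \<le> C"
proof -
  have "(\<Sum>i'\<in>I. X i' j * (if i' = i then 1 else 0)) = X i j" for j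
    using assms(2,3) by (subst sum.mono_neutral_right[of I "{i}"]) auto
  moreover have "l2 I (\<lambda>i'. if i' = i then 1 else 0) = 1"
  proof -
    have "(\<Sum>i'\<in>I. (cmod (if i' = i then 1 else 0))\<^sup>2) = 1"
      using assms(2,3) by (subst sum.mono_neutral_right[of I "{i}"]) auto
    then show ?thesis by (simp add: l2_def L2_set_def)
  qed
  ultimately show ?thesis
    using bform_apply[OF bform_transpose[OF assms(1)], of "\<lambda>i'. if i' = i then 1 else 0"] by simp
qed

text \<open>A bounded symbol gives Toeplitz matrices that are bounded by the same constant: in the integral of
\<open>toeplitz_form\<close>, the factor \<open>|p q|\<close> is at most \<open>(t |p|\<^sup>2 + |q|\<^sup>2/t)/2\<close>, and Parseval's identity
evaluates the integrals of the two squares; then \<open>t\<close> is chosen to balance them.\<close>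

lemma bounded_symbol_bform:
  assumes h: "h \<in> borel_measurable circ" and H: "\<And>\<theta>. \<theta> \<in> {-pi..pi} \<Longrightarrow> cmod (h \<theta>) \<le> H"
    and I: "finite I" "inj_on \<sigma> I" and J: "finite J" "inj_on \<tau> J"
  shows "bform I J (\<lambda>i j. fc h (\<sigma> i - \<tau> j)) H"
  unfolding bform_def
proof (intro conjI allI)
  have "cmod (h 0) \<le> H" by (rule H) simp
  then show H0: "0 \<le> H" using norm_ge_zero[of "h 0"] by linarith
  fix v w
  define p where "p = trigp (\<lambda>i. - \<sigma> i) I v"
  define q where "q = trigp \<tau> J w"
  have [measurable]: "p \<in> borel_measurable circ" "q \<in> borel_measurable circ"
    by (auto simp: p_def q_def)
  note [measurable] = h
  have pv: "(\<integral>\<theta>. (cmod (p \<theta>))\<^sup>2 \<partial>circ) = 2 * pi * (l2 I v)\<^sup>2"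
    unfolding p_def l2_sq by (rule parseval) (use I in \<open>auto simp: inj_on_def\<close>)
  have qw: "(\<integral>\<theta>. (cmod (q \<theta>))\<^sup>2 \<partial>circ) = 2 * pi * (l2 J w)\<^sup>2"
    unfolding q_def l2_sq by (rule parseval) (use J in \<open>auto simp: inj_on_def\<close>)
  have bp: "cmod (p \<theta>) \<le> (\<Sum>i\<in>I. cmod (v i))" and bq: "cmod (q \<theta>) \<le> (\<Sum>i\<in>J. cmod (w i))" for \<theta>
    unfolding p_def q_def by (rule norm_trigp_le)+
  have ip: "integrable circ (\<lambda>\<theta>. (cmod (p \<theta>))\<^sup>2)" and iq: "integrable circ (\<lambda>\<theta>. (cmod (q \<theta>))\<^sup>2)"
    by (rule finite_measure.integrable_const_bound[OF finite_measure_circ AE_I2],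
        simp, rule power_mono[OF bp], simp, measurable)
       (rule finite_measure.integrable_const_bound[OF finite_measure_circ AE_I2],
        simp, rule power_mono[OF bq], simp, measurable)
  have key: "cmod (\<Sum>i\<in>I. \<Sum>j\<in>J. v i * fc h (\<sigma> i - \<tau> j) * w j)
      \<le> H * (t * (l2 I v)\<^sup>2 + (l2 J w)\<^sup>2 / t) / 2" if t: "t > 0" for t
  proof -
    have "cmod (\<integral>\<theta>. h \<theta> * (p \<theta> * q \<theta>) \<partial>circ) \<le>
        (\<integral>\<theta>. H * ((t * (cmod (p \<theta>))\<^sup>2 + (cmod (q \<theta>))\<^sup>2 / t) / 2) \<partial>circ)"
    proof (rule order_trans[OF integral_norm_bound], rule integral_mono)
      show "integrable circ (\<lambda>\<theta>. cmod (h \<theta> * (p \<theta> * q \<theta>)))"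
        by (rule integrable_norm, rule integrable_bounded_circ[of _ "H * ((\<Sum>i\<in>I. cmod (v i)) * (\<Sum>i\<in>J. cmod (w i)))"])
           (auto simp: norm_mult intro!: mult_mono H bp bq H0 sum_nonneg)
      show "integrable circ (\<lambda>\<theta>. H * ((t * (cmod (p \<theta>))\<^sup>2 + (cmod (q \<theta>))\<^sup>2 / t) / 2))"
        using ip iq by auto
      fix \<theta> assume "\<theta> \<in> space circ"
      then have "cmod (h \<theta>) \<le> H" using H by simp
      moreover have "cmod (p \<theta>) * cmod (q \<theta>) \<le> (t * (cmod (p \<theta>))\<^sup>2 + (cmod (q \<theta>))\<^sup>2 / t) / 2"
      proof -
        have "0 \<le> (t * cmod (p \<theta>) - cmod (q \<theta>))\<^sup>2" by simp
        then have "2 * t * (cmod (p \<theta>) * cmod (q \<theta>)) \<le> t * (t * (cmod (p \<theta>))\<^sup>2) + (cmod (q \<theta>))\<^sup>2"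
          by (simp add: power2_eq_square algebra_simps)
        then show ?thesis using t by (simp add: field_simps power2_eq_square)
      qed
      ultimately show "cmod (h \<theta> * (p \<theta> * q \<theta>)) \<le> H * ((t * (cmod (p \<theta>))\<^sup>2 + (cmod (q \<theta>))\<^sup>2 / t) / 2)"
        unfolding norm_mult by (intro mult_mono) (auto simp: H0)
    qed
    also have "\<dots> = 2 * pi * (H * (t * (l2 I v)\<^sup>2 + (l2 J w)\<^sup>2 / t) / 2)"
      using ip iq t by (simp add: pv qw field_simps)
    finally have b: "cmod (\<integral>\<theta>. h \<theta> * (p \<theta> * q \<theta>) \<partial>circ) \<le> 2 * pi * (H * (t * (l2 I v)\<^sup>2 + (l2 J w)\<^sup>2 / t) / 2)" .
    have "integrable circ h" by (rule integrable_bounded_circ[OF h H])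
    from toeplitz_form[OF this I(1) J(1), of v \<sigma> \<tau> w, folded p_def q_def]
    have "cmod (\<Sum>i\<in>I. \<Sum>j\<in>J. v i * fc h (\<sigma> i - \<tau> j) * w j)
       = 1 / (2 * pi) * cmod (\<integral>\<theta>. h \<theta> * (p \<theta> * q \<theta>) \<partial>circ)"
      by (simp only: norm_mult norm_divide) simp
    also have "\<dots> \<le> 1 / (2 * pi) * (2 * pi * (H * (t * (l2 I v)\<^sup>2 + (l2 J w)\<^sup>2 / t) / 2))"
      by (rule mult_left_mono[OF b]) simp
    finally show ?thesis by simp
  qed
  show "cmod (\<Sum>i\<in>I. \<Sum>j\<in>J. v i * fc h (\<sigma> i - \<tau> j) * w j) \<le> H * l2 I v * l2 J w"
  proof (cases "l2 I v = 0 \<or> l2 J w = 0")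
    case True
    then have "(\<forall>i\<in>I. v i = 0) \<or> (\<forall>j\<in>J. w j = 0)"
      using I J by (auto simp: l2_def L2_set_eq_0_iff)
    then have "(\<Sum>i\<in>I. \<Sum>j\<in>J. v i * fc h (\<sigma> i - \<tau> j) * w j) = 0"
      by (auto intro!: sum.neutral)
    then show ?thesis using H0 by simp
  next
    case False
    then have pos: "l2 I v > 0" "l2 J w > 0" using l2_nonneg[of I v] l2_nonneg[of J w] by (auto simp: less_le simp del: l2_nonneg)
    \<comment> \<open>The value of t at which the two terms of the bound agree.\<close>
    have "H * (l2 J w / l2 I v * (l2 I v)\<^sup>2 + (l2 J w)\<^sup>2 / (l2 J w / l2 I v)) / 2 = H * l2 I v * l2 J w"
      using pos by (simp add: field_simps power2_eq_square)
    moreover have "l2 J w / l2 I v > 0" using pos by simp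
    ultimately show ?thesis using key[of "l2 J w / l2 I v"] by (simp only:)
  qed
qed

text \<open>The trace equals the mean of \<open>u\<close> times a form of \<open>Z\<close> evaluated at two vectors of
exponentials, each of norm \<open>\<surd>n\<close>. This plays the role of the trace norm estimate for Toeplitz matrices.\<close>

lemma trace_toeplitz_bound:
  assumes Z: "bform {..<n} {..<n} Z C" and u: "integrable circ u"
  shows "cmod (\<Sum>l<n. \<Sum>i<n. Z l i * fc u (int i - int l)) \<le> real n / (2 * pi) * C * (\<integral>\<theta>. cmod (u \<theta>) \<partial>circ)"
proof -
  define S where "S \<theta> = (\<Sum>l<n. \<Sum>i<n. ek (int l) \<theta> * Z l i * ek (- int i) \<theta>)" for \<theta>
  have C0: "0 \<le> C" using Z by (simp add: bform_def)
  have l: "l2 {..<n} (\<lambda>i. ek (m i) \<theta>) = sqrt (real n)" for m \<theta>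
    by (simp add: l2_def L2_set_def)
  have Sb: "cmod (S \<theta>) \<le> C * real n" for \<theta>
    using bformD[OF Z, of "\<lambda>l. ek (int l) \<theta>" "\<lambda>i. ek (- int i) \<theta>"] l unfolding S_def by (simp add: mult.assoc)
  have "(\<Sum>l<n. \<Sum>i<n. Z l i * fc u (int i - int l)) = 1 / (2 * of_real pi) * (\<integral>\<theta>. u \<theta> * S \<theta> \<partial>circ)"
  proof -
    have e: "u \<theta> * S \<theta> = (\<Sum>l<n. \<Sum>i<n. Z l i * (u \<theta> * ek (- (int i - int l)) \<theta>))" for \<theta>
      unfolding S_def sum_distrib_left
      using ek_add[of "int _" "- int _" \<theta>] by (intro sum.cong refl) (simp add: algebra_simps)
    have "(\<integral>\<theta>. (\<Sum>l<n. \<Sum>i<n. Z l i * (u \<theta> * ek (- (int i - int l)) \<theta>)) \<partial>circ)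
       = (\<Sum>l<n. \<Sum>i<n. Z l i * (\<integral>\<theta>. u \<theta> * ek (- (int i - int l)) \<theta> \<partial>circ))"
      using u by (subst Bochner_Integration.integral_sum
        | auto intro!: Bochner_Integration.integrable_sum integrable_mult_right integrable_mult_ek)+
    then show ?thesis unfolding e fc_def
      by (simp add: sum_distrib_left sum_distrib_right algebra_simps sum_divide_distrib)
  qed
  then have "cmod (\<Sum>l<n. \<Sum>i<n. Z l i * fc u (int i - int l)) = 1 / (2 * pi) * cmod (\<integral>\<theta>. u \<theta> * S \<theta> \<partial>circ)"
    by (simp add: norm_mult norm_divide)
  also have "cmod (\<integral>\<theta>. u \<theta> * S \<theta> \<partial>circ) \<le> (\<integral>\<theta>. cmod (u \<theta>) * (C * real n) \<partial>circ)"
  proof (rule order_trans[OF integral_norm_bound], rule integral_mono)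
    have [measurable]: "S \<in> borel_measurable circ" unfolding S_def by measurable
    show "integrable circ (\<lambda>\<theta>. cmod (u \<theta> * S \<theta>))"
      by (intro integrable_norm integrable_mult_bdd[OF u _ Sb]) measurable
    show "integrable circ (\<lambda>\<theta>. cmod (u \<theta>) * (C * real n))" using u by auto
    show "cmod (u \<theta> * S \<theta>) \<le> cmod (u \<theta>) * (C * real n)" for \<theta>
      unfolding norm_mult by (rule mult_left_mono[OF Sb]) simp
  qed
  finally show ?thesis by (simp add: field_simps)
qed
section \<open>Density of trigonometric polynomials\<close>

inductive trig :: "(real \<Rightarrow> complex) \<Rightarrow> bool" where
  trig_ek: "trig (ek m)"
| trig_add: "trig p \<Longrightarrow> trig q \<Longrightarrow> trig (\<lambda>\<theta>. p \<theta> + q \<theta>)"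
| trig_cmult: "trig p \<Longrightarrow> trig (\<lambda>\<theta>. c * p \<theta>)"

lemma trig_continuous: "trig p \<Longrightarrow> continuous_on UNIV p"
  by (induction rule: trig.induct) (auto simp: ek_def intro!: continuous_intros)

lemma trig_measurable: "trig p \<Longrightarrow> p \<in> borel_measurable circ"
  by (intro continuous_borel_circ trig_continuous)

lemma trig_bounded: "trig p \<Longrightarrow> \<exists>B. \<forall>\<theta>. cmod (p \<theta>) \<le> B"
proof (induction rule: trig.induct)
  case (trig_ek m)
  then show ?case by (auto intro: exI[of _ 1])
next
  case (trig_add p q)
  then obtain B B' where "\<And>\<theta>. cmod (p \<theta>) \<le> B" "\<And>\<theta>. cmod (q \<theta>) \<le> B'" by auto
  then show ?case by (auto intro!: exI[of _ "B + B'"] norm_triangle_mono)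
next
  case (trig_cmult p c)
  then obtain B where "\<And>\<theta>. cmod (p \<theta>) \<le> B" by auto
  then show ?case by (auto intro!: exI[of _ "cmod c * B"] mult_left_mono simp: norm_mult)
qed

lemma trig_integrable: "trig p \<Longrightarrow> integrable circ p"
  using trig_bounded trig_measurable integrable_bounded_circ by metis

lemma trig_const: "trig (\<lambda>\<theta>. c)"
  using trig_cmult[OF trig_ek[of 0], of c] by simp

lemma trig_mult: assumes "trig p" "trig q" shows "trig (\<lambda>\<theta>. p \<theta> * q \<theta>)"
  using assms(1)
proof (induction rule: trig.induct)
  case (trig_ek m)
  show ?case using assms(2)
  proof (induction rule: trig.induct)
    case (trig_ek k)
    have "(\<lambda>\<theta>. ek m \<theta> * ek k \<theta>) = ek (m + k)" by (simp add: ek_add fun_eq_iff)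
    then show ?case using trig.trig_ek by metis
  next
    case (trig_add p q)
    then show ?case using trig.trig_add[of "\<lambda>\<theta>. ek m \<theta> * p \<theta>" "\<lambda>\<theta>. ek m \<theta> * q \<theta>"]
      by (simp add: distrib_left)
  next
    case (trig_cmult p c)
    then show ?case using trig.trig_cmult[of "\<lambda>\<theta>. ek m \<theta> * p \<theta>" c]
      by (simp add: mult.left_commute)
  qed
next
  case (trig_add p p')
  then show ?case using trig.trig_add[of "\<lambda>\<theta>. p \<theta> * q \<theta>" "\<lambda>\<theta>. p' \<theta> * q \<theta>"]
    by (simp add: distrib_right)
next
  case (trig_cmult p c)
  then show ?case using trig.trig_cmult[of "\<lambda>\<theta>. p \<theta> * q \<theta>" c] by (simp add: mult.assoc)
qed

text \<open>On the unit circle, real polynomials in the two coordinates are trigonometric polynomials, which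
makes the Stone-Weierstrass theorem available.\<close>

lemma trig_polynomial_cis:
  assumes "real_polynomial_function p"
  shows "trig (\<lambda>\<theta>. of_real (p (cis \<theta>)))"
  using assms
proof (induction rule: real_polynomial_function.induct)
  case (linear f)
  interpret bounded_linear f by fact
  have "of_real (f (cis \<theta>)) =
     (of_real (f 1) / 2 + of_real (f \<i>) / (2 * \<i>)) * ek 1 \<theta> +
     (of_real (f 1) / 2 - of_real (f \<i>) / (2 * \<i>)) * ek (-1) \<theta>" for \<theta>
  proof -
    have "cis \<theta> = cos \<theta> *\<^sub>R 1 + sin \<theta> *\<^sub>R \<i>" by (simp add: complex_eq_iff)
    then have "f (cis \<theta>) = cos \<theta> * f 1 + sin \<theta> * f \<i>" by (simp add: add scaleR)
    then show ?thesis by (simp add: ek_cis complex_eq_iff field_simps)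
  qed
  then show ?case
    by (simp only:) (intro trig.intros)
next
  case (const c)
  then show ?case by (rule trig_const)
next
  case (add f g)
  then show ?case using trig_add by fastforce
next
  case (mult f g)
  then show ?case using trig_mult by fastforce
qed

definition trig_approx :: "(real \<Rightarrow> complex) \<Rightarrow> bool" where
  "trig_approx k \<longleftrightarrow> integrable circ k \<and>
     (\<forall>e>0. \<exists>p. trig p \<and> (\<integral>\<theta>. cmod (k \<theta> - p \<theta>) \<partial>circ) < e)"

lemma trig_approxI:
  assumes k: "integrable circ k"
    and a: "\<And>e. e > 0 \<Longrightarrow> \<exists>k'. trig_approx k' \<and> (\<integral>\<theta>. cmod (k \<theta> - k' \<theta>) \<partial>circ) < e"
  shows "trig_approx k"
  unfolding trig_approx_def
proof (intro conjI allI impI)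
  fix e :: real assume "e > 0"
  then have "e / 2 > 0" by simp
  from a[OF this] obtain k' where k': "integrable circ k'" "(\<integral>\<theta>. cmod (k \<theta> - k' \<theta>) \<partial>circ) < e / 2"
    and "\<exists>p. trig p \<and> (\<integral>\<theta>. cmod (k' \<theta> - p \<theta>) \<partial>circ) < e / 2"
    using \<open>e / 2 > 0\<close> unfolding trig_approx_def by blast
  then obtain p where p: "trig p" "(\<integral>\<theta>. cmod (k' \<theta> - p \<theta>) \<partial>circ) < e / 2" by auto
  note ip = trig_integrable[OF p(1)]
  have "(\<integral>\<theta>. cmod (k \<theta> - p \<theta>) \<partial>circ) \<le> (\<integral>\<theta>. cmod (k \<theta> - k' \<theta>) + cmod (k' \<theta> - p \<theta>) \<partial>circ)"
    by (rule integral_mono) (use k k' ip in \<open>auto intro: norm_diff_triangle_ineq norm_triangle_ineq4 norm_triangle_sub order_trans[OF _ norm_triangle_ineq]\<close>)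
  also have "\<dots> = (\<integral>\<theta>. cmod (k \<theta> - k' \<theta>) \<partial>circ) + (\<integral>\<theta>. cmod (k' \<theta> - p \<theta>) \<partial>circ)"
    using k k' ip by (intro Bochner_Integration.integral_add) auto
  also have "\<dots> < e" using k' p by simp
  finally show "\<exists>p. trig p \<and> (\<integral>\<theta>. cmod (k \<theta> - p \<theta>) \<partial>circ) < e" using p(1) by blast
qed (rule k)

lemma trig_approx_add:
  assumes "trig_approx k" "trig_approx k'" shows "trig_approx (\<lambda>\<theta>. k \<theta> + k' \<theta>)"
  unfolding trig_approx_def
proof (intro conjI allI impI)
  have i: "integrable circ k" "integrable circ k'" using assms by (auto simp: trig_approx_def)
  then show "integrable circ (\<lambda>\<theta>. k \<theta> + k' \<theta>)" by simp
  fix e :: real assume "e > 0"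
  then have "e / 2 > 0" by simp
  with assms obtain p p' where p: "trig p" "(\<integral>\<theta>. cmod (k \<theta> - p \<theta>) \<partial>circ) < e / 2"
    and p': "trig p'" "(\<integral>\<theta>. cmod (k' \<theta> - p' \<theta>) \<partial>circ) < e / 2"
    unfolding trig_approx_def by metis
  note ip = trig_integrable[OF p(1)] trig_integrable[OF p'(1)]
  have "(\<integral>\<theta>. cmod (k \<theta> + k' \<theta> - (p \<theta> + p' \<theta>)) \<partial>circ) \<le> (\<integral>\<theta>. cmod (k \<theta> - p \<theta>) + cmod (k' \<theta> - p' \<theta>) \<partial>circ)"
    by (rule integral_mono) (use i ip in \<open>auto intro: norm_diff_triangle_ineq\<close>)
  also have "\<dots> = (\<integral>\<theta>. cmod (k \<theta> - p \<theta>) \<partial>circ) + (\<integral>\<theta>. cmod (k' \<theta> - p' \<theta>) \<partial>circ)"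
    using i ip by (intro Bochner_Integration.integral_add) auto
  also have "\<dots> < e" using p' p by simp
  finally show "\<exists>p. trig p \<and> (\<integral>\<theta>. cmod (k \<theta> + k' \<theta> - p \<theta>) \<partial>circ) < e"
    using trig_add[OF p(1) p'(1)] by blast
qed

lemma trig_approx_cmult:
  assumes "trig_approx k" shows "trig_approx (\<lambda>\<theta>. c * k \<theta>)"
  unfolding trig_approx_def
proof (intro conjI allI impI)
  have i: "integrable circ k" using assms by (auto simp: trig_approx_def)
  then show "integrable circ (\<lambda>\<theta>. c * k \<theta>)" by simp
  fix e :: real assume "e > 0"
  have pos: "cmod c + 1 > 0" by (simp add: add_nonneg_pos)
  with \<open>e > 0\<close> have "e / (cmod c + 1) > 0" by simp
  with assms obtain p where p: "trig p" "(\<integral>\<theta>. cmod (k \<theta> - p \<theta>) \<partial>circ) < e / (cmod c + 1)"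
    unfolding trig_approx_def by metis
  have "(\<integral>\<theta>. cmod (c * k \<theta> - c * p \<theta>) \<partial>circ) = cmod c * (\<integral>\<theta>. cmod (k \<theta> - p \<theta>) \<partial>circ)"
    by (simp add: right_diff_distrib[symmetric] norm_mult)
  also have "\<dots> \<le> (cmod c + 1) * (\<integral>\<theta>. cmod (k \<theta> - p \<theta>) \<partial>circ)"
    by (rule mult_right_mono) (auto intro: Bochner_Integration.integral_nonneg)
  also have "\<dots> < e" using p(2) pos by (simp add: pos_less_divide_eq mult.commute)
  finally show "\<exists>p. trig p \<and> (\<integral>\<theta>. cmod (c * k \<theta> - p \<theta>) \<partial>circ) < e"
    using trig_cmult[OF p(1)] by blast
qed

lemma trig_approx_continuous:
  assumes F: "continuous_on (sphere 0 1) (F :: complex \<Rightarrow> real)"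
  shows "trig_approx (\<lambda>\<theta>. of_real (F (cis \<theta>)))"
  unfolding trig_approx_def
proof (intro conjI allI impI)
  have c: "continuous_on UNIV (\<lambda>\<theta>. complex_of_real (F (cis \<theta>)))"
    by (intro continuous_intros continuous_on_compose2[OF F]) (auto intro!: continuous_intros)
  obtain B where B: "\<And>z. z \<in> sphere 0 1 \<Longrightarrow> \<bar>F z\<bar> \<le> B"
    using compact_imp_bounded[OF compact_continuous_image[OF F compact_sphere]]
    unfolding bounded_iff by (metis image_eqI real_norm_def)
  show i: "integrable circ (\<lambda>\<theta>. complex_of_real (F (cis \<theta>)))"
    by (rule integrable_bounded_circ[OF continuous_borel_circ[OF c], of B]) (auto intro: B)
  fix e :: real assume e: "e > 0"
  then have "e / (4 * pi) > 0" by simp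
  then obtain g where g: "real_polynomial_function g" "\<And>z. z \<in> sphere 0 1 \<Longrightarrow> \<bar>F z - g z\<bar> < e / (4 * pi)"
    using Stone_Weierstrass_real_polynomial_function[OF compact_sphere F] by metis
  note t = trig_polynomial_cis[OF g(1)]
  have "(\<integral>\<theta>. cmod (of_real (F (cis \<theta>)) - of_real (g (cis \<theta>))) \<partial>circ) \<le> (\<integral>\<theta>. e / (4 * pi) \<partial>circ)"
  proof (rule integral_mono)
    show "integrable circ (\<lambda>\<theta>. e / (4 * pi))"
      by (rule finite_measure.integrable_const[OF finite_measure_circ])
    show "integrable circ (\<lambda>\<theta>. cmod (of_real (F (cis \<theta>)) - of_real (g (cis \<theta>))))"
      using i trig_integrable[OF t] by auto
    fix \<theta>
    show "cmod (of_real (F (cis \<theta>)) - of_real (g (cis \<theta>))) \<le> e / (4 * pi)"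
      using g(2)[of "cis \<theta>"] by (simp del: of_real_diff add: of_real_diff[symmetric])
  qed
  also have "\<dots> = e / 2" using measure_circ by simp
  also have "\<dots> < e" using e by simp
  finally show "\<exists>p. trig p \<and> (\<integral>\<theta>. cmod (of_real (F (cis \<theta>)) - p \<theta>) \<partial>circ) < e"
    using t by blast
qed

text \<open>The set is squeezed between a closed and an open set of almost the same measure; an Urysohn
function on the circle separates their images. The endpoints are excluded because \<open>cis\<close> identifies them.\<close>

lemma trig_approx_indicator:
  assumes A: "A \<in> sets lebesgue" "A \<subseteq> {-pi<..<pi}"
  shows "trig_approx (\<lambda>\<theta>. indicator A \<theta>)"
proof (rule trig_approxI)
  have m: "(\<lambda>\<theta>. indicator A \<theta> :: complex) \<in> borel_measurable circ"
    using A by (intro borel_measurable_indicator) (auto simp: sets_restrict_space_iff)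
  show i: "integrable circ (\<lambda>\<theta>. indicator A \<theta> :: complex)"
    by (rule integrable_bounded_circ[OF m, of 1]) (simp add: indicator_def)
  fix e :: real assume e: "e > 0"
  then have e2: "e / 2 > 0" by simp
  obtain K where K: "closed K" "K \<subseteq> A" "A - K \<in> lmeasurable" "emeasure lebesgue (A - K) < ennreal (e / 2)"
    using sets_lebesgue_inner_closed[OF A(1) e2] by metis
  obtain U' where U': "open U'" "A \<subseteq> U'" "U' - A \<in> lmeasurable" "emeasure lebesgue (U' - A) < ennreal (e / 2)"
    using sets_lebesgue_outer_open[OF A(1) e2] by metis
  define U where "U = U' \<inter> {-pi<..<pi}"
  have U: "open U" "A \<subseteq> U" using U' A by (auto simp: U_def)
  have Us: "U - K \<in> sets lebesgue" using U K by auto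
  have "bounded K" using K(2) A(2)
    by (intro bounded_subset[OF bounded_closed_interval[of "-pi" pi]]) force
  then have cK: "compact (cis ` K)"
    using K(1) by (intro compact_continuous_image continuous_intros) (auto simp: compact_eq_bounded_closed)
  have cL: "compact (cis ` ({-pi..pi} - U))"
    using U(1) by (intro compact_continuous_image continuous_intros compact_diff) auto
  have disj: "cis ` ({-pi..pi} - U) \<inter> cis ` K = {}"
  proof -
    have "False" if "x \<in> {-pi..pi}" "x \<notin> U" "y \<in> K" "cis x = cis y" for x y
    proof -
      have y: "y \<in> {-pi<..<pi}" "y \<in> U" using that K U A by auto
      have "Arg (cis y) = y" using y by (intro cis_Arg_unique) (auto simp: sgn_if)
      show False
      proof (cases "x = -pi")
        case True
        then have "cis x = cis pi" by (simp add: complex_eq_iff)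
        moreover have "Arg (cis pi) = pi" by (intro cis_Arg_unique) (auto simp: sgn_if)
        ultimately have "Arg (cis x) = pi" by metis
        then show ?thesis using y that \<open>Arg (cis y) = y\<close> by auto
      next
        case False
        then have "Arg (cis x) = x" using that by (intro cis_Arg_unique) (auto simp: sgn_if)
        then show ?thesis using y that \<open>Arg (cis y) = y\<close> by auto
      qed
    qed
    then show ?thesis by blast
  qed
  obtain F :: "complex \<Rightarrow> real" where F: "continuous_on UNIV F" "\<And>z. F z \<in> closed_segment 0 1"
     "\<And>z. z \<in> cis ` ({-pi..pi} - U) \<Longrightarrow> F z = 0" "\<And>z. z \<in> cis ` K \<Longrightarrow> F z = 1"
    using Urysohn[OF compact_imp_closed[OF cL] compact_imp_closed[OF cK] disj, of 0 1] by blast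
  have "continuous_on (sphere 0 1) F" using F(1) by (rule continuous_on_subset) simp
  note ta = trig_approx_continuous[OF this]
  have "(\<integral>\<theta>. cmod (indicator A \<theta> - of_real (F (cis \<theta>))) \<partial>circ) \<le> (\<integral>\<theta>. indicator (U - K) \<theta> \<partial>circ)"
  proof (rule integral_mono)
    show "integrable circ (\<lambda>\<theta>. cmod (indicator A \<theta> - of_real (F (cis \<theta>))))"
      using i ta by (auto simp: trig_approx_def)
    have "U - K \<in> sets circ" using Us by (auto simp: sets_restrict_space_iff U_def)
    then show "integrable circ (\<lambda>\<theta>. indicator (U - K) \<theta> :: real)"
      using finite_measure.emeasure_finite[OF finite_measure_circ]
      by (auto intro!: integrable_real_indicator simp: less_top[symmetric])
    fix \<theta> assume "\<theta> \<in> space circ"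
    then have th: "\<theta> \<in> {-pi..pi}" by simp
    have "0 \<le> F (cis \<theta>)" "F (cis \<theta>) \<le> 1" using F(2)[of "cis \<theta>"] by (auto simp: closed_segment_eq_real_ivl)
    moreover have "F (cis \<theta>) = 1" if "\<theta> \<in> K" using that F(4) by auto
    moreover have "F (cis \<theta>) = 0" if "\<theta> \<notin> U" using that F(3) th by auto
    moreover have "cmod (indicator A \<theta> - of_real (F (cis \<theta>))) = \<bar>indicator A \<theta> - F (cis \<theta>)\<bar>"
      by (cases "\<theta> \<in> A") (simp_all, metis norm_of_real of_real_1 of_real_diff)
    ultimately show "cmod (indicator A \<theta> - of_real (F (cis \<theta>))) \<le> indicator (U - K) \<theta>"
      using K(2) U(2)
      by (cases "\<theta> \<in> A"; cases "\<theta> \<in> U"; cases "\<theta> \<in> K") (auto simp: indicator_def)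
  qed
  also have "\<dots> = measure lebesgue (U - K)"
    using Us by (simp add: measure_restrict_space U_def Int_absorb1 Diff_subset le_infI2 greaterThanLessThan_subseteq_atLeastAtMost_iff) (auto intro!: arg_cong[of _ _ "measure lebesgue"])
  also have "\<dots> < e"
  proof -
    have "emeasure lebesgue (U - K) \<le> emeasure lebesgue ((A - K) \<union> (U' - A))"
      using K(3) U'(3) by (intro emeasure_mono) (auto simp: U_def fmeasurable_def)
    also have "\<dots> \<le> emeasure lebesgue (A - K) + emeasure lebesgue (U' - A)"
      using K(3) U'(3) by (intro emeasure_subadditive) (auto simp: fmeasurable_def)
    also have "\<dots> < ennreal (e / 2) + ennreal (e / 2)" using K(4) U'(4) by (rule add_strict_mono)
    also have "\<dots> = ennreal e" using e by (simp add: ennreal_plus[symmetric] del: ennreal_plus)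
    finally have "emeasure lebesgue (U - K) < ennreal e" .
    then show ?thesis using e
      by (metis Sigma_Algebra.measure_def enn2real_less_iff ennreal_less_top order.strict_trans)
  qed
  finally show "\<exists>k'. trig_approx k' \<and> (\<integral>\<theta>. cmod (indicator A \<theta> - k' \<theta>) \<partial>circ) < e"
    using ta by blast
qed

theorem trig_dense:
  assumes "integrable circ k" shows "trig_approx k"
  using assms
proof (induction rule: integrable_induct)
  case (base A c)
  define A' where "A' = A \<inter> {-pi<..<pi}"
  have A: "A \<in> sets lebesgue" "A \<subseteq> {-pi..pi}" using base by (auto simp: sets_restrict_space_iff)
  have A': "A' \<in> sets lebesgue" "A' \<subseteq> {-pi<..<pi}" using A by (auto simp: A'_def)
  have ta: "trig_approx (\<lambda>\<theta>. c * indicator A' \<theta>)" by (rule trig_approx_cmult[OF trig_approx_indicator[OF A']])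
  show ?case
  proof (rule trig_approxI)
    show "integrable circ (\<lambda>\<theta>. indicat_real A \<theta> *\<^sub>R c)" using base by (auto intro!: integrable_indicator)
    fix e :: real assume "e > 0"
    have n: "{-pi, pi} \<in> null_sets circ"
      by (auto simp: null_sets_restrict_space)
    have "(\<integral>\<theta>. cmod (indicat_real A \<theta> *\<^sub>R c - c * indicator A' \<theta>) \<partial>circ) = 0"
    proof (rule integral_eq_zero_AE, rule AE_mp[OF AE_not_in[OF n]], rule AE_I2, rule impI)
      fix x assume "x \<in> space circ" "x \<notin> {-pi, pi}"
      then show "cmod (indicat_real A x *\<^sub>R c - c * indicator A' x) = 0"
        using A by (auto simp: A'_def indicator_def)
    qed
    then show "\<exists>k'. trig_approx k' \<and> (\<integral>\<theta>. cmod (indicat_real A \<theta> *\<^sub>R c - k' \<theta>) \<partial>circ) < e"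
      using ta \<open>e > 0\<close> by (intro exI[of _ "\<lambda>\<theta>. c * indicator A' \<theta>"]) auto
  qed
next
  case (add f g)
  then show ?case by (auto intro: trig_approx_add)
next
  case (lim f s)
  have int_s: "integrable circ (s i)" and ta: "trig_approx (s i)" for i by fact+
  have int_f: "integrable circ f" by fact
  have conv: "(\<lambda>i. s i x) \<longlonglongrightarrow> f x" if "x \<in> space circ" for x using that by fact
  have bnd: "norm (s i x) \<le> 2 * norm (f x)" if "x \<in> space circ" for i x using that by fact
  show ?case
  proof (rule trig_approxI[OF int_f])
    fix e :: real assume "e > 0"
    have "(\<lambda>i. \<integral>\<theta>. cmod (f \<theta> - s i \<theta>) \<partial>circ) \<longlonglongrightarrow> (\<integral>\<theta>. 0 \<partial>circ)"
    proof (rule integral_dominated_convergence[of _ _ _ "\<lambda>\<theta>. 3 * cmod (f \<theta>)"])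
      show "integrable circ (\<lambda>\<theta>. 3 * cmod (f \<theta>))" using int_f by auto
      show "(\<lambda>\<theta>. cmod (f \<theta> - s i \<theta>)) \<in> borel_measurable circ" for i
        using int_s[of i] int_f by auto
      show "AE \<theta> in circ. (\<lambda>i. cmod (f \<theta> - s i \<theta>)) \<longlonglongrightarrow> 0"
      proof (rule AE_I2)
        fix x assume "x \<in> space circ"
        from conv[OF this] have "(\<lambda>i. cmod (f x - s i x)) \<longlonglongrightarrow> cmod (f x - f x)"
          by (intro tendsto_intros)
        then show "(\<lambda>i. cmod (f x - s i x)) \<longlonglongrightarrow> 0" by simp
      qed
      show "AE \<theta> in circ. norm (cmod (f \<theta> - s i \<theta>)) \<le> 3 * cmod (f \<theta>)" for i
      proof (rule AE_I2)
        fix x assume "x \<in> space circ"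
        from bnd[OF this, of i] norm_triangle_ineq4[of "f x" "s i x"]
        show "norm (cmod (f x - s i x)) \<le> 3 * cmod (f x)" by simp
      qed
    qed auto
    then have "eventually (\<lambda>i. (\<integral>\<theta>. cmod (f \<theta> - s i \<theta>) \<partial>circ) < e) sequentially"
      using \<open>e > 0\<close> by (auto dest!: order_tendstoD(2)[of _ _ _ e])
    then obtain i where "(\<integral>\<theta>. cmod (f \<theta> - s i \<theta>) \<partial>circ) < e"
      by (auto simp: eventually_sequentially)
    then show "\<exists>k'. trig_approx k' \<and> (\<integral>\<theta>. cmod (f \<theta> - k' \<theta>) \<partial>circ) < e"
      using ta by blast
  qed
qed

section \<open>Asymptotic multiplicativity for scalar symbols\<close>

text \<open>The entries of \<open>T\<^sub>n(k) T\<^sub>n(h) - T\<^sub>n(kh)\<close>.\<close>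

definition toeplitz_defect :: "(real \<Rightarrow> complex) \<Rightarrow> (real \<Rightarrow> complex) \<Rightarrow> nat \<Rightarrow> nat \<Rightarrow> nat \<Rightarrow> complex" where
  "toeplitz_defect k h n i l = (\<Sum>j<n. fc k (int i - int j) * fc h (int j - int l))
      - fc (\<lambda>\<theta>. k \<theta> * h \<theta>) (int i - int l)"

context
  fixes h :: "real \<Rightarrow> complex" and H :: real
  assumes h: "h \<in> borel_measurable circ" and H: "\<And>\<theta>. \<theta> \<in> {-pi..pi} \<Longrightarrow> cmod (h \<theta>) \<le> H"
begin

lemma toeplitz_defect_add:
  assumes "integrable circ k" "integrable circ k'"
  shows "toeplitz_defect (\<lambda>\<theta>. k \<theta> + k' \<theta>) h n i l = toeplitz_defect k h n i l + toeplitz_defect k' h n i l"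
proof -
  have "fc (\<lambda>\<theta>. (k \<theta> + k' \<theta>) * h \<theta>) j = fc (\<lambda>\<theta>. k \<theta> * h \<theta>) j + fc (\<lambda>\<theta>. k' \<theta> * h \<theta>) j" for j
    unfolding distrib_right
    by (rule fc_add[OF integrable_mult_bdd[OF assms(1) h H] integrable_mult_bdd[OF assms(2) h H]])
  then show ?thesis
    unfolding toeplitz_defect_def by (simp add: fc_add[OF assms] distrib_right sum.distrib)
qed

lemma toeplitz_defect_cmult: "toeplitz_defect (\<lambda>\<theta>. c * k \<theta>) h n i l = c * toeplitz_defect k h n i l"
  unfolding toeplitz_defect_def by (simp add: fc_cmult mult.assoc sum_distrib_left right_diff_distrib)

text \<open>By cyclicity the factor \<open>T\<^sub>n(h)\<close> can be moved to \<open>X\<close>, where it only changes the operator norm;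
what is left is linear in \<open>k\<close>, so that \<open>trace_toeplitz_bound\<close> applies.\<close>

lemma toeplitz_defect_bound:
  assumes X: "bform {..<n} {..<n} X C" and k: "integrable circ k"
  shows "cmod (\<Sum>l<n. \<Sum>i<n. X l i * toeplitz_defect k h n i l) \<le> real n / pi * (C * H) * (\<integral>\<theta>. cmod (k \<theta>) \<partial>circ)"
proof -
  have "cmod (h 0) \<le> H" by (rule H) simp
  then have H0: "0 \<le> H" using norm_ge_zero[of "h 0"] by linarith
  have C0: "0 \<le> C" using X by (simp add: bform_def)
  define Z where "Z j i = (\<Sum>l<n. fc h (int j - int l) * X l i)" for j i
  have Z: "bform {..<n} {..<n} Z (H * C)"
    unfolding Z_def
    by (rule bform_comp[OF bounded_symbol_bform[OF h H, of "{..<n}" int "{..<n}" int] X]) auto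
  have "(\<Sum>l<n. \<Sum>i<n. X l i * (\<Sum>j<n. fc k (int i - int j) * fc h (int j - int l)))
      = (\<Sum>l<n. \<Sum>i<n. \<Sum>j<n. fc h (int j - int l) * X l i * fc k (int i - int j))"
    by (simp add: sum_distrib_left ac_simps)
  also have "\<dots> = (\<Sum>l<n. \<Sum>j<n. \<Sum>i<n. fc h (int j - int l) * X l i * fc k (int i - int j))"
    by (rule sum.cong[OF refl], rule sum.swap)
  also have "\<dots> = (\<Sum>j<n. \<Sum>l<n. \<Sum>i<n. fc h (int j - int l) * X l i * fc k (int i - int j))"
    by (rule sum.swap)
  also have "\<dots> = (\<Sum>j<n. \<Sum>i<n. \<Sum>l<n. fc h (int j - int l) * X l i * fc k (int i - int j))"
    by (rule sum.cong[OF refl], rule sum.swap)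
  also have "\<dots> = (\<Sum>j<n. \<Sum>i<n. Z j i * fc k (int i - int j))"
    by (simp add: Z_def sum_distrib_right)
  finally have eq: "(\<Sum>l<n. \<Sum>i<n. X l i * toeplitz_defect k h n i l) =
     (\<Sum>j<n. \<Sum>i<n. Z j i * fc k (int i - int j))
     - (\<Sum>l<n. \<Sum>i<n. X l i * fc (\<lambda>\<theta>. k \<theta> * h \<theta>) (int i - int l))"
    by (simp add: toeplitz_defect_def right_diff_distrib sum_subtractf)
  have i: "integrable circ (\<lambda>\<theta>. k \<theta> * h \<theta>)" by (rule integrable_mult_bdd[OF k h H])
  have "cmod (\<Sum>l<n. \<Sum>i<n. X l i * fc (\<lambda>\<theta>. k \<theta> * h \<theta>) (int i - int l))
     \<le> real n / (2 * pi) * C * (\<integral>\<theta>. cmod (k \<theta> * h \<theta>) \<partial>circ)"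
    by (rule trace_toeplitz_bound[OF X i])
  also have "\<dots> \<le> real n / (2 * pi) * C * (\<integral>\<theta>. cmod (k \<theta>) * H \<partial>circ)"
    using integrable_norm[OF i] k C0 H
    by (intro mult_left_mono integral_mono) (auto simp: norm_mult intro!: mult_left_mono)
  finally have "cmod (\<Sum>l<n. \<Sum>i<n. X l i * fc (\<lambda>\<theta>. k \<theta> * h \<theta>) (int i - int l))
     \<le> real n / (2 * pi) * (C * H) * (\<integral>\<theta>. cmod (k \<theta>) \<partial>circ)"
    by (simp add: ac_simps)
  moreover have "cmod (\<Sum>j<n. \<Sum>i<n. Z j i * fc k (int i - int j)) \<le> real n / (2 * pi) * (H * C) * (\<integral>\<theta>. cmod (k \<theta>) \<partial>circ)"
    by (rule trace_toeplitz_bound[OF Z k])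
  ultimately have "cmod (\<Sum>l<n. \<Sum>i<n. X l i * toeplitz_defect k h n i l) \<le>
     real n / (2 * pi) * (H * C) * (\<integral>\<theta>. cmod (k \<theta>) \<partial>circ) + real n / (2 * pi) * (C * H) * (\<integral>\<theta>. cmod (k \<theta>) \<partial>circ)"
    unfolding eq by (intro order_trans[OF norm_triangle_ineq4] add_mono)
  also have "\<dots> = real n / pi * (C * H) * (\<integral>\<theta>. cmod (k \<theta>) \<partial>circ)" by (simp add: field_simps)
  finally show ?thesis .
qed

text \<open>The coefficients of \<open>exp(\<i>m\<theta>)\<close> only shift the rows of \<open>T\<^sub>n(h)\<close> by \<open>m\<close>. The defect thus
vanishes except in the rows that are shifted out of the matrix, and each such row contributes at
most \<open>C H\<close>.\<close>

lemma toeplitz_defect_ek: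
  assumes X: "bform {..<n} {..<n} X C"
  shows "cmod (\<Sum>l<n. \<Sum>i<n. X l i * toeplitz_defect (ek m) h n i l) \<le> 2 * real_of_int \<bar>m\<bar> * (C * H)"
proof -
  have "cmod (h 0) \<le> H" by (rule H) simp
  then have H0: "0 \<le> H" using norm_ge_zero[of "h 0"] by linarith
  have C0: "0 \<le> C" using X by (simp add: bform_def)
  \<comment> \<open>The rows that the shift by m moves out of the matrix.\<close>
  define S where "S = {i. i < n \<and> \<not> (0 \<le> int i - m \<and> int i - m < int n)}"
  have S: "S \<subseteq> {..<n}" "finite S" by (auto simp: S_def)
  have shift: "int i - int l - m = int i - m - int l" for i l by simp
  have err: "toeplitz_defect (ek m) h n i l = (if i \<in> S then - fc h (int i - m - int l) else 0)" if "i < n" for i l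
  proof (cases "i \<in> S")
    case True
    then have "(\<Sum>j<n. fc (ek m) (int i - int j) * fc h (int j - int l)) = 0"
      by (intro sum.neutral) (auto simp: fc_ek S_def)
    then show ?thesis using True unfolding toeplitz_defect_def fc_ek_mult shift by simp
  next
    case False
    define j where "j = nat (int i - m)"
    have j: "j < n" "int j = int i - m" using False that by (auto simp: S_def j_def)
    have "(\<Sum>j<n. fc (ek m) (int i - int j) * fc h (int j - int l))
        = (\<Sum>j'<n. if j' = j then fc h (int j' - int l) else 0)"
      using j by (intro sum.cong refl) (auto simp: fc_ek)
    then show ?thesis using False j unfolding toeplitz_defect_def fc_ek_mult shift by simp
  qed
  have cS: "real (card S) \<le> 2 * real_of_int \<bar>m\<bar>"
  proof -
    have "S \<subseteq> {..<nat \<bar>m\<bar>} \<union> {n - nat \<bar>m\<bar>..<n}" by (auto simp: S_def)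
    then have "card S \<le> card ({..<nat \<bar>m\<bar>} \<union> {n - nat \<bar>m\<bar>..<n})" by (intro card_mono) auto
    also have "\<dots> \<le> nat \<bar>m\<bar> + (n - (n - nat \<bar>m\<bar>))" by (rule order_trans[OF card_Un_le]) simp
    also have "\<dots> \<le> nat \<bar>m\<bar> + nat \<bar>m\<bar>" using diff_le_self[of "n" "nat \<bar>m\<bar>"] by (intro add_left_mono) linarith
    finally show ?thesis by linarith
  qed
  have col: "cmod (\<Sum>l<n. X l i * toeplitz_defect (ek m) h n i l) \<le> C * H" if i: "i \<in> S" for i
  proof -
    have "(\<Sum>l<n. X l i * toeplitz_defect (ek m) h n i l) = (\<Sum>l<n. X l i * - fc h (int i - m - int l))"
      using i S by (intro sum.cong refl) (subst err, auto)
    also have "cmod \<dots> \<le> l2 {..<n} (\<lambda>l. X l i) * l2 {..<n} (\<lambda>l. - fc h (int i - m - int l))"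
      by (rule cauchy_schwarz_l2)
    also have "\<dots> \<le> C * H"
    proof (rule mult_mono)
      show "l2 {..<n} (\<lambda>l. X l i) \<le> C"
        using bform_row[OF bform_transpose[OF X]] i S by auto
      have "bform {i} {..<n} (\<lambda>i j. fc h ((int i - m) - int j)) H"
        by (rule bounded_symbol_bform[OF h H]) auto
      from bform_row[OF this] show "l2 {..<n} (\<lambda>l. - fc h (int i - m - int l)) \<le> H"
        by (simp add: l2_def)
    qed (auto simp: C0)
    finally show ?thesis .
  qed
  have "(\<Sum>l<n. \<Sum>i<n. X l i * toeplitz_defect (ek m) h n i l) = (\<Sum>i<n. \<Sum>l<n. X l i * toeplitz_defect (ek m) h n i l)"
    by (rule sum.swap)
  also have "\<dots> = (\<Sum>i\<in>S. \<Sum>l<n. X l i * toeplitz_defect (ek m) h n i l)"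
    using S by (intro sum.mono_neutral_right) (auto simp: err)
  also have "cmod \<dots> \<le> (\<Sum>i\<in>S. C * H)" by (rule order_trans[OF norm_sum]) (rule sum_mono[OF col])
  also have "\<dots> = real (card S) * (C * H)" by simp
  also have "\<dots> \<le> 2 * real_of_int \<bar>m\<bar> * (C * H)" by (rule mult_right_mono[OF cS]) (simp add: C0 H0)
  finally show ?thesis .
qed

theorem scalar_asymptotic_multiplicativity:
  assumes X: "\<And>n. bform {..<n} {..<n} (X n) C" and k: "integrable circ k"
  shows "(\<lambda>n. (\<Sum>l<n. \<Sum>i<n. X n l i * toeplitz_defect k h n i l) / of_nat n) \<longlonglongrightarrow> 0"
proof -
  define E where "E k n = (\<Sum>l<n. \<Sum>i<n. X n l i * toeplitz_defect k h n i l) / of_nat n" for k n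
  have "cmod (h 0) \<le> H" by (rule H) simp
  then have H0: "0 \<le> H" using norm_ge_zero[of "h 0"] by linarith
  have C0: "0 \<le> C" using X by (simp add: bform_def)
  have add: "E (\<lambda>\<theta>. k \<theta> + k' \<theta>) = (\<lambda>n. E k n + E k' n)" if "integrable circ k" "integrable circ k'" for k k'
    by (simp add: E_def toeplitz_defect_add[OF that] distrib_left sum.distrib add_divide_distrib fun_eq_iff)
  have cmult: "E (\<lambda>\<theta>. c * k \<theta>) = (\<lambda>n. c * E k n)" for c k
    by (simp add: E_def toeplitz_defect_cmult sum_distrib_left ac_simps fun_eq_iff)
  have trig: "E p \<longlonglongrightarrow> 0" if "trig p" for p
    using that
  proof (induction rule: trig.induct)
    case (trig_ek m)
    have "\<forall>n. norm (E (ek m) n) \<le> 2 * real_of_int \<bar>m\<bar> * (C * H) * inverse (real n)"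
      unfolding E_def using toeplitz_defect_ek[OF X, of _ m]
      by (auto simp: norm_divide norm_mult norm_inverse divide_inverse intro!: mult_right_mono)
    moreover have "(\<lambda>n. 2 * real_of_int \<bar>m\<bar> * (C * H) * inverse (real n)) \<longlonglongrightarrow> 0"
      by (intro tendsto_mult_right_zero lim_inverse_n)
    ultimately show ?case by (rule Lim_null_comparison[OF always_eventually])
  next
    case (trig_add p q)
    then show ?case unfolding add[OF trig_integrable[OF trig_add(1)] trig_integrable[OF trig_add(2)]]
      by (auto intro: tendsto_add_zero)
  next
    case (trig_cmult p c)
    then show ?case unfolding cmult by (auto intro: tendsto_mult_right_zero)
  qed
  have bd: "cmod (E k n) \<le> (C * H / pi) * (\<integral>\<theta>. cmod (k \<theta>) \<partial>circ)" if "integrable circ k" for k n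
  proof (cases "n = 0")
    case True
    then show ?thesis using C0 H0 by (simp add: E_def)
  next
    case False
    then show ?thesis using toeplitz_defect_bound[OF X[of n] that]
      by (simp add: E_def norm_divide field_simps)
  qed
  have "E k \<longlonglongrightarrow> 0"
  proof (rule LIMSEQ_I)
    fix r :: real assume r: "r > 0"
    define e where "e = r / 2 / (C * H / pi + 1)"
    have den: "C * H / pi + 1 > 0" using C0 H0 by (intro add_nonneg_pos) auto
    then have "e > 0" using r by (simp add: e_def)
    then obtain p where p: "trig p" "(\<integral>\<theta>. cmod (k \<theta> - p \<theta>) \<partial>circ) < e"
      using trig_dense[OF k] by (auto simp: trig_approx_def)
    note ip = trig_integrable[OF p(1)]
    from LIMSEQ_D[OF trig[OF p(1)], of "r/2"] r obtain N where N: "\<And>n. n \<ge> N \<Longrightarrow> cmod (E p n) < r / 2" by auto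
    have "cmod (E k n) < r" if "n \<ge> N" for n
    proof -
      have "E k n = E p n + E (\<lambda>\<theta>. k \<theta> - p \<theta>) n"
        using fun_cong[OF add[of p "\<lambda>\<theta>. k \<theta> - p \<theta>"], of n] ip k by simp
      then have "cmod (E k n) \<le> cmod (E p n) + cmod (E (\<lambda>\<theta>. k \<theta> - p \<theta>) n)" by (simp add: norm_triangle_ineq)
      moreover have "cmod (E (\<lambda>\<theta>. k \<theta> - p \<theta>) n) \<le> (C * H / pi) * (\<integral>\<theta>. cmod (k \<theta> - p \<theta>) \<partial>circ)"
        using ip k by (intro bd) auto
      moreover have "\<dots> \<le> (C * H / pi + 1) * e"
        using p(2) C0 H0 by (intro mult_mono) (auto intro!: Bochner_Integration.integral_nonneg)
      moreover have "D * (r / 2 / D) = r / 2" if "D > 0" for D :: real using that by simp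
      from this[OF den] have "(C * H / pi + 1) * e = r / 2" by (simp only: e_def)
      ultimately show ?thesis using N[OF that] by linarith
    qed
    then show "\<exists>N. \<forall>n\<ge>N. norm (E k n - 0) < r" by auto
  qed
  then show ?thesis by (simp add: E_def[abs_def])
qed

end

section \<open>Hermitian matrices, traces and resolvents\<close>

lemma adjoint_dim [simp]:
  "dim_row (mat_adjoint A) = dim_col A" "dim_col (mat_adjoint A) = dim_row A"
  by (simp_all add: mat_adjoint_def)

lemma adjoint_index [simp]:
  fixes A :: "complex mat"
  assumes "i < dim_col A" "j < dim_row A"
  shows "mat_adjoint A $$ (i, j) = cnj (A $$ (j, i))"
  using assms by (simp add: mat_adjoint_def mat_of_rows_index)

text \<open>Entries of products are kept atomic by default, so that the simplifier can treat identities
between products as linear identities between atoms; this rule expands them where that is wanted.\<close>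

lemma mat_mult_index:
  "i < dim_row A \<Longrightarrow> j < dim_col B \<Longrightarrow> dim_col A = dim_row B \<Longrightarrow>
    (A * B) $$ (i, j) = (\<Sum>k<dim_row B. A $$ (i, k) * B $$ (k, j))"
  by (auto simp: scalar_prod_def lessThan_atLeast0 intro!: sum.cong)

declare index_mult_mat(1) [simp del]

lemma adjoint_adjoint [simp]: "mat_adjoint (mat_adjoint A) = (A :: complex mat)"
  by (rule eq_matI) auto

lemma adjoint_mult [simp]:
  "dim_col A = dim_row B \<Longrightarrow> mat_adjoint (A * B) = mat_adjoint B * mat_adjoint (A :: complex mat)"
  by (rule eq_matI) (auto simp: mat_mult_index intro!: sum.cong)

lemma adjoint_add [simp]:
  "dim_row A = dim_row B \<Longrightarrow> dim_col A = dim_col B \<Longrightarrow>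
    mat_adjoint (A + B) = mat_adjoint A + mat_adjoint (B :: complex mat)"
  by (rule eq_matI) auto

lemma adjoint_minus [simp]:
  "dim_row A = dim_row B \<Longrightarrow> dim_col A = dim_col B \<Longrightarrow>
    mat_adjoint (A - B) = mat_adjoint A - mat_adjoint (B :: complex mat)"
  by (rule eq_matI) auto

lemma adjoint_smult [simp]: "mat_adjoint (c \<cdot>\<^sub>m A) = cnj c \<cdot>\<^sub>m mat_adjoint (A :: complex mat)"
  by (rule eq_matI) auto

lemma adjoint_one [simp]: "mat_adjoint (1\<^sub>m n) = (1\<^sub>m n :: complex mat)"
  by (rule eq_matI) auto

lemma mm_assoc:
  "dim_col A = dim_row B \<Longrightarrow> dim_col B = dim_row C \<Longrightarrow> A * B * C = A * (B * (C :: complex mat))"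
  by (rule assoc_mult_mat[of A "dim_row A" "dim_col A" B "dim_col B" C "dim_col C"]) auto

lemma mm_add_left:
  "dim_row A = dim_row B \<Longrightarrow> dim_col A = dim_col B \<Longrightarrow> dim_col A = dim_row C \<Longrightarrow>
    (A + B) * C = A * C + B * (C :: complex mat)"
  by (rule add_mult_distrib_mat[of A "dim_row A" "dim_col A" B C "dim_col C"]) auto

lemma mm_add_right:
  "dim_row B = dim_row C \<Longrightarrow> dim_col B = dim_col C \<Longrightarrow> dim_col A = dim_row B \<Longrightarrow>
    A * (B + C) = A * B + A * (C :: complex mat)"
  by (rule mult_add_distrib_mat[of A "dim_row A" "dim_col A" B "dim_col B" C]) auto

lemma mm_minus_left:
  "dim_row A = dim_row B \<Longrightarrow> dim_col A = dim_col B \<Longrightarrow> dim_col A = dim_row C \<Longrightarrow>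
    (A - B) * C = A * C - B * (C :: complex mat)"
  by (rule minus_mult_distrib_mat[of A "dim_row A" "dim_col A" B C "dim_col C"]) auto

lemma mm_minus_right:
  "dim_row B = dim_row C \<Longrightarrow> dim_col B = dim_col C \<Longrightarrow> dim_col A = dim_row B \<Longrightarrow>
    A * (B - C) = A * B - A * (C :: complex mat)"
  by (rule mult_minus_distrib_mat[of A "dim_row A" "dim_col A" B "dim_col B" C]) auto

lemma mm_smult_left: "dim_col A = dim_row B \<Longrightarrow> (c \<cdot>\<^sub>m A) * B = c \<cdot>\<^sub>m (A * (B :: complex mat))"
  by (rule eq_matI) (auto simp: mat_mult_index sum_distrib_left ac_simps)

lemma mm_smult_right: "dim_col A = dim_row B \<Longrightarrow> A * (c \<cdot>\<^sub>m B) = c \<cdot>\<^sub>m (A * (B :: complex mat))"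
  by (rule eq_matI) (auto simp: mat_mult_index sum_distrib_left ac_simps)

lemma mm_one_left [simp]: "dim_row A = n \<Longrightarrow> 1\<^sub>m n * A = (A :: complex mat)"
  by (rule left_mult_one_mat[of A n "dim_col A"]) auto

lemma mm_one_right [simp]: "dim_col A = n \<Longrightarrow> A * 1\<^sub>m n = (A :: complex mat)"
  by (rule right_mult_one_mat[of A "dim_row A" n]) auto

lemmas mm_simps = mm_assoc mm_add_left mm_add_right mm_minus_left mm_minus_right
  mm_smult_left mm_smult_right

lemma mat_lin:
  assumes "dim_row A = dim_row B" "dim_col A = dim_col B"
    and "\<And>i j. i < dim_row B \<Longrightarrow> j < dim_col B \<Longrightarrow> A $$ (i, j) = B $$ (i, j)"
  shows "A = (B :: complex mat)"
  by (rule eq_matI) (use assms in auto)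

definition tr :: "complex mat \<Rightarrow> complex" where
  "tr A = (\<Sum>i<dim_row A. A $$ (i, i))"

lemma tr_add: "dim_row A = n \<Longrightarrow> dim_col A = n \<Longrightarrow> dim_row B = n \<Longrightarrow> dim_col B = n \<Longrightarrow> tr (A + B) = tr A + tr B"
  by (simp add: tr_def sum.distrib)

lemma tr_minus: "dim_row A = n \<Longrightarrow> dim_col A = n \<Longrightarrow> dim_row B = n \<Longrightarrow> dim_col B = n \<Longrightarrow> tr (A - B) = tr A - tr B"
  by (simp add: tr_def sum_subtractf)

lemma tr_smult: "dim_row A = dim_col A \<Longrightarrow> tr (c \<cdot>\<^sub>m A) = c * tr A"
  by (simp add: tr_def sum_distrib_left)

lemma tr_one [simp]: "tr (1\<^sub>m n) = of_nat n"
  by (simp add: tr_def)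

lemma tr_comm:
  assumes "dim_row A = dim_col B" "dim_col A = dim_row B"
  shows "tr (A * B) = tr (B * A)"
proof -
  have "tr (A * B) = (\<Sum>i<dim_row A. \<Sum>k<dim_row B. A $$ (i, k) * B $$ (k, i))"
    using assms by (simp add: tr_def mat_mult_index)
  also have "\<dots> = (\<Sum>k<dim_row B. \<Sum>i<dim_row A. B $$ (k, i) * A $$ (i, k))"
    by (subst sum.swap) (simp add: mult.commute)
  also have "\<dots> = tr (B * A)" using assms by (simp add: tr_def mat_mult_index)
  finally show ?thesis .
qed

subsection \<open>Positive matrices\<close>

definition qf :: "complex mat \<Rightarrow> complex mat \<Rightarrow> complex" where
  "qf A w = (mat_adjoint w * A * w) $$ (0, 0)"

text \<open>Vectors are matrices with one column, so that all computations stay within one algebra. Both this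
notion and \<open>pd\<close> include that the matrix is Hermitian.\<close>

definition psd :: "complex mat \<Rightarrow> bool" where
  "psd A \<longleftrightarrow> dim_row A = dim_col A \<and> mat_adjoint A = A \<and>
    (\<forall>w. dim_row w = dim_row A \<and> dim_col w = 1 \<longrightarrow> 0 \<le> Re (qf A w))"

definition pd :: "complex mat \<Rightarrow> bool" where
  "pd A \<longleftrightarrow> dim_row A = dim_col A \<and> mat_adjoint A = A \<and>
    (\<forall>w. dim_row w = dim_row A \<and> dim_col w = 1 \<and> w \<noteq> 0\<^sub>m (dim_row A) 1 \<longrightarrow> 0 < Re (qf A w))"

lemma psdD: "psd A \<Longrightarrow> dim_row w = dim_row A \<Longrightarrow> dim_col w = 1 \<Longrightarrow> 0 \<le> Re (qf A w)"
  and psd_dim: "psd A \<Longrightarrow> dim_row A = dim_col A"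
  and psd_herm: "psd A \<Longrightarrow> mat_adjoint A = A"
  by (auto simp: psd_def)

lemma pdD: "pd A \<Longrightarrow> dim_row w = dim_row A \<Longrightarrow> dim_col w = 1 \<Longrightarrow> w \<noteq> 0\<^sub>m (dim_row A) 1 \<Longrightarrow> 0 < Re (qf A w)"
  by (auto simp: pd_def)

lemma pd_dim: "pd A \<Longrightarrow> dim_row A = dim_col A"
  and pd_herm: "pd A \<Longrightarrow> mat_adjoint A = A"
  by (auto simp: pd_def)

lemma qf_zero: "dim_row A = dim_col A \<Longrightarrow> qf A (0\<^sub>m (dim_row A) 1) = 0"
  by (simp add: qf_def mat_mult_index)

lemma pd_psd: "pd A \<Longrightarrow> psd A"
proof -
  assume A: "pd A"
  have "0 \<le> Re (qf A w)" if "dim_row w = dim_row A" "dim_col w = 1" for w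
    using pdD[OF A that] qf_zero[OF pd_dim[OF A]] by (cases "w = 0\<^sub>m (dim_row A) 1") auto
  then show ?thesis using pd_dim[OF A] pd_herm[OF A] by (simp add: psd_def)
qed

lemma qf_one: "dim_col w = 1 \<Longrightarrow> dim_row w = n \<Longrightarrow> Re (qf (1\<^sub>m n) w) = (\<Sum>i<n. (cmod (w $$ (i, 0)))\<^sup>2)"
proof -
  assume "dim_col w = 1" "dim_row w = n"
  then have "qf (1\<^sub>m n) w = (\<Sum>i<n. cnj (w $$ (i, 0)) * w $$ (i, 0))" by (simp add: qf_def mat_mult_index)
  also have "\<dots> = of_real (\<Sum>i<n. (cmod (w $$ (i, 0)))\<^sup>2)"
    by (simp only: of_real_sum complex_norm_square mult.commute[of "cnj _"])
  finally show ?thesis by (simp only: Re_complex_of_real)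
qed

lemma qf_congr:
  assumes "dim_row A = dim_col A" "dim_row V = dim_row A" "dim_row w = dim_col V"
  shows "qf (mat_adjoint V * A * V) w = qf A (V * w)"
  using assms by (simp add: qf_def mm_simps)

lemma psd_congr:
  assumes "psd A" "dim_row V = dim_row A"
  shows "psd (mat_adjoint V * A * V)"
proof -
  note [simp] = psd_dim[OF assms(1), symmetric] psd_herm[OF assms(1)] assms(2)
  show ?thesis unfolding psd_def
  proof (intro conjI allI impI)
    show "mat_adjoint (mat_adjoint V * A * V) = mat_adjoint V * A * V" by (simp add: mm_simps)
    fix w :: "complex mat" assume w: "dim_row w = dim_row (mat_adjoint V * A * V) \<and> dim_col w = 1"
    then show "0 \<le> Re (qf (mat_adjoint V * A * V) w)"
      using psdD[OF assms(1), of "V * w"] by (subst qf_congr) auto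
  qed simp
qed

lemma psd_congr':
  assumes "psd A" "dim_col V = dim_row A"
  shows "psd (V * A * mat_adjoint V)"
  using psd_congr[OF assms(1), of "mat_adjoint V"] assms by simp

lemma qf_add:
  assumes "dim_row A = n" "dim_col A = n" "dim_row B = n" "dim_col B = n" "dim_row w = n" "dim_col w = 1"
  shows "qf (A + B) w = qf A w + qf B w"
  using assms by (simp add: qf_def mm_simps)

lemma qf_smult:
  assumes "dim_row A = n" "dim_col A = n" "dim_row w = n" "dim_col w = 1"
  shows "qf (c \<cdot>\<^sub>m A) w = c * qf A w"
  using assms by (simp add: qf_def mm_simps)

lemma psd_add: "psd A \<Longrightarrow> psd B \<Longrightarrow> dim_row A = dim_row B \<Longrightarrow> psd (A + B)"
  unfolding psd_def by (auto simp: qf_add[of A "dim_row A" B])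

lemma pd_add_psd: "pd A \<Longrightarrow> psd B \<Longrightarrow> dim_row A = dim_row B \<Longrightarrow> pd (A + B)"
  unfolding pd_def psd_def by (auto simp: qf_add[of A "dim_row A" B] add_pos_nonneg)

lemma psd_add_pd: "psd A \<Longrightarrow> pd B \<Longrightarrow> dim_row A = dim_row B \<Longrightarrow> pd (A + B)"
  unfolding pd_def psd_def by (auto simp: qf_add[of A "dim_row A" B] add_nonneg_pos)

lemma psd_smult: "psd A \<Longrightarrow> 0 \<le> c \<Longrightarrow> psd (of_real c \<cdot>\<^sub>m A)"
  unfolding psd_def by (auto simp: qf_smult[of A "dim_row A"])

lemma pd_smult: "pd A \<Longrightarrow> 0 < c \<Longrightarrow> pd (of_real c \<cdot>\<^sub>m A)"
  unfolding pd_def by (auto simp: qf_smult[of A "dim_row A"])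

lemma pd_one: "pd (1\<^sub>m n)"
  unfolding pd_def
proof (intro conjI allI impI)
  fix w :: "complex mat"
  assume w: "dim_row w = dim_row (1\<^sub>m n :: complex mat) \<and> dim_col w = 1 \<and> w \<noteq> 0\<^sub>m (dim_row (1\<^sub>m n :: complex mat)) 1"
  have "\<exists>i<n. w $$ (i, 0) \<noteq> 0"
  proof (rule ccontr)
    assume "\<not> ?thesis"
    then have "w = 0\<^sub>m n 1" using w by (intro eq_matI) auto
    with w show False by simp
  qed
  then have "0 < (\<Sum>i<n. (cmod (w $$ (i, 0)))\<^sup>2)" by (auto intro!: sum_pos2)
  then show "0 < Re (qf (1\<^sub>m n) w)" using w by (subst qf_one) auto
qed auto

lemma psd_gram: "psd (mat_adjoint B * B)"
  using psd_congr[OF pd_psd[OF pd_one], of B "dim_row B"] by simp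

lemma psd_diag:
  assumes "psd A" "i < dim_row A" shows "0 \<le> Re (A $$ (i, i))"
proof -
  note [simp] = psd_dim[OF assms(1), symmetric]
  define w :: "complex mat" where "w = mat (dim_row A) 1 (\<lambda>(k, l). if k = i then 1 else 0)"
  have w [simp]: "dim_row w = dim_row A" "dim_col w = 1" by (simp_all add: w_def)
  have wi: "k < dim_row A \<Longrightarrow> w $$ (k, 0) = (if k = i then 1 else 0)" for k by (simp add: w_def)
  have "qf A w = (\<Sum>k<dim_row A. (\<Sum>l<dim_row A. cnj (w $$ (l, 0)) * A $$ (l, k)) * w $$ (k, 0))"
    by (simp add: qf_def mat_mult_index)
  also have "\<dots> = (\<Sum>k<dim_row A. (if k = i then A $$ (i, k) else 0))"
  proof (rule sum.cong[OF refl])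
    fix k assume k: "k \<in> {..<dim_row A}"
    have "(\<Sum>l<dim_row A. cnj (w $$ (l, 0)) * A $$ (l, k)) = (\<Sum>l<dim_row A. if l = i then A $$ (l, k) else 0)"
      by (intro sum.cong refl) (auto simp: wi)
    then show "(\<Sum>l<dim_row A. cnj (w $$ (l, 0)) * A $$ (l, k)) * w $$ (k, 0) = (if k = i then A $$ (i, k) else 0)"
      using k assms(2) by (simp add: wi)
  qed
  also have "\<dots> = A $$ (i, i)" using assms(2) by simp
  finally show ?thesis using psdD[OF assms(1), of w] by simp
qed

lemma psd_tr: "psd A \<Longrightarrow> 0 \<le> Re (tr A)"
  by (auto simp: tr_def intro!: sum_nonneg psd_diag)

lemma mat_inv_dim [simp]:
  assumes "dim_row A = dim_col A"
  shows "dim_row (mat_inv A) = dim_col A" "dim_col (mat_inv A) = dim_col A"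
proof -
  have A: "A \<in> carrier_mat (dim_col A) (dim_col A)" using assms by auto
  have "mat_inv A \<in> carrier_mat (dim_col A) (dim_col A)"
  proof (cases "mat_inverse A")
    case None
    then show ?thesis using assms by (simp add: mat_inv_def)
  next
    case (Some B)
    from mat_inverse(2)[OF A this] Some show ?thesis by (simp add: mat_inv_def)
  qed
  then show "dim_row (mat_inv A) = dim_col A" "dim_col (mat_inv A) = dim_col A"
    by (rule carrier_matD)+
qed

lemma mat_inv_correct:
  assumes "A \<in> carrier_mat n n" "det A \<noteq> 0"
  shows "A * mat_inv A = 1\<^sub>m n" "mat_inv A * A = 1\<^sub>m n"
proof -
  have "A \<in> Units (ring_mat TYPE('a) n ())" by (rule det_non_zero_imp_unit[OF assms])
  then obtain B where "mat_inverse A = Some B"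
    using mat_inverse(1)[OF assms(1), of "()"] by (cases "mat_inverse A") auto
  then show "A * mat_inv A = 1\<^sub>m n" "mat_inv A * A = 1\<^sub>m n"
    using mat_inverse(2)[OF assms(1)] by (auto simp: mat_inv_def)
qed

lemma pd_det: assumes "pd A" shows "det A \<noteq> 0"
proof
  define n where "n = dim_row A"
  have A: "A \<in> carrier_mat n n" using pd_dim[OF assms] by (auto simp: n_def)
  assume "det A = 0"
  then obtain v where v: "v \<in> carrier_vec n" "v \<noteq> 0\<^sub>v n" "A *\<^sub>v v = 0\<^sub>v n"
    using det_0_iff_vec_prod_zero_field[OF A] by auto
  define w where "w = mat_of_cols n [v]"
  have dw [simp]: "dim_row w = n" "dim_col w = 1" by (auto simp: w_def)
  have wv: "col w 0 = v" using v by (simp add: w_def)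
  have "w \<noteq> 0\<^sub>m n 1" using wv v by (auto simp: zero_vec_def)
  moreover have "A * w = 0\<^sub>m n 1"
  proof (rule eq_matI)
    fix i j assume ij: "i < dim_row (0\<^sub>m n 1 :: complex mat)" "j < dim_col (0\<^sub>m n 1 :: complex mat)"
    then have "(A * w) $$ (i, j) = vec_index (A *\<^sub>v v) i" using A wv by (simp add: index_mult_mat(1))
    then show "(A * w) $$ (i, j) = 0\<^sub>m n 1 $$ (i, j)" using ij v by simp
  qed (use A in auto)
  then have "qf A w = 0" using A by (simp add: qf_def mm_assoc mat_mult_index)
  moreover have "dim_row A = n" using A by simp
  ultimately show False using pdD[OF assms, of w] dw by simp
qed

lemma pd_inv:
  assumes "pd A" "dim_row A = n"
  shows "A * mat_inv A = 1\<^sub>m n" "mat_inv A * A = 1\<^sub>m n"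
    "mat_adjoint (mat_inv A) = mat_inv A" "psd (mat_inv A)"
    "dim_row (mat_inv A) = n" "dim_col (mat_inv A) = n"
proof -
  have A: "A \<in> carrier_mat n n" using pd_dim[OF assms(1)] assms by auto
  then have [simp]: "dim_row A = n" "dim_col A = n" by auto
  show d [simp]: "dim_row (mat_inv A) = n" "dim_col (mat_inv A) = n" by simp_all
  show 1: "A * mat_inv A = 1\<^sub>m n" "mat_inv A * A = 1\<^sub>m n"
    using mat_inv_correct[OF A pd_det[OF assms(1)]] by auto
  have "mat_adjoint (mat_inv A) * A = 1\<^sub>m n"
    using arg_cong[OF 1(1), of mat_adjoint] pd_herm[OF assms(1)] by simp
  then have "mat_adjoint (mat_inv A) * A * mat_inv A = mat_inv A" by simp
  then show 2: "mat_adjoint (mat_inv A) = mat_inv A" by (simp add: mm_assoc 1)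
  have "mat_adjoint (mat_inv A) * A * mat_inv A = mat_inv A" by (simp add: 2 1)
  then show "psd (mat_inv A)" using psd_congr[OF pd_psd[OF assms(1)], of "mat_inv A"] by simp
qed

lemma pd_inv_unique:
  assumes "pd A" "dim_row A = n" "A * B = 1\<^sub>m n" "dim_row B = n"
  shows "B = mat_inv A"
proof -
  note i = pd_inv[OF assms(1,2)]
  have "dim_col A = n" using pd_dim[OF assms(1)] assms by simp
  moreover have "dim_col B = n" using arg_cong[OF assms(3), of dim_col] by simp
  ultimately have "mat_inv A * A * B = mat_inv A * (A * B)" using assms(2,4) by (simp add: mm_assoc i(5,6))
  then show ?thesis using assms(3,4) i(2,6) by simp
qed

lemma pd_inv_cancel:
  assumes "pd A" "dim_row A = n" "dim_row B = n"
  shows "A * (mat_inv A * B) = B" "mat_inv A * (A * B) = B"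
proof -
  note i = pd_inv[OF assms(1,2)]
  have c: "dim_col A = n" using pd_dim[OF assms(1)] assms by simp
  show "A * (mat_inv A * B) = B" "mat_inv A * (A * B) = B"
    using mm_assoc[of A "mat_inv A" B] mm_assoc[of "mat_inv A" A B] i assms c by simp_all
qed

lemma pd_inv_smult:
  assumes "pd A" "0 < c"
  shows "mat_inv (of_real c \<cdot>\<^sub>m A) = of_real (1 / c) \<cdot>\<^sub>m mat_inv A"
proof -
  note i = pd_inv[OF assms(1) refl]
  have c: "dim_col A = dim_row A" using pd_dim[OF assms(1)] by simp
  show ?thesis
    by (rule pd_inv_unique[OF pd_smult[OF assms], of "dim_row A", symmetric])
       (use i c assms(2) in \<open>auto simp: mm_simps intro!: mat_lin\<close>)
qed

text \<open>With \<open>S = P\<^sup>-\<^sup>1 - P'\<^sup>-\<^sup>1\<close> one has \<open>S = S P S + P'\<^sup>-\<^sup>1 (P' - P) P'\<^sup>-\<^sup>1\<close>, a sum of two positive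
semidefinite matrices.\<close>

lemma tr_inv_antimono:
  assumes P: "pd P" and P': "pd P'" and d: "dim_row P = n" "dim_row P' = n" and le: "psd (P' - P)"
  shows "Re (tr (mat_inv P')) \<le> Re (tr (mat_inv P))"
proof -
  note i = pd_inv[OF P d(1)] and i' = pd_inv[OF P' d(2)]
  have c [simp]: "dim_col P = n" "dim_col P' = n" using pd_dim[OF P] pd_dim[OF P'] d by auto
  note [simp] = d i(5,6) i'(5,6)
  define S where "S = mat_inv P - mat_inv P'"
  have [simp]: "dim_row S = n" "dim_col S = n" by (simp_all add: S_def)
  have "S = mat_adjoint S * P * S + mat_adjoint (mat_inv P') * (P' - P) * mat_inv P'"
    unfolding S_def
    by (rule mat_lin) (simp_all add: mm_simps i i' pd_inv_cancel[OF P d(1)] pd_inv_cancel[OF P' d(2)])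
  moreover have "psd (mat_adjoint S * P * S + mat_adjoint (mat_inv P') * (P' - P) * mat_inv P')"
    by (intro psd_add psd_congr pd_psd[OF P] le) auto
  ultimately have "0 \<le> Re (tr S)" by (metis psd_tr)
  then show ?thesis by (simp add: S_def tr_minus[where n = n])
qed

subsection \<open>Spectra\<close>

lemma upper_triangular_mult_diag:
  assumes "B \<in> carrier_mat n n" "C \<in> carrier_mat n n" "upper_triangular B" "upper_triangular C" "i < n"
  shows "(B * C) $$ (i, i) = B $$ (i, i) * (C $$ (i, i) :: complex)"
proof -
  have "(B * C) $$ (i, i) = (\<Sum>k<n. B $$ (i, k) * C $$ (k, i))" using assms by (simp add: mat_mult_index)
  also have "\<dots> = (\<Sum>k\<in>{i}. B $$ (i, k) * C $$ (k, i))"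
  proof (rule sum.mono_neutral_right)
    show "\<forall>k\<in>{..<n} - {i}. B $$ (i, k) * C $$ (k, i) = 0"
    proof
      fix k assume "k \<in> {..<n} - {i}"
      then have "k < i \<or> i < k" "k < n" by auto
      then show "B $$ (i, k) * C $$ (k, i) = 0" using assms by (auto simp: upper_triangular_def)
    qed
  qed (use assms in auto)
  finally show ?thesis by simp
qed

lemma upper_triangular_mult:
  assumes "B \<in> carrier_mat n n" "C \<in> carrier_mat n n" "upper_triangular B" "upper_triangular C"
  shows "upper_triangular (B * C :: complex mat)"
  unfolding upper_triangular_def
proof (intro allI impI)
  fix i j assume ij: "i < dim_row (B * C)" "j < i"
  then have "(B * C) $$ (i, j) = (\<Sum>k<n. B $$ (i, k) * C $$ (k, j))" using assms by (simp add: mat_mult_index)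
  also have "\<dots> = 0"
  proof (rule sum.neutral, rule ballI)
    fix k assume "k \<in> {..<n}"
    then show "B $$ (i, k) * C $$ (k, j) = 0" using assms ij
      by (cases "k < i") (auto simp: upper_triangular_def)
  qed
  finally show "(B * C) $$ (i, j) = 0" .
qed

text \<open>Row \<open>i\<close> of \<open>Y B = 1\<close> is solved from the left: the entries of \<open>Y\<close> before the diagonal vanish one after
the other.\<close>

lemma upper_triangular_inverse_diag:
  assumes B: "B \<in> carrier_mat n n" "upper_triangular B" and Y: "Y \<in> carrier_mat n n" "Y * B = 1\<^sub>m n"
    and nz: "\<And>i. i < n \<Longrightarrow> B $$ (i, i) \<noteq> (0 :: complex)" and i: "i < n"
  shows "Y $$ (i, i) = 1 / B $$ (i, i)"
proof -
  have e: "(\<Sum>k<n. Y $$ (i, k) * B $$ (k, j)) = (if i = j then 1 else 0)" if "j < n" for j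
  proof -
    have "(\<Sum>k<n. Y $$ (i, k) * B $$ (k, j)) = (Y * B) $$ (i, j)"
      using B(1) Y(1) i that by (simp add: mat_mult_index)
    then show ?thesis using Y(2) i that by simp
  qed
  have red: "(\<Sum>k<n. Y $$ (i, k) * B $$ (k, j)) = Y $$ (i, j) * B $$ (j, j)"
    if "j \<le> i" "\<And>k. k < j \<Longrightarrow> Y $$ (i, k) = 0" for j
  proof -
    have "(\<Sum>k<n. Y $$ (i, k) * B $$ (k, j)) = (\<Sum>k\<in>{j}. Y $$ (i, k) * B $$ (k, j))"
    proof (rule sum.mono_neutral_right)
      show "\<forall>k\<in>{..<n} - {j}. Y $$ (i, k) * B $$ (k, j) = 0"
      proof
        fix k assume "k \<in> {..<n} - {j}"
        then have "k < j \<or> j < k" "k < n" by auto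
        then show "Y $$ (i, k) * B $$ (k, j) = 0" using that B by (auto simp: upper_triangular_def)
      qed
    qed (use that i in auto)
    then show ?thesis by simp
  qed
  have z: "j < i \<longrightarrow> Y $$ (i, j) = 0" for j
  proof (induction j rule: less_induct)
    case (less j)
    show ?case
    proof
      assume j: "j < i"
      then have "Y $$ (i, j) * B $$ (j, j) = 0" using red[of j] e[of j] less i by auto
      then show "Y $$ (i, j) = 0" using nz[of j] j i by auto
    qed
  qed
  have "Y $$ (i, i) * B $$ (i, i) = 1" using red[of i] z e[of i] i by auto
  then show ?thesis using nz[OF i] by (simp add: field_simps)
qed

lemma eigvals_upper_triangular:
  assumes "similar_mat A B" "B \<in> carrier_mat n n" "upper_triangular B"
  shows "eigvals A = mset (diag_mat B)"
proof -
  have "proots (\<Prod>a\<leftarrow>as. [:- a, 1:]) = mset as" for as :: "complex list"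
  proof (induction as)
    case (Cons a as)
    have "(\<Prod>a\<leftarrow>as. [:- a, 1:]) \<noteq> (0 :: complex poly)" by (auto simp: prod_list_zero_iff)
    then have "proots ([:- a, 1:] * (\<Prod>a\<leftarrow>as. [:- a, 1:])) = proots [:- a, 1:] + proots (\<Prod>a\<leftarrow>as. [:- a, 1:])"
      by (intro proots_mult) auto
    then show ?case using Cons by simp
  qed simp
  then show ?thesis
    unfolding eigvals_def char_poly_similar[OF assms(1)] char_poly_upper_triangular[OF assms(2,3)] by simp
qed

text \<open>A triangular matrix similar to \<open>A\<close> shows at once the eigenvalues of \<open>A\<close>, of \<open>A\<^sup>2\<close> and of the
resolvent on its diagonal, with the same order and multiplicities.\<close>

lemma spectral_data:
  fixes A :: "complex mat"
  assumes A: "A \<in> carrier_mat n n"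
  obtains es where "length es = n" "eigvals A = mset es" "eigvals (A * A) = mset (map (\<lambda>z. z * z) es)"
    "tr A = sum_list es"
    "\<And>x R. R \<in> carrier_mat n n \<Longrightarrow> R * (x \<cdot>\<^sub>m 1\<^sub>m n + A) = 1\<^sub>m n \<Longrightarrow> (\<forall>e\<in>set es. x + e \<noteq> 0) \<Longrightarrow>
       tr R = (\<Sum>e\<leftarrow>es. 1 / (x + e))"
    "\<And>e. e \<in> set es \<Longrightarrow> \<exists>w. dim_row w = n \<and> dim_col w = 1 \<and> w \<noteq> 0\<^sub>m n 1 \<and> A * w = e \<cdot>\<^sub>m w"
proof -
  obtain as where as: "char_poly A = (\<Prod>a\<leftarrow>as. [:- a, 1:])" "length as = n"
    using char_poly_factorized[OF A] by auto
  obtain B P Q where "schur_decomposition A as = (B, P, Q)" by (metis prod_cases3)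
  from schur_decomposition[OF A as(1) this]
  have sw: "similar_mat_wit A B P Q" and ut: "upper_triangular B" and dB: "diag_mat B = as" by auto
  from sw A have c: "B \<in> carrier_mat n n" "P \<in> carrier_mat n n" "Q \<in> carrier_mat n n"
    and PQ: "P * Q = 1\<^sub>m n" and QP: "Q * P = 1\<^sub>m n" and AB: "A = P * B * Q"
    by (auto simp: similar_mat_wit_def Let_def)
  from c A have [simp]: "dim_row B = n" "dim_col B = n" "dim_row P = n" "dim_col P = n"
    "dim_row Q = n" "dim_col Q = n" "dim_row A = n" "dim_col A = n" by auto
  have QPX: "Q * (P * X) = X" if "dim_row X = n" for X using QP that by (simp flip: mm_assoc)
  have asB: "as = map (\<lambda>i. B $$ (i, i)) [0..<n]" using dB by (simp add: diag_mat_def)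
  have sumas: "(\<Sum>e\<leftarrow>as. f e) = (\<Sum>i<n. f (B $$ (i, i)))" for f :: "complex \<Rightarrow> complex"
    by (simp add: asB sum_list_sum_nth lessThan_atLeast0)
  have trsim: "tr (P * X * Q) = tr X" if "dim_row X = n" "dim_col X = n" for X
    using that tr_comm[of "P * X" Q] by (simp add: QPX)
  show ?thesis
  proof (rule that[of as])
    show "length as = n" by fact
    have "similar_mat A B" using sw by (auto simp: similar_mat_def)
    then show "eigvals A = mset as" using eigvals_upper_triangular[OF _ c(1) ut] dB by simp
    have "A * A = P * (B * B) * Q" unfolding AB by (simp add: mm_assoc QPX)
    then have "similar_mat_wit (A * A) (B * B) P Q"
      by (rule similar_mat_witI[OF PQ QP _ mult_carrier_mat[OF A A] mult_carrier_mat[OF c(1) c(1)] c(2,3)])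
    then have "similar_mat (A * A) (B * B)" by (auto simp: similar_mat_def)
    from eigvals_upper_triangular[OF this mult_carrier_mat[OF c(1) c(1)] upper_triangular_mult[OF c(1) c(1) ut ut]]
    have "eigvals (A * A) = mset (diag_mat (B * B))" .
    also have "diag_mat (B * B) = map (\<lambda>z. z * z) as"
      unfolding asB diag_mat_def using upper_triangular_mult_diag[OF c(1) c(1) ut ut] by simp
    finally show "eigvals (A * A) = mset (map (\<lambda>z. z * z) as)" .
    show "tr A = sum_list as" using trsim[of B] sumas[of "\<lambda>e. e"] by (simp add: AB tr_def)
    show "tr R = (\<Sum>e\<leftarrow>as. 1 / (x + e))"
      if R: "R \<in> carrier_mat n n" "R * (x \<cdot>\<^sub>m 1\<^sub>m n + A) = 1\<^sub>m n" and nz: "\<forall>e\<in>set as. x + e \<noteq> 0" for x R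
    proof -
      from R(1) have [simp]: "dim_row R = n" "dim_col R = n" by auto
      define Y where "Y = Q * R * P"
      define B' where "B' = x \<cdot>\<^sub>m 1\<^sub>m n + B"
      have [simp]: "dim_row B' = n" "dim_col B' = n" "dim_row Y = n" "dim_col Y = n" by (auto simp: B'_def Y_def)
      have "P * B' * Q = x \<cdot>\<^sub>m 1\<^sub>m n + A" unfolding B'_def AB by (simp add: mm_simps PQ)
      then have "R * (P * B' * Q) = 1\<^sub>m n" using R(2) by simp
      then have "Q * (R * (P * B' * Q)) * P = 1\<^sub>m n" using QP by simp
      then have "Y * B' = 1\<^sub>m n" unfolding Y_def by (simp add: mm_assoc QP)
      moreover have "upper_triangular B'" using ut by (auto simp: B'_def upper_triangular_def)
      moreover have "B' $$ (i, i) \<noteq> 0" if "i < n" for i using nz that by (auto simp: asB B'_def)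
      ultimately have "Y $$ (i, i) = 1 / B' $$ (i, i)" if "i < n" for i
        using that by (intro upper_triangular_inverse_diag[where n = n]) auto
      then have "tr Y = (\<Sum>e\<leftarrow>as. 1 / (x + e))" unfolding sumas by (simp add: tr_def B'_def)
      moreover have "tr Y = tr R" unfolding Y_def using tr_comm[of "Q * R" P] PQ by (simp flip: mm_assoc)
      ultimately show ?thesis by simp
    qed
    show "\<exists>w. dim_row w = n \<and> dim_col w = 1 \<and> w \<noteq> 0\<^sub>m n 1 \<and> A * w = e \<cdot>\<^sub>m w" if "e \<in> set as" for e
    proof -
      have "poly (char_poly A) e = 0" unfolding as(1) using that by (auto simp: poly_prod_list prod_list_zero_iff)
      then obtain v where v: "v \<in> carrier_vec n" "v \<noteq> 0\<^sub>v n" "A *\<^sub>v v = e \<cdot>\<^sub>v v"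
        using eigenvalue_root_char_poly[OF A] by (auto simp: eigenvalue_def eigenvector_def)
      define w where "w = mat_of_cols n [v]"
      have dw [simp]: "dim_row w = n" "dim_col w = 1" by (auto simp: w_def)
      have wv: "col w 0 = v" using v by (simp add: w_def)
      have "w \<noteq> 0\<^sub>m n 1" using wv v by (auto simp: zero_vec_def)
      moreover have "A * w = e \<cdot>\<^sub>m w"
      proof (rule eq_matI)
        fix i j assume ij: "i < dim_row (e \<cdot>\<^sub>m w)" "j < dim_col (e \<cdot>\<^sub>m w)"
        then have "(A * w) $$ (i, j) = vec_index (A *\<^sub>v v) i" using A wv by (simp add: index_mult_mat(1))
        also have "\<dots> = e * vec_index (col w 0) i" using ij v wv by simp
        also have "\<dots> = (e \<cdot>\<^sub>m w) $$ (i, j)" using ij by simp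
        finally show "(A * w) $$ (i, j) = (e \<cdot>\<^sub>m w) $$ (i, j)" .
      qed auto
      ultimately show ?thesis using dw by blast
    qed
  qed
qed

lemma herm_qf_real:
  assumes "mat_adjoint A = A" "dim_row A = dim_col A" "dim_row w = dim_row A" "dim_col w = 1"
  shows "Im (qf A w) = 0"
proof -
  have e: "mat_adjoint (mat_adjoint w * A * w) = mat_adjoint w * A * w" using assms by (simp add: mm_assoc)
  have "cnj (qf A w) = mat_adjoint (mat_adjoint w * A * w) $$ (0, 0)"
    using assms by (simp add: qf_def del: adjoint_mult)
  then have "cnj (qf A w) = qf A w" by (simp only: e qf_def)
  then show ?thesis by (metis Reals_cnj_iff complex_is_Real_iff)
qed

lemma psd_spectrum:
  assumes "psd A" "dim_row A = n"
  obtains ls where "length ls = n" "eigvals A = mset (map of_real ls)" "singvals A = mset ls"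
    "\<And>l. l \<in> set ls \<Longrightarrow> 0 \<le> l"
    "\<And>x R. R \<in> carrier_mat n n \<Longrightarrow> R * (of_real x \<cdot>\<^sub>m 1\<^sub>m n + A) = 1\<^sub>m n \<Longrightarrow> 0 < x \<Longrightarrow>
       tr R = of_real (\<Sum>l\<leftarrow>ls. 1 / (x + l))"
proof -
  have A: "A \<in> carrier_mat n n" using psd_dim[OF assms(1)] assms by auto
  then have [simp]: "dim_row A = n" "dim_col A = n" by auto
  obtain es where es: "length es = n" "eigvals A = mset es"
    "eigvals (A * A) = mset (map (\<lambda>z. z * z) es)" "tr A = sum_list es"
    "\<And>x R. R \<in> carrier_mat n n \<Longrightarrow> R * (x \<cdot>\<^sub>m 1\<^sub>m n + A) = 1\<^sub>m n \<Longrightarrow> (\<forall>e\<in>set es. x + e \<noteq> 0) \<Longrightarrow>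
       tr R = (\<Sum>e\<leftarrow>es. 1 / (x + e))"
    "\<And>e. e \<in> set es \<Longrightarrow> \<exists>w. dim_row w = n \<and> dim_col w = 1 \<and> w \<noteq> 0\<^sub>m n 1 \<and> A * w = e \<cdot>\<^sub>m w"
    by (rule spectral_data[OF A]) (rule that; assumption)
  have e: "e = of_real (Re e) \<and> 0 \<le> Re e" if ein: "e \<in> set es" for e
  proof -
    obtain w where w: "dim_row w = n" "dim_col w = 1" "w \<noteq> 0\<^sub>m n 1" "A * w = e \<cdot>\<^sub>m w"
      using es(6)[OF ein] by auto
    have "qf A w = e * qf (1\<^sub>m n) w" using w by (simp add: qf_def mm_simps)
    moreover have "0 < Re (qf (1\<^sub>m n) w)" using w by (intro pdD[OF pd_one]) auto
    moreover have "Im (qf (1\<^sub>m n) w) = 0" "Im (qf A w) = 0"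
      using w psd_herm[OF assms(1)] by (auto intro!: herm_qf_real)
    moreover have "0 \<le> Re (qf A w)" using psdD[OF assms(1), of w] w by simp
    ultimately show ?thesis by (auto simp: complex_eq_iff zero_le_mult_iff)
  qed
  define ls where "ls = map Re es"
  have esl: "map of_real ls = es" unfolding ls_def map_map by (rule map_idI) (use e in auto)
  show ?thesis
  proof (rule that[of ls])
    show "length ls = n" using es by (simp add: ls_def)
    show "eigvals A = mset (map of_real ls)" using esl es by simp
    have "singvals A = image_mset (\<lambda>z. sqrt (Re z)) (mset (map (\<lambda>z. z * z) es))"
      unfolding singvals_def using psd_herm[OF assms(1)] es by simp
    also have "\<dots> = mset (map (\<lambda>z. sqrt (Re (z * z))) es)" by (simp flip: mset_map add: comp_def)
    also have "map (\<lambda>z. sqrt (Re (z * z))) es = map Re es"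
    proof (rule map_cong[OF refl])
      fix z assume "z \<in> set es"
      from e[OF this] have "Re (z * z) = Re z * Re z" "0 \<le> Re z" by (auto simp: complex_eq_iff)
      then show "sqrt (Re (z * z)) = Re z" by (metis real_sqrt_abs2 abs_of_nonneg)
    qed
    finally show "singvals A = mset ls" by (simp add: ls_def)
    show "0 \<le> l" if "l \<in> set ls" for l using that e by (auto simp: ls_def)
    show "tr R = of_real (\<Sum>l\<leftarrow>ls. 1 / (x + l))"
      if "R \<in> carrier_mat n n" "R * (of_real x \<cdot>\<^sub>m 1\<^sub>m n + A) = 1\<^sub>m n" "0 < x" for x R
    proof -
      have "\<forall>e\<in>set es. of_real x + e \<noteq> 0"
      proof
        fix z assume "z \<in> set es"
        from e[OF this] have "Re (of_real x + z) > 0" using that(3) by simp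
        then show "of_real x + z \<noteq> 0" by (metis less_irrefl zero_complex.sel(1))
      qed
      from es(5)[OF that(1,2) this] have "tr R = (\<Sum>e\<leftarrow>es. 1 / (of_real x + e))" .
      also have "\<dots> = (\<Sum>l\<leftarrow>ls. of_real (1 / (x + l)))" by (subst esl[symmetric]) (simp add: comp_def)
      also have "\<dots> = of_real (\<Sum>l\<leftarrow>ls. 1 / (x + l))" by (induction ls) auto
      finally show ?thesis .
    qed
  qed
qed

text \<open>If \<open>P Q w = e w\<close>, then for \<open>u = P\<^sup>-\<^sup>1 w\<close> the forms of \<open>Q\<close> at \<open>w\<close> and of \<open>P\<close> at \<open>u\<close> differ by the factor \<open>e\<close>.
So all eigenvalues of \<open>P Q\<close> are nonnegative, and the trace is their sum.\<close>

lemma tr_pd_psd_nonneg: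
  assumes P: "pd P" and Q: "psd Q" and d: "dim_row P = n" "dim_row Q = n"
  shows "0 \<le> Re (tr (P * Q))"
proof -
  have c [simp]: "dim_row P = n" "dim_col P = n" "dim_row Q = n" "dim_col Q = n"
    using pd_dim[OF P] psd_dim[OF Q] d by auto
  then have "P * Q \<in> carrier_mat n n" by auto
  then have "\<exists>es. tr (P * Q) = sum_list es \<and> (\<forall>e\<in>set es. \<exists>w. dim_row w = n \<and> dim_col w = 1 \<and> w \<noteq> 0\<^sub>m n 1 \<and> P * Q * w = e \<cdot>\<^sub>m w)"
    by (rule spectral_data) blast
  then obtain es where es: "tr (P * Q) = sum_list es"
    "\<And>e. e \<in> set es \<Longrightarrow> \<exists>w. dim_row w = n \<and> dim_col w = 1 \<and> w \<noteq> 0\<^sub>m n 1 \<and> P * Q * w = e \<cdot>\<^sub>m w" by blast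
  have "0 \<le> Re e" if ein: "e \<in> set es" for e
  proof -
    obtain w where w: "dim_row w = n" "dim_col w = 1" "w \<noteq> 0\<^sub>m n 1" "P * Q * w = e \<cdot>\<^sub>m w"
      using es(2)[OF ein] by auto
    define u where "u = mat_inv P * w"
    have wu: "w = P * u" using w pd_inv_cancel[OF P d(1), of w] by (simp add: u_def)
    have u: "dim_row u = n" "dim_col u = 1" using w pd_inv[OF P d(1)] by (auto simp: u_def)
    have "u \<noteq> 0\<^sub>m n 1"
    proof
      assume "u = 0\<^sub>m n 1"
      then have "w = 0\<^sub>m n 1" unfolding wu by (simp add: mat_lin mat_mult_index)
      with w(3) show False by simp
    qed
    then have Pu: "0 < Re (qf P u)" using u by (intro pdD[OF P]) auto
    have "mat_inv P * (P * (Q * w)) = mat_inv P * (e \<cdot>\<^sub>m w)" using w by (simp add: mm_assoc)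
    then have "Q * w = e \<cdot>\<^sub>m u" using w pd_inv_cancel(2)[OF P d(1), of "Q * w"] pd_inv[OF P d(1)]
      by (simp add: u_def mm_simps)
    then have "mat_adjoint w * (Q * w) = mat_adjoint u * (P * (e \<cdot>\<^sub>m u))"
      using u pd_herm[OF P] by (simp add: wu mm_assoc)
    then have "qf Q w = e * qf P u" using u w by (simp add: qf_def mm_simps)
    moreover have "Im (qf P u) = 0" using u pd_herm[OF P] by (intro herm_qf_real) auto
    moreover have "0 \<le> Re (qf Q w)" using psdD[OF Q, of w] w by simp
    ultimately show ?thesis using Pu by (auto simp: zero_le_mult_iff)
  qed
  then have "0 \<le> (\<Sum>e\<leftarrow>es. Re e)" by (auto intro!: sum_list_nonneg)
  moreover have "Re (sum_list es) = (\<Sum>e\<leftarrow>es. Re e)" by (induction es) auto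
  ultimately show ?thesis using es by simp
qed

lemma bform_of_gram_bound:
  assumes "psd (of_real (c\<^sup>2) \<cdot>\<^sub>m 1\<^sub>m m - V * mat_adjoint V)" "dim_row V = m" "dim_col V = k" "0 \<le> c"
  shows "bform {..<m} {..<k} (\<lambda>i j. V $$ (i, j)) c"
proof -
  note [simp] = assms(2,3)
  have "bform {..<k} {..<m} (\<lambda>j i. V $$ (i, j)) c"
  proof (rule bformI_apply)
    fix w :: "nat \<Rightarrow> complex"
    define u :: "complex mat" where "u = mat m 1 (\<lambda>(i, _). cnj (w i))"
    have [simp]: "dim_row u = m" "dim_col u = 1" by (simp_all add: u_def)
    have "Re (qf (1\<^sub>m k) (mat_adjoint V * u)) = (\<Sum>j<k. (cmod ((mat_adjoint V * u) $$ (j, 0)))\<^sup>2)"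
      by (rule qf_one) auto
    also have "\<dots> = (\<Sum>j<k. (cmod (\<Sum>i<m. V $$ (i, j) * w i))\<^sup>2)"
    proof (rule sum.cong[OF refl])
      fix j assume "j \<in> {..<k}"
      then have "(mat_adjoint V * u) $$ (j, 0) = cnj (\<Sum>i<m. V $$ (i, j) * w i)"
        by (simp add: mat_mult_index) (simp add: u_def)
      then show "(cmod ((mat_adjoint V * u) $$ (j, 0)))\<^sup>2 = (cmod (\<Sum>i<m. V $$ (i, j) * w i))\<^sup>2"
        by (simp only: complex_mod_cnj)
    qed
    finally have 1: "Re (qf (1\<^sub>m k) (mat_adjoint V * u)) = (l2 {..<k} (\<lambda>j. \<Sum>i<m. V $$ (i, j) * w i))\<^sup>2"
      by (simp add: l2_sq)
    have 2: "Re (qf (1\<^sub>m m) u) = (l2 {..<m} w)\<^sup>2"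
      by (subst qf_one) (auto simp: l2_sq u_def)
    have "qf (of_real (c\<^sup>2) \<cdot>\<^sub>m 1\<^sub>m m - V * mat_adjoint V) u = of_real (c\<^sup>2) * qf (1\<^sub>m m) u - qf (1\<^sub>m k) (mat_adjoint V * u)"
      by (simp add: qf_def mm_simps)
    then have "0 \<le> c\<^sup>2 * (l2 {..<m} w)\<^sup>2 - (l2 {..<k} (\<lambda>j. \<Sum>i<m. V $$ (i, j) * w i))\<^sup>2"
      using psdD[OF assms(1), of u] 1 2 by (simp del: of_real_power)
    then have "(l2 {..<k} (\<lambda>j. \<Sum>i<m. V $$ (i, j) * w i))\<^sup>2 \<le> (c * l2 {..<m} w)\<^sup>2"
      by (simp add: power_mult_distrib)
    then show "l2 {..<k} (\<lambda>j. \<Sum>i<m. V $$ (i, j) * w i) \<le> c * l2 {..<m} w"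
      by (rule power2_le_imp_le) (simp add: assms)
  qed (rule assms)
  then show ?thesis by (rule bform_transpose)
qed

section \<open>The resolvent of a Schur complement\<close>

definition schur :: "complex mat \<Rightarrow> complex mat \<Rightarrow> complex mat" where
  "schur G F = F * mat_inv G * mat_adjoint F"

definition schur_res :: "real \<Rightarrow> complex mat \<Rightarrow> complex mat \<Rightarrow> complex mat" where
  "schur_res x G F = mat_inv (of_real x \<cdot>\<^sub>m 1\<^sub>m (dim_row F) + schur G F)"

text \<open>The pair \<open>schur_cross\<close>, \<open>schur_res\<close> is the last block row of the inverse of the block matrix
with rows \<open>(G, F\<^sup>*)\<close> and \<open>(-F, x)\<close>. That block matrix is never formed; only the two equations
\<open>schur_cross_G\<close> and \<open>schur_cross_F\<close> that express this are used.\<close>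

definition schur_cross :: "real \<Rightarrow> complex mat \<Rightarrow> complex mat \<Rightarrow> complex mat" where
  "schur_cross x G F = schur_res x G F * F * mat_inv G"

lemma psd_schur:
  assumes "pd G" "dim_col F = dim_row G" shows "psd (schur G F)"
  unfolding schur_def using assms pd_inv[OF assms(1) refl] by (intro psd_congr') auto

lemma schur_dim [simp]: "dim_row (schur G F) = dim_row F" "dim_col (schur G F) = dim_row F"
  by (simp_all add: schur_def)

lemma pd_shift: assumes "psd A" "0 < x" "dim_row A = n" shows "pd (of_real x \<cdot>\<^sub>m 1\<^sub>m n + A)"
  by (rule pd_add_psd[OF pd_smult[OF pd_one assms(2)] assms(1)]) (simp add: assms(3))

context
  fixes G F :: "complex mat" and x :: real and N Q :: nat
  assumes G: "pd G" and N: "dim_row G = N" and F: "dim_row F = Q" "dim_col F = N" and x: "0 < x"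
begin

lemma pd_shift_schur: "pd (of_real x \<cdot>\<^sub>m 1\<^sub>m Q + schur G F)"
  using G N F by (intro pd_shift psd_schur x) auto

lemma schur_aux_dims:
  "dim_col G = N" "dim_row (mat_inv G) = N" "dim_col (mat_inv G) = N"
  "dim_row (schur_res x G F) = Q" "dim_col (schur_res x G F) = Q"
  "dim_row (schur_cross x G F) = Q" "dim_col (schur_cross x G F) = N"
  using pd_dim[OF G] N pd_inv[OF G N] pd_inv[OF pd_shift_schur] F
  by (simp_all add: schur_res_def schur_cross_def)

lemma schur_res_herm: "mat_adjoint (schur_res x G F) = schur_res x G F"
  and schur_res_eq: "schur_res x G F * (of_real x \<cdot>\<^sub>m 1\<^sub>m Q + schur G F) = 1\<^sub>m Q"
  using pd_inv[OF pd_shift_schur, of Q] F by (simp_all add: schur_res_def)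

lemma schur_cross_G: "schur_cross x G F * G = schur_res x G F * F"
  using schur_aux_dims N F by (simp add: schur_cross_def mm_assoc pd_inv(2)[OF G N])

lemma schur_cross_F: "schur_cross x G F * mat_adjoint F + of_real x \<cdot>\<^sub>m schur_res x G F = 1\<^sub>m Q"
proof -
  have "schur_cross x G F * mat_adjoint F + of_real x \<cdot>\<^sub>m schur_res x G F
     = schur_res x G F * (of_real x \<cdot>\<^sub>m 1\<^sub>m Q + schur G F)"
    using schur_aux_dims N F by (intro mat_lin) (simp_all add: schur_cross_def schur_def mm_simps)
  then show ?thesis by (simp add: schur_res_eq)
qed

lemma G_schur_cross: "G * mat_adjoint (schur_cross x G F) = mat_adjoint F * schur_res x G F"
  using arg_cong[OF schur_cross_G, of mat_adjoint] schur_aux_dims N F pd_herm[OF G] schur_res_herm by simp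

lemma schur_cross_F': "schur_cross x G F * mat_adjoint F = 1\<^sub>m Q - of_real x \<cdot>\<^sub>m schur_res x G F"
  using schur_aux_dims F by (subst schur_cross_F[symmetric], intro mat_lin) auto

lemma F_schur_cross: "F * mat_adjoint (schur_cross x G F) = 1\<^sub>m Q - of_real x \<cdot>\<^sub>m schur_res x G F"
  using arg_cong[OF schur_cross_F', of mat_adjoint] schur_aux_dims N F schur_res_herm by simp

text \<open>With \<open>R\<close> and \<open>V\<close> for the two blocks: \<open>V G V\<^sup>* = R F V\<^sup>* = R - x R\<^sup>2\<close>. The left side is positive
semidefinite, which yields all bounds on \<open>R\<close> and \<open>V\<close> below.\<close>

lemma schur_cross_gram:
  "schur_cross x G F * G * mat_adjoint (schur_cross x G F) = schur_res x G F - of_real x \<cdot>\<^sub>m (schur_res x G F * schur_res x G F)"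
proof -
  have "schur_cross x G F * G * mat_adjoint (schur_cross x G F) = schur_res x G F * (F * mat_adjoint (schur_cross x G F))"
    using schur_aux_dims F by (simp add: schur_cross_G mm_assoc)
  then show ?thesis using schur_aux_dims by (simp add: F_schur_cross mm_simps)
qed

lemma psd_schur_cross_gram: "psd (schur_res x G F - of_real x \<cdot>\<^sub>m (schur_res x G F * schur_res x G F))"
  unfolding schur_cross_gram[symmetric] using schur_aux_dims N by (intro psd_congr' pd_psd G) simp

lemma psd_schur_res_le: "psd (of_real (1 / x) \<cdot>\<^sub>m 1\<^sub>m Q - schur_res x G F)"
proof -
  define R where "R = schur_res x G F"
  have [simp]: "dim_row R = Q" "dim_col R = Q" "mat_adjoint R = R"
    using schur_aux_dims schur_res_herm by (simp_all add: R_def)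
  define S where "S = 1\<^sub>m Q - of_real x \<cdot>\<^sub>m R"
  have [simp]: "dim_row S = Q" "dim_col S = Q" "mat_adjoint S = S" by (simp_all add: S_def)
  have "of_real (1 / x) \<cdot>\<^sub>m 1\<^sub>m Q - R = of_real (1 / x) \<cdot>\<^sub>m (mat_adjoint S * S) + (R - of_real x \<cdot>\<^sub>m (R * R))"
    using x by (intro mat_lin) (simp_all add: S_def mm_simps, simp add: field_simps)
  moreover have "psd \<dots>"
    using x psd_schur_cross_gram by (intro psd_smult psd_add psd_gram) (auto simp: R_def[symmetric])
  ultimately show ?thesis by (simp only: R_def)
qed

lemma bform_schur_res: "bform {..<Q} {..<Q} (\<lambda>i j. schur_res x G F $$ (i, j)) (1 / x)"
proof (rule bform_of_gram_bound)
  define R where "R = schur_res x G F"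
  have [simp]: "dim_row R = Q" "dim_col R = Q" "mat_adjoint R = R" using schur_aux_dims schur_res_herm by (simp_all add: R_def)
  have "of_real ((1 / x)\<^sup>2) \<cdot>\<^sub>m 1\<^sub>m Q - R * mat_adjoint R
      = of_real (1 / x) \<cdot>\<^sub>m ((of_real (1 / x) \<cdot>\<^sub>m 1\<^sub>m Q - R) + (R - of_real x \<cdot>\<^sub>m (R * R)))"
    using x by (intro mat_lin) (simp_all add: mm_simps, simp add: field_simps power2_eq_square)
  moreover have "psd \<dots>"
    using x psd_schur_cross_gram psd_schur_res_le by (intro psd_smult psd_add) (auto simp: R_def[symmetric])
  ultimately show "psd (of_real ((1 / x)\<^sup>2) \<cdot>\<^sub>m 1\<^sub>m Q - schur_res x G F * mat_adjoint (schur_res x G F))"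
    by (simp only: R_def)
qed (use x schur_aux_dims in auto)

lemma bform_schur_cross:
  assumes "0 < \<epsilon>" "psd (G - of_real \<epsilon> \<cdot>\<^sub>m 1\<^sub>m N)"
  shows "bform {..<Q} {..<N} (\<lambda>i j. schur_cross x G F $$ (i, j)) (1 / sqrt (\<epsilon> * x))"
proof (rule bform_of_gram_bound)
  define R where "R = schur_res x G F"
  define V where "V = schur_cross x G F"
  have [simp]: "dim_row R = Q" "dim_col R = Q" "mat_adjoint R = R" "dim_row V = Q" "dim_col V = N"
    "dim_row G = N" "dim_col G = N"
    using schur_aux_dims schur_res_herm N by (simp_all add: R_def V_def)
  have gram: "V * (G * mat_adjoint V) = R - of_real x \<cdot>\<^sub>m (R * R)"
    using schur_cross_gram by (simp add: V_def[symmetric] R_def[symmetric] mm_assoc)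
  have sq: "(1 / sqrt (\<epsilon> * x))\<^sup>2 = 1 / (\<epsilon> * x)" using x assms(1) by (simp add: power_divide)
  have "of_real (1 / (\<epsilon> * x)) \<cdot>\<^sub>m 1\<^sub>m Q - V * mat_adjoint V
      = of_real (1 / \<epsilon>) \<cdot>\<^sub>m ((of_real (1 / x) \<cdot>\<^sub>m 1\<^sub>m Q - R) + of_real x \<cdot>\<^sub>m (mat_adjoint R * R)
          + V * (G - of_real \<epsilon> \<cdot>\<^sub>m 1\<^sub>m N) * mat_adjoint V)"
    using x assms(1) by (intro mat_lin) (simp_all add: mm_simps gram, simp add: field_simps)
  moreover have "psd \<dots>"
    using x assms psd_schur_res_le by (intro psd_smult psd_add psd_gram psd_congr') (auto simp: R_def[symmetric])
  ultimately show "psd (of_real ((1 / sqrt (\<epsilon> * x))\<^sup>2) \<cdot>\<^sub>m 1\<^sub>m Q - schur_cross x G F * mat_adjoint (schur_cross x G F))"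
    by (simp only: V_def sq)
qed (use x assms schur_aux_dims in auto)

lemma pd_gram_shift: "pd (of_real x \<cdot>\<^sub>m G + mat_adjoint F * F)"
  using N F schur_aux_dims by (intro pd_add_psd pd_smult G x psd_gram) auto

text \<open>Both sides, multiplied by \<open>x G + F\<^sup>* F\<close>, give \<open>F\<close>. The formula moves the resolvent to the larger
space, where a shift of \<open>G\<close> is a multiple of the identity.\<close>

lemma schur_cross_push_through: "schur_cross x G F = F * mat_inv (of_real x \<cdot>\<^sub>m G + mat_adjoint F * F)"
proof -
  define K where "K = of_real x \<cdot>\<^sub>m G + mat_adjoint F * F"
  have K: "pd K" "dim_row K = N" "dim_col K = N" using pd_gram_shift schur_aux_dims N F by (auto simp: K_def)
  have "schur_cross x G F * K = of_real x \<cdot>\<^sub>m (schur_cross x G F * G) + schur_cross x G F * mat_adjoint F * F"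
    using schur_aux_dims N F by (simp add: K_def mm_simps)
  also have "\<dots> = F"
    unfolding schur_cross_G schur_cross_F' using schur_aux_dims N F by (intro mat_lin) (simp_all add: mm_simps)
  finally have "schur_cross x G F * K * mat_inv K = F * mat_inv K" by simp
  moreover have "schur_cross x G F * K * mat_inv K = schur_cross x G F * (K * mat_inv K)"
    using schur_aux_dims K pd_inv[OF K(1,2)] by (intro mm_assoc) auto
  ultimately show ?thesis using pd_inv[OF K(1,2)] schur_aux_dims by (simp add: K_def)
qed

lemma tr_schur_res: "of_real x * tr (schur_res x G F) = of_nat Q -
    tr (F * mat_inv (of_real x \<cdot>\<^sub>m G + mat_adjoint F * F) * mat_adjoint F)"
proof -
  have "tr (schur_cross x G F * mat_adjoint F) = of_nat Q - of_real x * tr (schur_res x G F)"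
    unfolding schur_cross_F' using schur_aux_dims by (simp add: tr_minus[where n = Q] tr_smult)
  then show ?thesis by (simp add: schur_cross_push_through)
qed

end

text \<open>The trace of the resolvent is monotone in \<open>G\<close>, and this bounds its growth. By \<open>tr_schur_res\<close> the increase is
\<open>tr W (K\<^sup>-\<^sup>1 - K'\<^sup>-\<^sup>1)\<close> up to the factor \<open>x\<close>, where \<open>W = F\<^sup>* F\<close>, \<open>K = x G + W\<close> and \<open>K' = K + d\<close> with
\<open>d = x \<epsilon>\<close>. As \<open>K\<close> and \<open>K'\<close> commute, this is \<open>d tr W C\<close> with \<open>C = K\<^sup>-\<^sup>1 K'\<^sup>-\<^sup>1\<close> positive, and
replacing \<open>W = K - x G\<close> by \<open>K\<close> leaves \<open>d tr K'\<^sup>-\<^sup>1\<close>, which is at most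
\<open>\<epsilon> tr (G + \<epsilon>)\<^sup>-\<^sup>1\<close>.\<close>

lemma tr_schur_res_shift:
  assumes G: "pd G" and N: "dim_row G = N" and F: "dim_row F = Q" "dim_col F = N" and x: "0 < x" and e: "0 < \<epsilon>"
  defines "G' \<equiv> G + of_real \<epsilon> \<cdot>\<^sub>m 1\<^sub>m N"
  shows "Re (tr (schur_res x G F)) \<le> Re (tr (schur_res x G' F))"
    "x * (Re (tr (schur_res x G' F)) - Re (tr (schur_res x G F))) \<le> \<epsilon> * Re (tr (mat_inv G'))"
proof -
  have [simp]: "dim_row G = N" "dim_col G = N" "dim_row F = Q" "dim_col F = N" using pd_dim[OF G] N F by auto
  have G': "pd G'" "dim_row G' = N" "dim_col G' = N"
    unfolding G'_def using e by (auto intro!: pd_add_psd[OF G] psd_smult pd_psd[OF pd_one])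
  \<comment> \<open>Shifting G by \<open>\<epsilon>\<close> shifts \<open>x G + F\<^sup>* F\<close> by d.\<close>
  define d where "d = x * \<epsilon>"
  have d: "0 < d" using x e by (simp add: d_def)
  define K where "K = of_real x \<cdot>\<^sub>m G + mat_adjoint F * F"
  define K' where "K' = of_real x \<cdot>\<^sub>m G' + mat_adjoint F * F"
  have K: "pd K" "dim_row K = N" and K': "pd K'" "dim_row K' = N"
    unfolding K_def K'_def using pd_gram_shift[OF G N F x] pd_gram_shift[OF G'(1,2) F x] by simp_all
  have Kc [simp]: "dim_row K = N" "dim_col K = N" "dim_row K' = N" "dim_col K' = N"
    using pd_dim[OF K(1)] pd_dim[OF K'(1)] K K' by auto
  have K'K: "K' = K + of_real d \<cdot>\<^sub>m 1\<^sub>m N"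
    unfolding K'_def K_def G'_def d_def by (rule mat_lin) (simp_all add: algebra_simps)
  define I where "I = mat_inv K"
  define J where "J = mat_inv K'"
  note iK = pd_inv[OF K, folded I_def] and iK' = pd_inv[OF K', folded J_def]
  note [simp] = iK(3,5,6) iK'(3,5,6)
  define C where "C = I * J"
  have [simp]: "dim_row C = N" "dim_col C = N" by (simp_all add: C_def)
  \<comment> \<open>The resolvent identity, once for each order of the factors.\<close>
  have IJ: "I = J + of_real d \<cdot>\<^sub>m (J * I)"
  proof -
    have "J * K' * I = J * K * I + of_real d \<cdot>\<^sub>m (J * I)" unfolding K'K by (simp add: mm_simps)
    then show ?thesis using iK(1) by (simp add: iK'(2) mm_assoc)
  qed
  have JI: "I = J + of_real d \<cdot>\<^sub>m C"
  proof -
    have "I * K' * J = I * K * J + of_real d \<cdot>\<^sub>m (I * J)" unfolding K'K by (simp add: mm_simps)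
    then show ?thesis using iK'(1) by (simp add: iK(2) mm_assoc C_def)
  qed
  \<comment> \<open>This exhibits the product C of two commuting inverses as positive.\<close>
  have "C = mat_adjoint J * J + of_real d \<cdot>\<^sub>m (mat_adjoint J * I * J)"
    unfolding C_def by (subst IJ) (simp add: mm_simps)
  moreover have "psd \<dots>"
    using d iK(4) by (intro psd_add psd_gram psd_smult psd_congr) auto
  ultimately have psdC: "psd C" by simp
  have diff: "of_real x * (tr (schur_res x G' F) - tr (schur_res x G F)) = of_real d * tr (F * C * mat_adjoint F)"
  proof -
    have "F * I * mat_adjoint F = F * J * mat_adjoint F + of_real d \<cdot>\<^sub>m (F * C * mat_adjoint F)"
      by (subst JI) (simp add: mm_simps)
    then have "tr (F * I * mat_adjoint F) = tr (F * J * mat_adjoint F) + of_real d * tr (F * C * mat_adjoint F)"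
      by (simp add: tr_add[where n = Q] tr_smult)
    moreover have "t - s = c" if "a = b + c" "s = q - a" "t = q - b" for a b c s t q :: complex
      using that by simp
    ultimately have "of_real x * tr (schur_res x G' F) - of_real x * tr (schur_res x G F) = of_real d * tr (F * C * mat_adjoint F)"
      using tr_schur_res[OF G N F x, folded K_def, folded I_def] tr_schur_res[OF G'(1,2) F x, folded K'_def, folded J_def]
      by blast
    then show ?thesis by (simp only: right_diff_distrib)
  qed
  have rdiff: "x * (Re (tr (schur_res x G' F)) - Re (tr (schur_res x G F))) = d * Re (tr (F * C * mat_adjoint F))"
    using arg_cong[OF diff, of Re] by simp
  have "0 \<le> Re (tr (F * C * mat_adjoint F))" by (intro psd_tr psd_congr' psdC) simp
  then have "0 \<le> x * (Re (tr (schur_res x G' F)) - Re (tr (schur_res x G F)))" using d rdiff by simp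
  then show "Re (tr (schur_res x G F)) \<le> Re (tr (schur_res x G' F))" using x by (simp add: zero_le_mult_iff)
  have "tr (F * C * mat_adjoint F) = tr (mat_adjoint F * F * C)"
    using tr_comm[of "F * C" "mat_adjoint F"] by (simp add: mm_assoc)
  also have "mat_adjoint F * F = K - of_real x \<cdot>\<^sub>m G"
    unfolding K_def by (rule mat_lin) simp_all
  also have "(K - of_real x \<cdot>\<^sub>m G) * C = J - of_real x \<cdot>\<^sub>m (G * C)"
  proof -
    have "K * C = J" using iK(1) by (simp add: C_def flip: mm_assoc)
    then show ?thesis by (simp add: mm_simps)
  qed
  also have "tr (J - of_real x \<cdot>\<^sub>m (G * C)) = tr J - of_real x * tr (G * C)"
    by (simp add: tr_minus[where n = N] tr_smult)
  finally have "Re (tr (F * C * mat_adjoint F)) = Re (tr J) - x * Re (tr (G * C))" by simp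
  moreover have "0 \<le> Re (tr (G * C))" by (rule tr_pd_psd_nonneg[OF G psdC N]) simp
  ultimately have le1: "Re (tr (F * C * mat_adjoint F)) \<le> Re (tr J)" using x by simp
  have le2: "Re (tr J) \<le> (1 / x) * Re (tr (mat_inv G'))"
  proof -
    have "psd (K' - of_real x \<cdot>\<^sub>m G')"
    proof -
      have "K' - of_real x \<cdot>\<^sub>m G' = mat_adjoint F * F" unfolding K'_def using G' by (intro mat_lin) simp_all
      then show ?thesis by (simp add: psd_gram)
    qed
    then have "Re (tr J) \<le> Re (tr (mat_inv (of_real x \<cdot>\<^sub>m G')))"
      unfolding J_def using G' by (intro tr_inv_antimono[OF pd_smult[OF G'(1) x] K'(1), of N]) auto
    also have "\<dots> = (1 / x) * Re (tr (mat_inv G'))"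
      using pd_inv[OF G'(1,2)] by (simp add: pd_inv_smult[OF G'(1) x] tr_smult del: of_real_divide)
    finally show ?thesis .
  qed
  have "x * (Re (tr (schur_res x G' F)) - Re (tr (schur_res x G F))) \<le> d * ((1 / x) * Re (tr (mat_inv G')))"
    unfolding rdiff using le1 le2 d by (intro mult_left_mono) auto
  also have "\<dots> = \<epsilon> * Re (tr (mat_inv G'))" using x by (simp add: d_def)
  finally show "x * (Re (tr (schur_res x G' F)) - Re (tr (schur_res x G F))) \<le> \<epsilon> * Re (tr (mat_inv G'))" .
qed

lemma psd_shift_diff: "psd A \<Longrightarrow> dim_row A = n \<Longrightarrow> psd (A + of_real e \<cdot>\<^sub>m 1\<^sub>m n - of_real e \<cdot>\<^sub>m 1\<^sub>m n)"
proof -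
  assume A: "psd A" "dim_row A = n"
  then have "A + of_real e \<cdot>\<^sub>m 1\<^sub>m n - of_real e \<cdot>\<^sub>m 1\<^sub>m n = A"
    using psd_dim[OF A(1)] by (intro mat_lin) auto
  then show ?thesis using A by simp
qed

text \<open>With \<open>I = (A + e)\<^sup>-\<^sup>1\<close>, the matrix \<open>e\<^sup>-\<^sup>2 - I\<^sup>2\<close> equals \<open>e\<^sup>-\<^sup>2 (1 - e I)\<^sup>2 + (2/e) I A I\<close>.\<close>

lemma bform_inv_shift:
  assumes A: "psd A" "dim_row A = n" and e: "0 < e"
  shows "bform {..<n} {..<n} (\<lambda>i j. mat_inv (A + of_real e \<cdot>\<^sub>m 1\<^sub>m n) $$ (i, j)) (1 / e)"
proof (rule bform_of_gram_bound)
  have [simp]: "dim_row A = n" "dim_col A = n" using psd_dim[OF A(1)] A by auto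
  define P where "P = A + of_real e \<cdot>\<^sub>m 1\<^sub>m n"
  have P: "pd P" "dim_row P = n" "dim_col P = n"
    unfolding P_def using e by (auto intro!: psd_add_pd[OF A(1)] pd_smult pd_one)
  define I where "I = mat_inv P"
  note i = pd_inv[OF P(1,2), folded I_def]
  note [simp] = i(3,5,6) P(2,3)
  have I1: "I = I * A * I + of_real e \<cdot>\<^sub>m (I * I)"
  proof -
    have "I * P * I = I * A * I + of_real e \<cdot>\<^sub>m (I * I)" unfolding P_def by (simp add: mm_simps)
    then show ?thesis using i by simp
  qed
  have p1: "psd (mat_adjoint I * A * I)" by (rule psd_congr[OF A(1)]) simp
  have p2: "psd (mat_adjoint (1\<^sub>m n - of_real e \<cdot>\<^sub>m I) * (1\<^sub>m n - of_real e \<cdot>\<^sub>m I))" by (rule psd_gram)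
  have "of_real ((1 / e)\<^sup>2) \<cdot>\<^sub>m 1\<^sub>m n - I * mat_adjoint I =
     of_real ((1 / e)\<^sup>2) \<cdot>\<^sub>m (mat_adjoint (1\<^sub>m n - of_real e \<cdot>\<^sub>m I) * (1\<^sub>m n - of_real e \<cdot>\<^sub>m I))
       + of_real (2 / e) \<cdot>\<^sub>m (mat_adjoint I * A * I)"
  proof (rule mat_lin)
    fix i j assume ij: "i < dim_row (of_real ((1 / e)\<^sup>2) \<cdot>\<^sub>m (mat_adjoint (1\<^sub>m n - of_real e \<cdot>\<^sub>m I) * (1\<^sub>m n - of_real e \<cdot>\<^sub>m I))
       + of_real (2 / e) \<cdot>\<^sub>m (mat_adjoint I * A * I))"
      "j < dim_col (of_real ((1 / e)\<^sup>2) \<cdot>\<^sub>m (mat_adjoint (1\<^sub>m n - of_real e \<cdot>\<^sub>m I) * (1\<^sub>m n - of_real e \<cdot>\<^sub>m I))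
       + of_real (2 / e) \<cdot>\<^sub>m (mat_adjoint I * A * I))"
    define a where "a = (I * A * I) $$ (i, j)"
    define b where "b = (I * I) $$ (i, j)"
    have "I $$ (i, j) = a + of_real e * b"
      using arg_cong[OF I1, of "\<lambda>M. M $$ (i, j)"] ij by (simp add: a_def b_def)
    then show "(of_real ((1 / e)\<^sup>2) \<cdot>\<^sub>m 1\<^sub>m n - I * mat_adjoint I) $$ (i, j) =
      (of_real ((1 / e)\<^sup>2) \<cdot>\<^sub>m (mat_adjoint (1\<^sub>m n - of_real e \<cdot>\<^sub>m I) * (1\<^sub>m n - of_real e \<cdot>\<^sub>m I))
       + of_real (2 / e) \<cdot>\<^sub>m (mat_adjoint I * A * I)) $$ (i, j)"
      using ij e by (simp add: mm_minus_left mm_minus_right mm_smult_left mm_smult_right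
          a_def[symmetric] b_def[symmetric]) (simp add: field_simps power2_eq_square)
  qed auto
  moreover have "psd \<dots>" using e p1 p2 by (intro psd_add psd_smult) auto
  ultimately show "psd (of_real ((1 / e)\<^sup>2) \<cdot>\<^sub>m 1\<^sub>m n - mat_inv (A + of_real e \<cdot>\<^sub>m 1\<^sub>m n) * mat_adjoint (mat_inv (A + of_real e \<cdot>\<^sub>m 1\<^sub>m n)))"
    by (simp only: I_def P_def)
  show "dim_row (mat_inv (A + of_real e \<cdot>\<^sub>m 1\<^sub>m n)) = n" "dim_col (mat_inv (A + of_real e \<cdot>\<^sub>m 1\<^sub>m n)) = n"
    using i(5,6) by (simp_all add: I_def P_def)
qed (use e in simp)

section \<open>Block Toeplitz matrices\<close>

lemma fourier_coeff_index:
  "k < a \<Longrightarrow> l < b \<Longrightarrow> fourier_coeff a b \<phi> j $$ (k, l) = fc (\<lambda>\<theta>. \<phi> \<theta> $$ (k, l)) j"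
  by (simp add: fourier_coeff_def fc_def ek_def)

lemma block_toeplitz_dim [simp]:
  "dim_row (block_toeplitz a b n \<phi>) = a * n" "dim_col (block_toeplitz a b n \<phi>) = b * n"
  by (simp_all add: block_toeplitz_def)

lemma block_index_less: "i < n \<Longrightarrow> \<alpha> < a \<Longrightarrow> i * a + \<alpha> < a * (n :: nat)"
proof -
  assume "i < n" "\<alpha> < a"
  then have "i * a + \<alpha> < Suc i * a" by simp
  also have "\<dots> \<le> n * a" using \<open>i < n\<close> by (intro mult_le_mono1) simp
  finally show ?thesis by (simp add: mult.commute)
qed

lemma block_toeplitz_index:
  assumes "i < n" "\<alpha> < a" "j < n" "\<beta> < b"
  shows "block_toeplitz a b n \<phi> $$ (i * a + \<alpha>, j * b + \<beta>) = fc (\<lambda>\<theta>. \<phi> \<theta> $$ (\<alpha>, \<beta>)) (int i - int j)"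
  using assms block_index_less[of i n \<alpha> a] block_index_less[of j n \<beta> b]
  by (simp add: block_toeplitz_def fourier_coeff_index)

text \<open>Sums over the index of a block matrix are sums over the block number and the position in the block;
together with \<open>block_toeplitz_index\<close> this replaces all computations with quotients and remainders.\<close>

lemma sum_blocks: "(\<Sum>p<a * n. f p) = (\<Sum>i<n. \<Sum>\<alpha><a. f (i * a + \<alpha> :: nat))"
proof -
  have e: "sum f {i * a..<i * a + a} = (\<Sum>\<alpha><a. f (i * a + \<alpha>))" for i
    using sum.shift_bounds_nat_ivl[of f 0 "i * a" a] by (simp add: lessThan_atLeast0 add.commute)
  have "(\<Sum>p<a * n. f p) = (\<Sum>i<n. sum f {i * a..<i * a + a})"
    by (simp add: sum.nat_group mult.commute)
  then show ?thesis by (simp only: e)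
qed

lemma block_index_cases:
  assumes "p < a * n"
  obtains i \<alpha> where "i < n" "\<alpha> < a" "p = i * a + (\<alpha> :: nat)"
proof -
  have "a > 0" using assms by (cases a) auto
  then show thesis using assms that[of "p div a" "p mod a"]
    by (simp add: less_mult_imp_div_less mult.commute)
qed

lemma block_index_eq_iff:
  assumes "\<alpha> < a" "\<beta> < (a :: nat)" shows "i * a + \<alpha> = j * a + \<beta> \<longleftrightarrow> i = j \<and> \<alpha> = \<beta>"
proof
  assume e: "i * a + \<alpha> = j * a + \<beta>"
  have "(i * a + \<alpha>) div a = i" "(j * a + \<beta>) div a = j" using assms by simp_all
  then have "i = j" using e by simp
  then show "i = j \<and> \<alpha> = \<beta>" using e by simp
qed simp

lemma block_matI:
  assumes "dim_row A = a * n" "dim_row B = a * n" "dim_col A = b * n" "dim_col B = b * n"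
    and "\<And>i \<alpha> j \<beta>. i < n \<Longrightarrow> \<alpha> < a \<Longrightarrow> j < n \<Longrightarrow> \<beta> < b \<Longrightarrow>
      A $$ (i * a + \<alpha>, j * b + \<beta>) = B $$ (i * a + \<alpha>, j * b + \<beta>)"
  shows "A = (B :: complex mat)"
proof (rule mat_lin)
  fix p r assume "p < dim_row B" "r < dim_col B"
  then have "p < a * n" "r < b * n" using assms by auto
  then show "A $$ (p, r) = B $$ (p, r)" using assms(5) by (auto elim!: block_index_cases)
qed (use assms in auto)

lemma extend_by_zero:
  assumes "inj_on h K'"
  obtains v' :: "'y \<Rightarrow> complex" where "\<And>i. i \<in> K' \<Longrightarrow> v' (h i) = v i" "\<And>i. i \<notin> h ` K' \<Longrightarrow> v' i = 0"
  by (rule that[of "\<lambda>p. if p \<in> h ` K' then v (inv_into K' h p) else 0"]) (use assms in auto)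

lemma bform_sub:
  fixes f :: "'c \<Rightarrow> 'a" and g :: "'d \<Rightarrow> 'b"
  assumes X: "bform I J X C" and fin: "finite I" "finite J"
    and f: "inj_on f I'" "f ` I' \<subseteq> I" and g: "inj_on g J'" "g ` J' \<subseteq> J"
  shows "bform I' J' (\<lambda>i j. X (f i) (g j)) C"
  unfolding bform_def
proof (intro conjI allI)
  show "0 \<le> C" using X by (simp add: bform_def)
  fix v :: "'c \<Rightarrow> complex" and w :: "'d \<Rightarrow> complex"
  obtain v' where v': "\<And>i. i \<in> I' \<Longrightarrow> v' (f i) = v i" "\<And>i. i \<notin> f ` I' \<Longrightarrow> v' i = 0"
    using extend_by_zero[OF f(1), of v] by blast
  obtain w' where w': "\<And>j. j \<in> J' \<Longrightarrow> w' (g j) = w j" "\<And>j. j \<notin> g ` J' \<Longrightarrow> w' j = 0"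
    using extend_by_zero[OF g(1), of w] by blast
  have S1: "(\<Sum>i\<in>I. v' i * y i) = (\<Sum>i\<in>I'. v i * y (f i))" for y
  proof -
    have "(\<Sum>i\<in>I. v' i * y i) = (\<Sum>i\<in>f ` I'. v' i * y i)"
      using fin f v' by (intro sum.mono_neutral_right) auto
    also have "\<dots> = (\<Sum>i\<in>I'. v i * y (f i))" using f v' by (simp add: sum.reindex)
    finally show ?thesis .
  qed
  have S2: "(\<Sum>j\<in>J. y j * w' j) = (\<Sum>j\<in>J'. y (g j) * w j)" for y
  proof -
    have "(\<Sum>j\<in>J. y j * w' j) = (\<Sum>j\<in>g ` J'. y j * w' j)"
      using fin g w' by (intro sum.mono_neutral_right) auto
    also have "\<dots> = (\<Sum>j\<in>J'. y (g j) * w j)" using g w' by (simp add: sum.reindex)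
    finally show ?thesis .
  qed
  have l2v: "l2 I v' = l2 I' v"
  proof -
    have "(\<Sum>i\<in>I. (cmod (v' i))\<^sup>2) = (\<Sum>i\<in>f ` I'. (cmod (v' i))\<^sup>2)"
      using fin f v' by (intro sum.mono_neutral_right) auto
    also have "\<dots> = (\<Sum>i\<in>I'. (cmod (v i))\<^sup>2)" using f v' by (simp add: sum.reindex)
    finally show ?thesis by (simp add: l2_def L2_set_def)
  qed
  have l2w: "l2 J w' = l2 J' w"
  proof -
    have "(\<Sum>j\<in>J. (cmod (w' j))\<^sup>2) = (\<Sum>j\<in>g ` J'. (cmod (w' j))\<^sup>2)"
      using fin g w' by (intro sum.mono_neutral_right) auto
    also have "\<dots> = (\<Sum>j\<in>J'. (cmod (w j))\<^sup>2)" using g w' by (simp add: sum.reindex)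
    finally show ?thesis by (simp add: l2_def L2_set_def)
  qed
  have "(\<Sum>i\<in>I. \<Sum>j\<in>J. v' i * X i j * w' j) = (\<Sum>i\<in>I. v' i * (\<Sum>j\<in>J. X i j * w' j))"
    by (simp add: sum_distrib_left mult.assoc)
  also have "\<dots> = (\<Sum>i\<in>I'. v i * (\<Sum>j\<in>J'. X (f i) (g j) * w j))" by (simp only: S1 S2)
  also have "\<dots> = (\<Sum>i\<in>I'. \<Sum>j\<in>J'. v i * X (f i) (g j) * w j)"
    by (simp add: sum_distrib_left mult.assoc)
  finally show "cmod (\<Sum>i\<in>I'. \<Sum>j\<in>J'. v i * X (f i) (g j) * w j) \<le> C * l2 I' v * l2 J' w"
    using bformD[OF X, of v' w'] by (simp add: l2v l2w)
qed

lemma bform_block: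
  fixes a b n :: nat
  assumes "bform {..<a * n} {..<b * n} X C" "\<alpha> < a" "\<beta> < b"
  shows "bform {..<n} {..<n} (\<lambda>i j. X (i * a + \<alpha>) (j * b + \<beta>)) C"
proof (rule bform_sub[OF assms(1), of "\<lambda>i. i * a + \<alpha>" _ "\<lambda>j. j * b + \<beta>"])
  show "inj_on (\<lambda>i. i * a + \<alpha>) {..<n}" "inj_on (\<lambda>j. j * b + \<beta>) {..<n}"
    using block_index_eq_iff[OF assms(2,2)] block_index_eq_iff[OF assms(3,3)] by (simp_all add: inj_on_def)
  show "(\<lambda>i. i * a + \<alpha>) ` {..<n} \<subseteq> {..<a * n}" "(\<lambda>j. j * b + \<beta>) ` {..<n} \<subseteq> {..<b * n}"
    using block_index_less[OF _ assms(2)] block_index_less[OF _ assms(3)] by (simp_all add: image_subset_iff)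
qed (rule finite_lessThan)+

lemma bform_entry:
  assumes "bform I J X C" "finite I" "finite J" "i \<in> I" "j \<in> J"
  shows "cmod (X i j) \<le> C"
proof -
  have "cmod (X i j) \<le> l2 J (X i)" unfolding l2_def by (rule member_le_L2_set[OF assms(3,5)])
  also have "\<dots> \<le> C" by (rule bform_row[OF assms(1,2,4)])
  finally show ?thesis .
qed

text \<open>Boundedness is required at every point and not only almost everywhere; the symbols to which this
is applied satisfy it.\<close>

definition bdd_symbol :: "nat \<Rightarrow> nat \<Rightarrow> (real \<Rightarrow> complex mat) \<Rightarrow> real \<Rightarrow> bool" where
  "bdd_symbol a b h H \<longleftrightarrow> (\<forall>\<theta>\<in>{-pi..pi}. h \<theta> \<in> carrier_mat a b) \<and>
    (\<forall>i<a. \<forall>j<b. (\<lambda>\<theta>. h \<theta> $$ (i, j)) \<in> borel_measurable circ) \<and>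
    (\<forall>\<theta>\<in>{-pi..pi}. \<forall>i<a. \<forall>j<b. cmod (h \<theta> $$ (i, j)) \<le> H)"

lemma fc_cong: "(\<And>\<theta>. \<theta> \<in> {-pi..pi} \<Longrightarrow> u \<theta> = v \<theta>) \<Longrightarrow> fc u j = fc v j"
  unfolding fc_def by (intro arg_cong2[of _ _ _ _ "(*)"] Bochner_Integration.integral_cong) auto

text \<open>Entrywise the defect is a sum of scalar defects, and the submatrices of \<open>X n\<close> that are obtained by
fixing the positions inside the blocks inherit the norm bound.\<close>

theorem block_asymptotic_multiplicativity:
  assumes k: "L1_symbol a b k" and h: "bdd_symbol b c h H"
    and X: "\<And>n. dim_row (X n) = c * n" "\<And>n. dim_col (X n) = a * n"
      "\<And>n. bform {..<c * n} {..<a * n} (\<lambda>i j. X n $$ (i, j)) C"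
  shows "(\<lambda>n. tr (X n * (block_toeplitz a b n k * block_toeplitz b c n h
      - block_toeplitz a c n (\<lambda>\<theta>. k \<theta> * h \<theta>))) / of_nat n) \<longlonglongrightarrow> 0"
proof -
  define K where "K \<alpha> \<beta> \<theta> = k \<theta> $$ (\<alpha>, \<beta>)" for \<alpha> \<beta> \<theta>
  define h' where "h' \<beta> \<gamma> \<theta> = h \<theta> $$ (\<beta>, \<gamma>)" for \<beta> \<gamma> \<theta>
  have kc: "\<And>\<theta>. \<theta> \<in> {-pi..pi} \<Longrightarrow> k \<theta> \<in> carrier_mat a b"
    and ki: "\<And>\<alpha> \<beta>. \<alpha> < a \<Longrightarrow> \<beta> < b \<Longrightarrow> integrable circ (K \<alpha> \<beta>)"
    using k by (auto simp: L1_symbol_def K_def[abs_def])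
  have hc: "\<And>\<theta>. \<theta> \<in> {-pi..pi} \<Longrightarrow> h \<theta> \<in> carrier_mat b c"
    and hm: "\<And>\<beta> \<gamma>. \<beta> < b \<Longrightarrow> \<gamma> < c \<Longrightarrow> h' \<beta> \<gamma> \<in> borel_measurable circ"
    and hb: "\<And>\<beta> \<gamma> \<theta>. \<beta> < b \<Longrightarrow> \<gamma> < c \<Longrightarrow> \<theta> \<in> {-pi..pi} \<Longrightarrow> cmod (h' \<beta> \<gamma> \<theta>) \<le> H"
    using h by (auto simp: bdd_symbol_def h'_def[abs_def])
  define D where "D n = block_toeplitz a b n k * block_toeplitz b c n h - block_toeplitz a c n (\<lambda>\<theta>. k \<theta> * h \<theta>)" for n
  have Ddim [simp]: "dim_row (D n) = a * n" "dim_col (D n) = c * n" for n by (simp_all add: D_def)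
  have D: "D n $$ (i * a + \<alpha>, l * c + \<gamma>) = (\<Sum>\<beta><b. toeplitz_defect (K \<alpha> \<beta>) (h' \<beta> \<gamma>) n i l)"
    if "i < n" "\<alpha> < a" "l < n" "\<gamma> < c" for n i \<alpha> l \<gamma>
  proof -
    note less = block_index_less[OF that(1,2)] block_index_less[OF that(3,4)]
    have "(block_toeplitz a b n k * block_toeplitz b c n h) $$ (i * a + \<alpha>, l * c + \<gamma>)
      = (\<Sum>j<n. \<Sum>\<beta><b. fc (K \<alpha> \<beta>) (int i - int j) * fc (h' \<beta> \<gamma>) (int j - int l))"
      using less that by (simp add: mat_mult_index sum_blocks block_toeplitz_index K_def[abs_def] h'_def[abs_def])
    also have "\<dots> = (\<Sum>\<beta><b. \<Sum>j<n. fc (K \<alpha> \<beta>) (int i - int j) * fc (h' \<beta> \<gamma>) (int j - int l))"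
      by (rule sum.swap)
    finally have 1: "(block_toeplitz a b n k * block_toeplitz b c n h) $$ (i * a + \<alpha>, l * c + \<gamma>)
      = (\<Sum>\<beta><b. \<Sum>j<n. fc (K \<alpha> \<beta>) (int i - int j) * fc (h' \<beta> \<gamma>) (int j - int l))" .
    have "block_toeplitz a c n (\<lambda>\<theta>. k \<theta> * h \<theta>) $$ (i * a + \<alpha>, l * c + \<gamma>)
      = fc (\<lambda>\<theta>. (k \<theta> * h \<theta>) $$ (\<alpha>, \<gamma>)) (int i - int l)"
      using that by (simp add: block_toeplitz_index)
    also have "\<dots> = fc (\<lambda>\<theta>. \<Sum>\<beta><b. K \<alpha> \<beta> \<theta> * h' \<beta> \<gamma> \<theta>) (int i - int l)"
    proof (rule fc_cong)
      fix \<theta> assume "\<theta> \<in> {-pi..pi}"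
      from kc[OF this] hc[OF this] show "(k \<theta> * h \<theta>) $$ (\<alpha>, \<gamma>) = (\<Sum>\<beta><b. K \<alpha> \<beta> \<theta> * h' \<beta> \<gamma> \<theta>)"
        using that by (simp add: mat_mult_index K_def h'_def)
    qed
    also have "\<dots> = (\<Sum>\<beta><b. fc (\<lambda>\<theta>. K \<alpha> \<beta> \<theta> * h' \<beta> \<gamma> \<theta>) (int i - int l))"
      by (rule fc_sum, simp, rule integrable_mult_bdd[OF ki hm hb]) (use that in auto)
    finally show ?thesis using 1 less by (simp add: D_def toeplitz_defect_def sum_subtractf)
  qed
  have T: "tr (X n * D n) = (\<Sum>\<gamma><c. \<Sum>\<alpha><a. \<Sum>\<beta><b. \<Sum>l<n. \<Sum>i<n.
      X n $$ (l * c + \<gamma>, i * a + \<alpha>) * toeplitz_defect (K \<alpha> \<beta>) (h' \<beta> \<gamma>) n i l)" for n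
  proof -
    let ?t = "\<lambda>l \<gamma> i \<alpha> \<beta>. X n $$ (l * c + \<gamma>, i * a + \<alpha>) * toeplitz_defect (K \<alpha> \<beta>) (h' \<beta> \<gamma>) n i l"
    have "tr (X n * D n) = (\<Sum>p<c * n. \<Sum>r<a * n. X n $$ (p, r) * D n $$ (r, p))"
      using X by (simp add: tr_def mat_mult_index)
    also have "\<dots> = (\<Sum>l<n. \<Sum>\<gamma><c. \<Sum>i<n. \<Sum>\<alpha><a. \<Sum>\<beta><b. ?t l \<gamma> i \<alpha> \<beta>)"
      by (simp add: sum_blocks D sum_distrib_left)
    also have "\<dots> = (\<Sum>\<gamma><c. \<Sum>l<n. \<Sum>i<n. \<Sum>\<alpha><a. \<Sum>\<beta><b. ?t l \<gamma> i \<alpha> \<beta>)" by (rule sum.swap)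
    also have "\<dots> = (\<Sum>\<gamma><c. \<Sum>l<n. \<Sum>\<alpha><a. \<Sum>i<n. \<Sum>\<beta><b. ?t l \<gamma> i \<alpha> \<beta>)"
      by (intro sum.cong refl sum.swap)
    also have "\<dots> = (\<Sum>\<gamma><c. \<Sum>\<alpha><a. \<Sum>l<n. \<Sum>i<n. \<Sum>\<beta><b. ?t l \<gamma> i \<alpha> \<beta>)"
      by (intro sum.cong refl sum.swap)
    also have "\<dots> = (\<Sum>\<gamma><c. \<Sum>\<alpha><a. \<Sum>l<n. \<Sum>\<beta><b. \<Sum>i<n. ?t l \<gamma> i \<alpha> \<beta>)"
      by (intro sum.cong refl sum.swap)
    also have "\<dots> = (\<Sum>\<gamma><c. \<Sum>\<alpha><a. \<Sum>\<beta><b. \<Sum>l<n. \<Sum>i<n. ?t l \<gamma> i \<alpha> \<beta>)"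
      by (intro sum.cong refl sum.swap)
    finally show ?thesis .
  qed
  have "(\<lambda>n. \<Sum>\<gamma><c. \<Sum>\<alpha><a. \<Sum>\<beta><b. (\<Sum>l<n. \<Sum>i<n.
      X n $$ (l * c + \<gamma>, i * a + \<alpha>) * toeplitz_defect (K \<alpha> \<beta>) (h' \<beta> \<gamma>) n i l) / of_nat n) \<longlonglongrightarrow> 0"
  proof (intro tendsto_null_sum)
    fix \<gamma> \<alpha> \<beta> assume "\<gamma> \<in> {..<c}" "\<alpha> \<in> {..<a}" "\<beta> \<in> {..<b}"
    then have l: "\<gamma> < c" "\<alpha> < a" "\<beta> < b" by auto
    show "(\<lambda>n. (\<Sum>l<n. \<Sum>i<n. X n $$ (l * c + \<gamma>, i * a + \<alpha>) * toeplitz_defect (K \<alpha> \<beta>) (h' \<beta> \<gamma>) n i l) / of_nat n) \<longlonglongrightarrow> 0"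
      by (rule scalar_asymptotic_multiplicativity[OF hm[OF l(3,1)] hb[OF l(3,1)] bform_block[OF X(3) l(1,2)] ki[OF l(2,3)]])
  qed
  then show ?thesis by (simp only: T D_def[symmetric] sum_divide_distrib)
qed

lemma fc_cnj: "fc (\<lambda>\<theta>. cnj (u \<theta>)) j = cnj (fc u (- j))"
proof -
  have "(\<integral>\<theta>. cnj (u \<theta>) * ek (- j) \<theta> \<partial>circ) = (\<integral>\<theta>. cnj (u \<theta> * ek j \<theta>) \<partial>circ)"
    by (simp add: cnj_ek)
  also have "\<dots> = cnj (\<integral>\<theta>. u \<theta> * ek j \<theta> \<partial>circ)" by (rule Bochner_Integration.integral_cnj)
  finally show ?thesis by (simp add: fc_def)
qed

lemma block_toeplitz_adjoint:
  assumes "\<And>\<theta>. \<theta> \<in> {-pi..pi} \<Longrightarrow> \<phi> \<theta> \<in> carrier_mat a b"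
  shows "block_toeplitz b a n (\<lambda>\<theta>. mat_adjoint (\<phi> \<theta>)) = mat_adjoint (block_toeplitz a b n \<phi>)"
proof (rule block_matI[where a = b and b = a and n = n])
  fix i \<beta> j \<alpha> assume l: "i < n" "\<beta> < b" "j < n" "\<alpha> < a"
  have "fc (\<lambda>\<theta>. mat_adjoint (\<phi> \<theta>) $$ (\<beta>, \<alpha>)) (int i - int j) = fc (\<lambda>\<theta>. cnj (\<phi> \<theta> $$ (\<alpha>, \<beta>))) (int i - int j)"
  proof (rule fc_cong)
    fix \<theta> assume "\<theta> \<in> {-pi..pi}"
    from assms[OF this] l show "mat_adjoint (\<phi> \<theta>) $$ (\<beta>, \<alpha>) = cnj (\<phi> \<theta> $$ (\<alpha>, \<beta>))" by simp
  qed
  then show "block_toeplitz b a n (\<lambda>\<theta>. mat_adjoint (\<phi> \<theta>)) $$ (i * b + \<beta>, j * a + \<alpha>) =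
      mat_adjoint (block_toeplitz a b n \<phi>) $$ (i * b + \<beta>, j * a + \<alpha>)"
    using l by (simp add: block_index_less block_toeplitz_index fc_cnj)
qed auto

lemma block_toeplitz_cong:
  assumes "\<And>\<theta>. \<theta> \<in> {-pi..pi} \<Longrightarrow> \<phi> \<theta> = \<psi> \<theta>"
  shows "block_toeplitz a b n \<phi> = block_toeplitz a b n \<psi>"
proof (rule block_matI[where a = a and b = b and n = n])
  fix i \<alpha> j \<beta> assume l: "i < n" "\<alpha> < a" "j < n" "\<beta> < b"
  have "fc (\<lambda>\<theta>. \<phi> \<theta> $$ (\<alpha>, \<beta>)) (int i - int j) = fc (\<lambda>\<theta>. \<psi> \<theta> $$ (\<alpha>, \<beta>)) (int i - int j)"
    by (rule fc_cong) (simp add: assms)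
  then show "block_toeplitz a b n \<phi> $$ (i * a + \<alpha>, j * b + \<beta>) = block_toeplitz a b n \<psi> $$ (i * a + \<alpha>, j * b + \<beta>)"
    using l by (simp add: block_toeplitz_index)
qed auto

lemma integrable_const_circ: "integrable circ (\<lambda>\<theta>. c :: complex)"
  by (rule integrable_bounded_circ[of _ "cmod c"]) auto

lemma fc_const: "fc (\<lambda>\<theta>. c) j = (if j = 0 then c else 0)"
  using fc_cmult[of c "ek 0" j] fc_ek[of 0 j] by simp

lemma block_toeplitz_add:
  assumes "L1_symbol a b \<phi>" "L1_symbol a b \<psi>"
  shows "block_toeplitz a b n (\<lambda>\<theta>. \<phi> \<theta> + \<psi> \<theta>) = block_toeplitz a b n \<phi> + block_toeplitz a b n \<psi>"
proof (rule block_matI[where a = a and b = b and n = n])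
  fix i \<alpha> j \<beta> assume l: "i < n" "\<alpha> < a" "j < n" "\<beta> < b"
  have "fc (\<lambda>\<theta>. (\<phi> \<theta> + \<psi> \<theta>) $$ (\<alpha>, \<beta>)) (int i - int j) = fc (\<lambda>\<theta>. \<phi> \<theta> $$ (\<alpha>, \<beta>) + \<psi> \<theta> $$ (\<alpha>, \<beta>)) (int i - int j)"
  proof (rule fc_cong)
    fix \<theta> assume "\<theta> \<in> {-pi..pi}"
    then have "\<phi> \<theta> \<in> carrier_mat a b" "\<psi> \<theta> \<in> carrier_mat a b" using assms by (simp_all add: L1_symbol_def)
    then show "(\<phi> \<theta> + \<psi> \<theta>) $$ (\<alpha>, \<beta>) = \<phi> \<theta> $$ (\<alpha>, \<beta>) + \<psi> \<theta> $$ (\<alpha>, \<beta>)" using l by simp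
  qed
  also have "\<dots> = fc (\<lambda>\<theta>. \<phi> \<theta> $$ (\<alpha>, \<beta>)) (int i - int j) + fc (\<lambda>\<theta>. \<psi> \<theta> $$ (\<alpha>, \<beta>)) (int i - int j)"
    by (rule fc_add) (use assms l in \<open>auto simp: L1_symbol_def\<close>)
  finally show "block_toeplitz a b n (\<lambda>\<theta>. \<phi> \<theta> + \<psi> \<theta>) $$ (i * a + \<alpha>, j * b + \<beta>) =
      (block_toeplitz a b n \<phi> + block_toeplitz a b n \<psi>) $$ (i * a + \<alpha>, j * b + \<beta>)"
    using l by (simp add: block_toeplitz_index block_index_less)
qed auto

lemma block_toeplitz_smult:
  assumes "\<And>\<theta>. \<theta> \<in> {-pi..pi} \<Longrightarrow> \<phi> \<theta> \<in> carrier_mat a b"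
  shows "block_toeplitz a b n (\<lambda>\<theta>. c \<cdot>\<^sub>m \<phi> \<theta>) = c \<cdot>\<^sub>m block_toeplitz a b n \<phi>"
proof (rule block_matI[where a = a and b = b and n = n])
  fix i \<alpha> j \<beta> assume l: "i < n" "\<alpha> < a" "j < n" "\<beta> < b"
  have "fc (\<lambda>\<theta>. (c \<cdot>\<^sub>m \<phi> \<theta>) $$ (\<alpha>, \<beta>)) (int i - int j) = fc (\<lambda>\<theta>. c * \<phi> \<theta> $$ (\<alpha>, \<beta>)) (int i - int j)"
  proof (rule fc_cong)
    fix \<theta> assume "\<theta> \<in> {-pi..pi}"
    from assms[OF this] l show "(c \<cdot>\<^sub>m \<phi> \<theta>) $$ (\<alpha>, \<beta>) = c * \<phi> \<theta> $$ (\<alpha>, \<beta>)" by simp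
  qed
  then show "block_toeplitz a b n (\<lambda>\<theta>. c \<cdot>\<^sub>m \<phi> \<theta>) $$ (i * a + \<alpha>, j * b + \<beta>) =
      (c \<cdot>\<^sub>m block_toeplitz a b n \<phi>) $$ (i * a + \<alpha>, j * b + \<beta>)"
    using l by (simp add: block_toeplitz_index block_index_less fc_cmult)
qed auto

lemma block_toeplitz_one: "block_toeplitz a a n (\<lambda>\<theta>. 1\<^sub>m a) = 1\<^sub>m (a * n)"
proof (rule block_matI[where a = a and b = a and n = n])
  fix i \<alpha> j \<beta> assume l: "i < n" "\<alpha> < a" "j < n" "\<beta> < a"
  then show "block_toeplitz a a n (\<lambda>\<theta>. 1\<^sub>m a) $$ (i * a + \<alpha>, j * a + \<beta>) = 1\<^sub>m (a * n) $$ (i * a + \<alpha>, j * a + \<beta>)"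
    by (simp add: block_toeplitz_index block_index_less fc_const block_index_eq_iff)
qed auto

lemma L1_symbol_const: "A \<in> carrier_mat a b \<Longrightarrow> L1_symbol a b (\<lambda>\<theta>. A)"
  by (auto simp: L1_symbol_def integrable_const_circ)

lemma bdd_symbol_L1: "bdd_symbol a b h H \<Longrightarrow> L1_symbol a b h"
  by (auto simp: L1_symbol_def bdd_symbol_def intro!: integrable_bounded_circ[of _ H])

lemma tr_block_toeplitz:
  assumes "L1_symbol a a \<phi>"
  shows "tr (block_toeplitz a a n \<phi>) = of_nat n * (1 / (2 * of_real pi) * (\<integral>\<theta>. tr (\<phi> \<theta>) \<partial>circ))"
proof -
  have "tr (block_toeplitz a a n \<phi>) = (\<Sum>i<n. \<Sum>\<alpha><a. fc (\<lambda>\<theta>. \<phi> \<theta> $$ (\<alpha>, \<alpha>)) 0)"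
    by (simp add: tr_def sum_blocks block_toeplitz_index)
  also have "\<dots> = of_nat n * fc (\<lambda>\<theta>. \<Sum>\<alpha><a. \<phi> \<theta> $$ (\<alpha>, \<alpha>)) 0"
    using assms by (subst fc_sum) (auto simp: L1_symbol_def)
  also have "fc (\<lambda>\<theta>. \<Sum>\<alpha><a. \<phi> \<theta> $$ (\<alpha>, \<alpha>)) 0 = fc (\<lambda>\<theta>. tr (\<phi> \<theta>)) 0"
    by (rule fc_cong) (use assms in \<open>auto simp: L1_symbol_def tr_def\<close>)
  finally show ?thesis by (simp add: fc_def)
qed

subsection \<open>Positivity\<close>

text \<open>The vector-valued trigonometric polynomial whose coefficients are the blocks of \<open>w\<close>.\<close>

definition vhat :: "nat \<Rightarrow> nat \<Rightarrow> complex mat \<Rightarrow> real \<Rightarrow> complex mat" where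
  "vhat a n w \<theta> = mat a 1 (\<lambda>(\<alpha>, _). trigp int {..<n} (\<lambda>i. w $$ (i * a + \<alpha>, 0)) \<theta>)"

lemma qf_block_toeplitz:
  assumes g: "L1_symbol a a g" and w: "dim_row w = a * n" "dim_col w = 1"
  shows "integrable circ (\<lambda>\<theta>. qf (g \<theta>) (vhat a n w \<theta>))"
    "qf (block_toeplitz a a n g) w = 1 / (2 * of_real pi) * (\<integral>\<theta>. qf (g \<theta>) (vhat a n w \<theta>) \<partial>circ)"
proof -
  define W where "W \<alpha> i = w $$ (i * a + \<alpha>, 0)" for \<alpha> i
  define P where "P \<alpha> \<beta> \<theta> = g \<theta> $$ (\<alpha>, \<beta>) *
      (trigp (\<lambda>i. - int i) {..<n} (\<lambda>i. cnj (W \<alpha> i)) \<theta> * trigp int {..<n} (W \<beta>) \<theta>)" for \<alpha> \<beta> \<theta>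
  have gi: "\<alpha> < a \<Longrightarrow> \<beta> < a \<Longrightarrow> integrable circ (\<lambda>\<theta>. g \<theta> $$ (\<alpha>, \<beta>))" for \<alpha> \<beta>
    using g by (auto simp: L1_symbol_def)
  have Pi: "integrable circ (P \<alpha> \<beta>)" if "\<alpha> < a" "\<beta> < a" for \<alpha> \<beta>
    unfolding P_def
    by (rule integrable_mult_bdd[OF gi[OF that], of _ "(\<Sum>i<n. cmod (cnj (W \<alpha> i))) * (\<Sum>i<n. cmod (W \<beta> i))"])
       (auto simp del: complex_mod_cnj intro!: mult_mono norm_trigp_le sum_nonneg simp: norm_mult)
  have q: "qf (g \<theta>) (vhat a n w \<theta>) = (\<Sum>\<alpha><a. \<Sum>\<beta><a. P \<alpha> \<beta> \<theta>)" if "\<theta> \<in> {-pi..pi}" for \<theta>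
  proof -
    have c: "dim_row (g \<theta>) = a" "dim_col (g \<theta>) = a" using g that by (auto simp: L1_symbol_def)
    have v: "dim_row (vhat a n w \<theta>) = a" "dim_col (vhat a n w \<theta>) = 1" by (simp_all add: vhat_def)
    have e: "vhat a n w \<theta> $$ (\<alpha>, 0) = trigp int {..<n} (W \<alpha>) \<theta>" if "\<alpha> < a" for \<alpha>
      using that by (simp add: vhat_def W_def[abs_def])
    have ce: "cnj (trigp int {..<n} (W \<alpha>) \<theta>) = trigp (\<lambda>i. - int i) {..<n} (\<lambda>i. cnj (W \<alpha> i)) \<theta>" for \<alpha>
      by (simp add: trigp_def cnj_ek)
    have "qf (g \<theta>) (vhat a n w \<theta>) = (\<Sum>\<beta><a. \<Sum>\<alpha><a. P \<alpha> \<beta> \<theta>)"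
      using c v by (simp add: qf_def mat_mult_index e ce P_def sum_distrib_right sum_distrib_left ac_simps)
    then show ?thesis by (subst sum.swap) simp
  qed
  have "integrable circ (\<lambda>\<theta>. \<Sum>\<alpha><a. \<Sum>\<beta><a. P \<alpha> \<beta> \<theta>)"
    by (intro Bochner_Integration.integrable_sum Pi) auto
  then show "integrable circ (\<lambda>\<theta>. qf (g \<theta>) (vhat a n w \<theta>))"
    by (subst Bochner_Integration.integrable_cong[OF refl q]) auto
  have "(\<integral>\<theta>. qf (g \<theta>) (vhat a n w \<theta>) \<partial>circ) = (\<integral>\<theta>. (\<Sum>\<alpha><a. \<Sum>\<beta><a. P \<alpha> \<beta> \<theta>) \<partial>circ)"
    by (rule Bochner_Integration.integral_cong[OF refl]) (simp add: q)
  also have "\<dots> = (\<Sum>\<alpha><a. \<Sum>\<beta><a. \<integral>\<theta>. P \<alpha> \<beta> \<theta> \<partial>circ)"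
  proof -
    have "(\<integral>\<theta>. (\<Sum>\<alpha><a. \<Sum>\<beta><a. P \<alpha> \<beta> \<theta>) \<partial>circ) = (\<Sum>\<alpha><a. \<integral>\<theta>. (\<Sum>\<beta><a. P \<alpha> \<beta> \<theta>) \<partial>circ)"
      by (intro Bochner_Integration.integral_sum Bochner_Integration.integrable_sum Pi) auto
    also have "\<dots> = (\<Sum>\<alpha><a. \<Sum>\<beta><a. \<integral>\<theta>. P \<alpha> \<beta> \<theta> \<partial>circ)"
      by (intro sum.cong refl Bochner_Integration.integral_sum Pi) auto
    finally show ?thesis .
  qed
  finally have I: "1 / (2 * of_real pi) * (\<integral>\<theta>. qf (g \<theta>) (vhat a n w \<theta>) \<partial>circ)
     = (\<Sum>\<alpha><a. \<Sum>\<beta><a. 1 / (2 * of_real pi) * (\<integral>\<theta>. P \<alpha> \<beta> \<theta> \<partial>circ))"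
    by (simp add: sum_distrib_left)
  have "qf (block_toeplitz a a n g) w = (\<Sum>r<a * n. \<Sum>p<a * n. cnj (w $$ (p, 0)) * block_toeplitz a a n g $$ (p, r) * w $$ (r, 0))"
    using w by (simp add: qf_def mat_mult_index sum_distrib_right)
  also have "\<dots> = (\<Sum>p<a * n. \<Sum>r<a * n. cnj (w $$ (p, 0)) * block_toeplitz a a n g $$ (p, r) * w $$ (r, 0))"
    by (rule sum.swap)
  also have "\<dots> = (\<Sum>i<n. \<Sum>\<alpha><a. \<Sum>l<n. \<Sum>\<beta><a. cnj (W \<alpha> i) * fc (\<lambda>\<theta>. g \<theta> $$ (\<alpha>, \<beta>)) (int i - int l) * W \<beta> l)"
    by (simp add: sum_blocks block_toeplitz_index W_def)
  also have "\<dots> = (\<Sum>\<alpha><a. \<Sum>i<n. \<Sum>l<n. \<Sum>\<beta><a. cnj (W \<alpha> i) * fc (\<lambda>\<theta>. g \<theta> $$ (\<alpha>, \<beta>)) (int i - int l) * W \<beta> l)"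
    by (rule sum.swap)
  also have "\<dots> = (\<Sum>\<alpha><a. \<Sum>i<n. \<Sum>\<beta><a. \<Sum>l<n. cnj (W \<alpha> i) * fc (\<lambda>\<theta>. g \<theta> $$ (\<alpha>, \<beta>)) (int i - int l) * W \<beta> l)"
    by (intro sum.cong refl sum.swap)
  also have "\<dots> = (\<Sum>\<alpha><a. \<Sum>\<beta><a. \<Sum>i<n. \<Sum>l<n. cnj (W \<alpha> i) * fc (\<lambda>\<theta>. g \<theta> $$ (\<alpha>, \<beta>)) (int i - int l) * W \<beta> l)"
    by (intro sum.cong refl sum.swap)
  also have "\<dots> = (\<Sum>\<alpha><a. \<Sum>\<beta><a. 1 / (2 * of_real pi) * (\<integral>\<theta>. P \<alpha> \<beta> \<theta> \<partial>circ))"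
    by (intro sum.cong refl) (subst toeplitz_form[OF gi], auto simp: P_def[abs_def])
  finally show "qf (block_toeplitz a a n g) w = 1 / (2 * of_real pi) * (\<integral>\<theta>. qf (g \<theta>) (vhat a n w \<theta>) \<partial>circ)"
    by (simp only: I)
qed

text \<open>The form of the Toeplitz matrix at \<open>w\<close> is the mean of the forms of \<open>g\<close> at \<open>vhat a n w\<close>. If that mean
vanishes, the trigonometric polynomial is zero almost everywhere, hence \<open>w = 0\<close> by Parseval.\<close>

theorem pd_block_toeplitz:
  assumes g: "L1_symbol a a g" and pos: "\<And>\<theta>. \<theta> \<in> {-pi..pi} \<Longrightarrow> pd (g \<theta>)"
  shows "pd (block_toeplitz a a n g)"
  unfolding pd_def
proof (intro conjI allI impI)
  show "dim_row (block_toeplitz a a n g) = dim_col (block_toeplitz a a n g)" by simp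
  have c: "\<And>\<theta>. \<theta> \<in> {-pi..pi} \<Longrightarrow> g \<theta> \<in> carrier_mat a a" using g by (auto simp: L1_symbol_def)
  have "block_toeplitz a a n (\<lambda>\<theta>. mat_adjoint (g \<theta>)) = block_toeplitz a a n g"
    by (rule block_toeplitz_cong) (use pos pd_herm in auto)
  then show "mat_adjoint (block_toeplitz a a n g) = block_toeplitz a a n g"
    using block_toeplitz_adjoint[OF c] by simp
  fix w :: "complex mat"
  assume "dim_row w = dim_row (block_toeplitz a a n g) \<and> dim_col w = 1 \<and> w \<noteq> 0\<^sub>m (dim_row (block_toeplitz a a n g)) 1"
  then have w: "dim_row w = a * n" "dim_col w = 1" "w \<noteq> 0\<^sub>m (a * n) 1" by auto
  note Q = qf_block_toeplitz[OF g w(1,2)]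
  define q where "q \<theta> = Re (qf (g \<theta>) (vhat a n w \<theta>))" for \<theta>
  have qi: "integrable circ q" unfolding q_def using Q(1) by (rule integrable_Re)
  have v: "dim_row (vhat a n w \<theta>) = a" "dim_col (vhat a n w \<theta>) = 1" for \<theta> by (simp_all add: vhat_def)
  have q0: "0 \<le> q \<theta>" if "\<theta> \<in> {-pi..pi}" for \<theta>
    unfolding q_def using psdD[OF pd_psd[OF pos[OF that]]] c[OF that] v by auto
  have Re: "Re (qf (block_toeplitz a a n g) w) = 1 / (2 * pi) * (\<integral>\<theta>. q \<theta> \<partial>circ)"
  proof -
    have "Re (qf (block_toeplitz a a n g) w) = Re (of_real (1 / (2 * pi)) * (\<integral>\<theta>. qf (g \<theta>) (vhat a n w \<theta>) \<partial>circ))"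
      unfolding Q(2) by simp
    also have "\<dots> = 1 / (2 * pi) * Re (\<integral>\<theta>. qf (g \<theta>) (vhat a n w \<theta>) \<partial>circ)"
      by (simp only: Re_complex_of_real times_complex.sel Im_complex_of_real mult_zero_left diff_0_right)
    also have "Re (\<integral>\<theta>. qf (g \<theta>) (vhat a n w \<theta>) \<partial>circ) = (\<integral>\<theta>. q \<theta> \<partial>circ)"
      unfolding q_def using Q(1) by simp
    finally show ?thesis .
  qed
  have "(\<integral>\<theta>. q \<theta> \<partial>circ) \<noteq> 0"
  proof
    assume "(\<integral>\<theta>. q \<theta> \<partial>circ) = 0"
    moreover have "AE \<theta> in circ. 0 \<le> q \<theta>" by (rule AE_I2) (simp add: q0)
    ultimately have AEq: "AE \<theta> in circ. q \<theta> = 0"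
      using integral_nonneg_eq_0_iff_AE[OF qi] by simp
    have z: "w $$ (i * a + \<alpha>, 0) = 0" if l: "i < n" "\<alpha> < a" for i \<alpha>
    proof -
      have "AE \<theta> in circ. (cmod (trigp int {..<n} (\<lambda>i. w $$ (i * a + \<alpha>, 0)) \<theta>))\<^sup>2 = 0"
        using AEq
      proof (rule AE_mp, intro AE_I2 impI)
        fix \<theta> assume th: "\<theta> \<in> space circ" and "q \<theta> = 0"
        then have th': "\<theta> \<in> {-pi..pi}" by simp
        have "vhat a n w \<theta> = 0\<^sub>m a 1"
        proof (rule ccontr)
          assume "vhat a n w \<theta> \<noteq> 0\<^sub>m a 1"
          then have "0 < Re (qf (g \<theta>) (vhat a n w \<theta>))"
            using c[OF th'] v by (intro pdD[OF pos[OF th']]) auto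
          with \<open>q \<theta> = 0\<close> show False by (simp add: q_def)
        qed
        from arg_cong[OF this, of "\<lambda>M. M $$ (\<alpha>, 0)"] l
        show "(cmod (trigp int {..<n} (\<lambda>i. w $$ (i * a + \<alpha>, 0)) \<theta>))\<^sup>2 = 0" by (simp add: vhat_def)
      qed
      then have "(\<integral>\<theta>. (cmod (trigp int {..<n} (\<lambda>i. w $$ (i * a + \<alpha>, 0)) \<theta>))\<^sup>2 \<partial>circ) = 0"
        by (rule integral_eq_zero_AE)
      then have "(\<Sum>i<n. (cmod (w $$ (i * a + \<alpha>, 0)))\<^sup>2) = 0"
        using parseval[of "{..<n}" int "\<lambda>i. w $$ (i * a + \<alpha>, 0)"] by simp
      then show ?thesis using l by (simp add: sum_nonneg_eq_0_iff)
    qed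
    have "w = 0\<^sub>m (a * n) 1"
    proof (rule eq_matI)
      fix p r assume "p < dim_row (0\<^sub>m (a * n) 1 :: complex mat)" "r < dim_col (0\<^sub>m (a * n) 1 :: complex mat)"
      then have p: "p < a * n" "r = 0" by auto
      from p(1) obtain i \<alpha> where "i < n" "\<alpha> < a" "p = i * a + \<alpha>" by (rule block_index_cases)
      then show "w $$ (p, r) = 0\<^sub>m (a * n) 1 $$ (p, r)" using z p by simp
    qed (use w in auto)
    with w show False by simp
  qed
  moreover have "0 \<le> (\<integral>\<theta>. q \<theta> \<partial>circ)" using q0 by (intro Bochner_Integration.integral_nonneg) auto
  ultimately show "0 < Re (qf (block_toeplitz a a n g) w)" unfolding Re by simp
qed

section \<open>Measurability of pointwise matrix operations\<close>

definition mat_measurable :: "nat \<Rightarrow> nat \<Rightarrow> (real \<Rightarrow> complex mat) \<Rightarrow> bool" where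
  "mat_measurable a b \<phi> \<longleftrightarrow> (\<forall>\<theta>\<in>{-pi..pi}. \<phi> \<theta> \<in> carrier_mat a b) \<and>
    (\<forall>i<a. \<forall>j<b. (\<lambda>\<theta>. \<phi> \<theta> $$ (i, j)) \<in> borel_measurable circ)"

lemma mat_measurable_dim:
  "mat_measurable a b \<phi> \<Longrightarrow> \<theta> \<in> {-pi..pi} \<Longrightarrow> dim_row (\<phi> \<theta>) = a"
  "mat_measurable a b \<phi> \<Longrightarrow> \<theta> \<in> {-pi..pi} \<Longrightarrow> dim_col (\<phi> \<theta>) = b"
  unfolding mat_measurable_def by (auto dest!: bspec)

lemma mat_measurable_entry:
  "mat_measurable a b \<phi> \<Longrightarrow> i < a \<Longrightarrow> j < b \<Longrightarrow> (\<lambda>\<theta>. \<phi> \<theta> $$ (i, j)) \<in> borel_measurable circ"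
  unfolding mat_measurable_def by simp

lemma mat_measurableI:
  assumes "\<And>\<theta>. \<theta> \<in> {-pi..pi} \<Longrightarrow> dim_row (\<phi> \<theta>) = a" "\<And>\<theta>. \<theta> \<in> {-pi..pi} \<Longrightarrow> dim_col (\<phi> \<theta>) = b"
    and "\<And>i j. i < a \<Longrightarrow> j < b \<Longrightarrow> u i j \<in> borel_measurable circ"
    and "\<And>i j \<theta>. i < a \<Longrightarrow> j < b \<Longrightarrow> \<theta> \<in> {-pi..pi} \<Longrightarrow> \<phi> \<theta> $$ (i, j) = u i j \<theta>"
  shows "mat_measurable a b \<phi>"
  unfolding mat_measurable_def
proof (intro conjI allI impI ballI)
  fix i j assume l: "i < a" "j < b"
  show "(\<lambda>\<theta>. \<phi> \<theta> $$ (i, j)) \<in> borel_measurable circ"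
    by (subst measurable_cong[of circ _ "u i j"]) (use assms l in auto)
qed (use assms in \<open>auto intro!: carrier_matI\<close>)

lemma L1_symbol_measurable: "L1_symbol a b \<phi> \<Longrightarrow> mat_measurable a b \<phi>"
  unfolding L1_symbol_def mat_measurable_def using borel_measurable_integrable by blast

lemma mat_measurable_mult:
  assumes \<phi>: "mat_measurable a b \<phi>" and \<psi>: "mat_measurable b c \<psi>"
  shows "mat_measurable a c (\<lambda>\<theta>. \<phi> \<theta> * \<psi> \<theta>)"
proof (rule mat_measurableI[where u = "\<lambda>i j \<theta>. \<Sum>k<b. \<phi> \<theta> $$ (i, k) * \<psi> \<theta> $$ (k, j)"])
  fix i j assume l: "i < a" "j < c"
  show "(\<lambda>\<theta>. \<Sum>k<b. \<phi> \<theta> $$ (i, k) * \<psi> \<theta> $$ (k, j)) \<in> borel_measurable circ"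
    using l by (intro borel_measurable_sum borel_measurable_times mat_measurable_entry[OF \<phi>] mat_measurable_entry[OF \<psi>]) auto
qed (simp_all add: mat_measurable_dim[OF \<phi>] mat_measurable_dim[OF \<psi>] mat_mult_index)

lemma mat_measurable_add:
  assumes \<phi>: "mat_measurable a b \<phi>" and \<psi>: "mat_measurable a b \<psi>"
  shows "mat_measurable a b (\<lambda>\<theta>. \<phi> \<theta> + \<psi> \<theta>)"
proof (rule mat_measurableI[where u = "\<lambda>i j \<theta>. \<phi> \<theta> $$ (i, j) + \<psi> \<theta> $$ (i, j)"])
  fix i j assume l: "i < a" "j < b"
  show "(\<lambda>\<theta>. \<phi> \<theta> $$ (i, j) + \<psi> \<theta> $$ (i, j)) \<in> borel_measurable circ"
    using l by (intro borel_measurable_add mat_measurable_entry[OF \<phi>] mat_measurable_entry[OF \<psi>]) auto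
qed (simp_all add: mat_measurable_dim[OF \<phi>] mat_measurable_dim[OF \<psi>])

lemma mat_measurable_const: "A \<in> carrier_mat a b \<Longrightarrow> mat_measurable a b (\<lambda>\<theta>. A)"
  by (rule mat_measurableI[where u = "\<lambda>i j \<theta>. A $$ (i, j)"]) auto

lemma mat_measurable_adjoint:
  assumes \<phi>: "mat_measurable a b \<phi>" shows "mat_measurable b a (\<lambda>\<theta>. mat_adjoint (\<phi> \<theta>))"
proof (rule mat_measurableI[where u = "\<lambda>i j \<theta>. cnj (\<phi> \<theta> $$ (j, i))"])
  fix i j assume l: "i < b" "j < a"
  have "(\<lambda>\<theta>. \<phi> \<theta> $$ (j, i)) \<in> borel_measurable circ" by (rule mat_measurable_entry[OF \<phi> l(2,1)])
  then show "(\<lambda>\<theta>. cnj (\<phi> \<theta> $$ (j, i))) \<in> borel_measurable circ"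
    by (rule measurable_compose) (intro borel_measurable_continuous_onI continuous_intros)
qed (simp_all add: mat_measurable_dim[OF \<phi>])

lemma measurable_det:
  assumes \<phi>: "mat_measurable n n \<phi>" shows "(\<lambda>\<theta>. det (\<phi> \<theta>)) \<in> borel_measurable circ"
proof -
  have "(\<lambda>\<theta>. \<Sum>p\<in>{p. p permutes {0..<n}}. signof p * (\<Prod>i = 0..<n. \<phi> \<theta> $$ (i, p i))) \<in> borel_measurable circ"
  proof (intro borel_measurable_sum borel_measurable_times borel_measurable_prod borel_measurable_const)
    fix p i assume "p \<in> {p. p permutes {0..<n}}" "i \<in> {0..<n}"
    then have "i < n" "p i < n" using permutes_in_image[of p "{0..<n}" i] by auto
    then show "(\<lambda>\<theta>. \<phi> \<theta> $$ (i, p i)) \<in> borel_measurable circ" by (rule mat_measurable_entry[OF \<phi>])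
  qed
  moreover have "det (\<phi> \<theta>) = (\<Sum>p\<in>{p. p permutes {0..<n}}. signof p * (\<Prod>i = 0..<n. \<phi> \<theta> $$ (i, p i)))"
    if "\<theta> \<in> space circ" for \<theta>
    using that mat_measurable_dim[OF \<phi>, of \<theta>] by (intro det_def') (auto intro!: carrier_matI)
  ultimately show ?thesis by (subst measurable_cong) auto
qed

text \<open>The cofactor formula, with the default value of \<open>mat_inv\<close> for singular matrices; it shows that the
entries of the inverse are measurable functions of the entries.\<close>

lemma mat_inv_adj_mat:
  fixes A :: "complex mat"
  assumes A: "A \<in> carrier_mat n n" and l: "i < n" "j < n"
  shows "mat_inv A $$ (i, j) = (if det A = 0 then 0 else (1 / det A) * ((-1) ^ (j + i) * det (mat_delete A j i)))"
proof (cases "det A = 0")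
  case True
  have "mat_inverse A = None"
  proof (rule ccontr)
    assume "mat_inverse A \<noteq> None"
    then obtain B where "mat_inverse A = Some B" by auto
    from mat_inverse(2)[OF A this] have B: "A * B = 1\<^sub>m n" "B \<in> carrier_mat n n" by auto
    from det_mult[OF A B(2)] have "det A * det B = 1" using B by simp
    then show False using True by simp
  qed
  then show ?thesis using True A l by (simp add: mat_inv_def)
next
  case False
  note i = mat_inv_correct[OF A False]
  have [simp]: "dim_row A = n" "dim_col A = n" using A by auto
  have [simp]: "dim_row (adj_mat A) = n" "dim_col (adj_mat A) = n" using adj_mat(1)[OF A] by auto
  have "mat_inv A * (A * adj_mat A) = adj_mat A" using i by (simp flip: mm_assoc)
  then have "adj_mat A = det A \<cdot>\<^sub>m mat_inv A" using adj_mat(2)[OF A] by (simp add: mm_smult_right)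
  from arg_cong[OF this, of "\<lambda>M. M $$ (i, j)"] have "adj_mat A $$ (i, j) = det A * mat_inv A $$ (i, j)"
    using l by simp
  moreover have "adj_mat A $$ (i, j) = (-1) ^ (j + i) * det (mat_delete A j i)"
    using l by (simp add: adj_mat_def cofactor_def)
  ultimately show ?thesis using False by (simp add: field_simps)
qed

lemma mat_measurable_inv:
  assumes \<phi>: "mat_measurable n n \<phi>" shows "mat_measurable n n (\<lambda>\<theta>. mat_inv (\<phi> \<theta>))"
proof (rule mat_measurableI[where u = "\<lambda>i j \<theta>. if det (\<phi> \<theta>) = 0 then 0 else
    (1 / det (\<phi> \<theta>)) * ((-1) ^ (j + i) * det (mat_delete (\<phi> \<theta>) j i))"])
  fix i j assume l: "i < n" "j < n"
  note [measurable] = measurable_det[OF \<phi>]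
  have "mat_measurable (n - 1) (n - 1) (\<lambda>\<theta>. mat_delete (\<phi> \<theta>) j i)"
  proof (rule mat_measurableI[where u = "\<lambda>k m \<theta>. \<phi> \<theta> $$ (if k < j then k else Suc k, if m < i then m else Suc m)"])
    fix k m assume "k < n - 1" "m < n - 1"
    then show "(\<lambda>\<theta>. \<phi> \<theta> $$ (if k < j then k else Suc k, if m < i then m else Suc m)) \<in> borel_measurable circ"
      by (intro mat_measurable_entry[OF \<phi>]) auto
  qed (simp_all add: mat_measurable_dim[OF \<phi>] mat_delete_def)
  note [measurable] = measurable_det[OF this]
  show "(\<lambda>\<theta>. if det (\<phi> \<theta>) = 0 then 0 else (1 / det (\<phi> \<theta>)) * ((-1) ^ (j + i) * det (mat_delete (\<phi> \<theta>) j i)))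
     \<in> borel_measurable circ"
    by measurable
next
  fix i j \<theta> assume l: "i < n" "j < n" and "\<theta> \<in> {-pi..pi}"
  then have "\<phi> \<theta> \<in> carrier_mat n n" using mat_measurable_dim[OF \<phi>] by (intro carrier_matI) auto
  then show "mat_inv (\<phi> \<theta>) $$ (i, j) = (if det (\<phi> \<theta>) = 0 then 0 else
    (1 / det (\<phi> \<theta>)) * ((-1) ^ (j + i) * det (mat_delete (\<phi> \<theta>) j i)))"
    using l by (rule mat_inv_adj_mat)
qed (simp_all add: mat_measurable_dim[OF \<phi>])

lemma mat_measurable_schur:
  assumes "mat_measurable s s g" "mat_measurable q s f"
  shows "mat_measurable q q (\<lambda>\<theta>. schur (g \<theta>) (f \<theta>))"
  unfolding schur_def
  by (rule mat_measurable_mult[OF mat_measurable_mult[OF assms(2) mat_measurable_inv[OF assms(1)]]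
      mat_measurable_adjoint[OF assms(2)]])

lemma mat_measurable_cong:
  assumes "mat_measurable a b \<phi>" "\<And>\<theta>. \<theta> \<in> {-pi..pi} \<Longrightarrow> \<phi> \<theta> = \<psi> \<theta>"
  shows "mat_measurable a b \<psi>"
  using assms(1) mat_measurable_dim[OF assms(1)] assms(2)
  by (intro mat_measurableI[where u = "\<lambda>i j \<theta>. \<phi> \<theta> $$ (i, j)"]) (auto intro: mat_measurable_entry)

lemma mat_measurable_schur_res:
  assumes "mat_measurable s s g" "mat_measurable q s f"
  shows "mat_measurable q q (\<lambda>\<theta>. schur_res x (g \<theta>) (f \<theta>))"
proof (rule mat_measurable_cong)
  show "mat_measurable q q (\<lambda>\<theta>. mat_inv (of_real x \<cdot>\<^sub>m 1\<^sub>m q + schur (g \<theta>) (f \<theta>)))"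
    by (intro mat_measurable_inv mat_measurable_add mat_measurable_const mat_measurable_schur[OF assms]) auto
qed (simp add: schur_res_def mat_measurable_dim[OF assms(2)])

lemma mat_measurable_schur_cross:
  assumes "mat_measurable s s g" "mat_measurable q s f"
  shows "mat_measurable q s (\<lambda>\<theta>. schur_cross x (g \<theta>) (f \<theta>))"
  unfolding schur_cross_def
  by (rule mat_measurable_mult[OF mat_measurable_mult[OF mat_measurable_schur_res[OF assms] assms(2)]
      mat_measurable_inv[OF assms(1)]])

lemma measurable_tr:
  assumes "mat_measurable n n \<phi>" shows "(\<lambda>\<theta>. tr (\<phi> \<theta>)) \<in> borel_measurable circ"
proof (subst measurable_cong)
  show "tr (\<phi> \<theta>) = (\<Sum>i<n. \<phi> \<theta> $$ (i, i))" if "\<theta> \<in> space circ" for \<theta>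
    using that by (simp add: tr_def mat_measurable_dim[OF assms])
  show "(\<lambda>\<theta>. \<Sum>i<n. \<phi> \<theta> $$ (i, i)) \<in> borel_measurable circ"
    by (intro borel_measurable_sum mat_measurable_entry[OF assms]) auto
qed

lemma bdd_symbolI:
  assumes "mat_measurable a b h" "\<And>\<theta>. \<theta> \<in> {-pi..pi} \<Longrightarrow> bform {..<a} {..<b} (\<lambda>i j. h \<theta> $$ (i, j)) H"
  shows "bdd_symbol a b h H"
  unfolding bdd_symbol_def
proof (intro conjI ballI allI impI)
  fix \<theta> i j assume "\<theta> \<in> {-pi..pi}" "i < a" "j < b"
  then show "cmod (h \<theta> $$ (i, j)) \<le> H" using bform_entry[OF assms(2)] by simp
qed (use assms(1) in \<open>simp_all add: mat_measurable_def\<close>)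

section \<open>Limits of resolvent traces\<close>

text \<open>Exchange of the limits in \<open>n\<close> and \<open>k\<close>: the error of the approximation is controlled, both before and
after the limit in \<open>n\<close>, by quantities that have the limits \<open>I k\<close>.\<close>

lemma perturbation_limit:
  fixes A :: "nat \<Rightarrow> real"
  assumes x: "0 < x" and A: "\<And>k. (\<lambda>n. A' k n) \<longlonglongrightarrow> L' k" and B: "\<And>k. (\<lambda>n. B k n) \<longlonglongrightarrow> I k"
    and le: "\<And>k n. A n \<le> A' k n" "\<And>k n. x * (A' k n - A n) \<le> B k n"
    and le': "\<And>k. L \<le> L' k" "\<And>k. x * (L' k - L) \<le> I k"
    and I: "I \<longlonglongrightarrow> (0::real)"
  shows "A \<longlonglongrightarrow> L"
proof (rule LIMSEQ_I)
  fix r :: real assume r: "r > 0"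
  then have xr: "0 < x * r / 4" using x by simp
  from LIMSEQ_D[OF I this] obtain k where "\<bar>I k\<bar> < x * r / 4" by auto
  then have k: "I k < x * r / 4" by simp
  from LIMSEQ_D[OF A[of k], of "r / 4"] r obtain n1 where n1: "\<And>n. n \<ge> n1 \<Longrightarrow> \<bar>A' k n - L' k\<bar> < r / 4" by auto
  from LIMSEQ_D[OF B[of k] xr] obtain n2 where n2: "\<And>n. n \<ge> n2 \<Longrightarrow> \<bar>B k n - I k\<bar> < x * r / 4" by auto
  have "\<bar>A n - L\<bar> < r" if "n \<ge> max n1 n2" for n
  proof -
    have "\<bar>B k n - I k\<bar> < x * r / 4" "\<bar>A' k n - L' k\<bar> < r / 4" using n1[of n] n2[of n] that by auto
    then have "B k n - I k < x * r / 4" and 3: "A' k n - L' k < r / 4" "L' k - A' k n < r / 4" by linarith+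
    then have "B k n < x * r / 2" using k by linarith
    then have "x * (A' k n - A n) < x * (r / 2)" using le(2)[of k n] by simp
    then have 1: "A' k n - A n < r / 2" using x by simp
    have "x * (L' k - L) < x * (r / 4)" using le'(2)[of k] k by simp
    then have 2: "L' k - L < r / 4" using x by simp
    show ?thesis using 1 2 3 le(1)[of n k] le'(1)[of k] by linarith
  qed
  then show "\<exists>no. \<forall>n\<ge>no. norm (A n - L) < r" by (intro exI[of _ "max n1 n2"]) auto
qed

lemma L1_symbol_adjoint: "L1_symbol a b \<phi> \<Longrightarrow> L1_symbol b a (\<lambda>\<theta>. mat_adjoint (\<phi> \<theta>))"
proof -
  assume \<phi>: "L1_symbol a b \<phi>"
  note m = L1_symbol_measurable[OF \<phi>]
  have "integrable circ (\<lambda>\<theta>. mat_adjoint (\<phi> \<theta>) $$ (i, j))" if "i < b" "j < a" for i j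
  proof (subst Bochner_Integration.integrable_cong[OF refl])
    show "mat_adjoint (\<phi> \<theta>) $$ (i, j) = cnj (\<phi> \<theta> $$ (j, i))" if "\<theta> \<in> space circ" for \<theta>
      using that \<open>i < b\<close> \<open>j < a\<close> by (simp add: mat_measurable_dim[OF m])
    show "integrable circ (\<lambda>\<theta>. cnj (\<phi> \<theta> $$ (j, i)))" using \<phi> that by (simp add: L1_symbol_def)
  qed
  then show ?thesis using mat_measurable_adjoint[OF m] by (simp add: L1_symbol_def mat_measurable_def)
qed

lemma L1_symbol_add:
  assumes "L1_symbol a b \<phi>" "L1_symbol a b \<psi>" shows "L1_symbol a b (\<lambda>\<theta>. \<phi> \<theta> + \<psi> \<theta>)"
proof -
  note m = L1_symbol_measurable[OF assms(1)] L1_symbol_measurable[OF assms(2)]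
  have "integrable circ (\<lambda>\<theta>. (\<phi> \<theta> + \<psi> \<theta>) $$ (i, j))" if "i < a" "j < b" for i j
  proof (subst Bochner_Integration.integrable_cong[OF refl])
    show "(\<phi> \<theta> + \<psi> \<theta>) $$ (i, j) = \<phi> \<theta> $$ (i, j) + \<psi> \<theta> $$ (i, j)" if "\<theta> \<in> space circ" for \<theta>
      using that \<open>i < a\<close> \<open>j < b\<close> by (simp add: mat_measurable_dim[OF m(1)] mat_measurable_dim[OF m(2)])
    show "integrable circ (\<lambda>\<theta>. \<phi> \<theta> $$ (i, j) + \<psi> \<theta> $$ (i, j))" using assms that by (simp add: L1_symbol_def)
  qed
  then show ?thesis using mat_measurable_add[OF m] by (simp add: L1_symbol_def mat_measurable_def)
qed

lemma bform_adjoint: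
  assumes V: "bform {..<m} {..<k} (\<lambda>i j. V $$ (i, j)) C" and d: "dim_row V = m" "dim_col V = k"
  shows "bform {..<k} {..<m} (\<lambda>i j. mat_adjoint V $$ (i, j)) C"
  unfolding bform_def
proof (intro conjI allI)
  show "0 \<le> C" using V by (simp add: bform_def)
  fix v w :: "nat \<Rightarrow> complex"
  have "(\<Sum>i<k. \<Sum>j<m. v i * mat_adjoint V $$ (i, j) * w j) = (\<Sum>j<m. \<Sum>i<k. v i * mat_adjoint V $$ (i, j) * w j)"
    by (rule sum.swap)
  also have "\<dots> = cnj (\<Sum>j<m. \<Sum>i<k. cnj (w j) * V $$ (j, i) * cnj (v i))"
    by (simp add: d ac_simps)
  finally have "cmod (\<Sum>i<k. \<Sum>j<m. v i * mat_adjoint V $$ (i, j) * w j)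
      = cmod (\<Sum>j<m. \<Sum>i<k. cnj (w j) * V $$ (j, i) * cnj (v i))" by (simp only: complex_mod_cnj)
  also have "\<dots> \<le> C * l2 {..<m} (\<lambda>j. cnj (w j)) * l2 {..<k} (\<lambda>i. cnj (v i))" by (rule bformD[OF V])
  finally show "cmod (\<Sum>i<k. \<Sum>j<m. v i * mat_adjoint V $$ (i, j) * w j) \<le> C * l2 {..<k} v * l2 {..<m} w"
    by (simp add: l2_def ac_simps)
qed

context
  fixes s q :: nat and f g :: "real \<Rightarrow> complex mat"
  assumes g: "L1_symbol s s g" and gpd: "\<And>\<theta>. \<theta> \<in> {-pi..pi} \<Longrightarrow> pd (g \<theta>)" and f: "L1_symbol q s f"
begin

text \<open>The context fixes symbols with \<open>g\<close> positive definite at every point of the interval; the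
exceptional null set is removed in the main proof.\<close>

abbreviation (input) "TG n \<equiv> block_toeplitz s s n g"
abbreviation (input) "TF n \<equiv> block_toeplitz q s n f"

lemma gdim: "\<theta> \<in> {-pi..pi} \<Longrightarrow> dim_row (g \<theta>) = s" "\<theta> \<in> {-pi..pi} \<Longrightarrow> dim_col (g \<theta>) = s"
  and fdim: "\<theta> \<in> {-pi..pi} \<Longrightarrow> dim_row (f \<theta>) = q" "\<theta> \<in> {-pi..pi} \<Longrightarrow> dim_col (f \<theta>) = s"
  using mat_measurable_dim[OF L1_symbol_measurable[OF g]] mat_measurable_dim[OF L1_symbol_measurable[OF f]] by auto

lemma pd_TG: "pd (TG n)" by (rule pd_block_toeplitz[OF g gpd])

definition g_shift :: "real \<Rightarrow> real \<Rightarrow> complex mat" where "g_shift e \<theta> = g \<theta> + of_real e \<cdot>\<^sub>m 1\<^sub>m s"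

definition TG_shift :: "real \<Rightarrow> nat \<Rightarrow> complex mat" where "TG_shift e n = TG n + of_real e \<cdot>\<^sub>m 1\<^sub>m (s * n)"

lemma g_shift_L1: "L1_symbol s s (g_shift e)"
  unfolding g_shift_def[abs_def] by (intro L1_symbol_add g L1_symbol_const) simp

lemma g_shift_toeplitz: "block_toeplitz s s n (g_shift e) = TG_shift e n"
proof -
  have "block_toeplitz s s n (g_shift e) = TG n + block_toeplitz s s n (\<lambda>\<theta>. of_real e \<cdot>\<^sub>m 1\<^sub>m s)"
    unfolding g_shift_def[abs_def] by (intro block_toeplitz_add g L1_symbol_const) simp
  also have "block_toeplitz s s n (\<lambda>\<theta>. of_real e \<cdot>\<^sub>m 1\<^sub>m s) = of_real e \<cdot>\<^sub>m 1\<^sub>m (s * n)"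
    by (subst block_toeplitz_smult) (auto simp: block_toeplitz_one)
  finally show ?thesis by (simp add: TG_shift_def)
qed

lemma g_shift_pd: "0 \<le> e \<Longrightarrow> \<theta> \<in> {-pi..pi} \<Longrightarrow> pd (g_shift e \<theta>)"
  unfolding g_shift_def using gdim by (intro pd_add_psd gpd psd_smult pd_psd[OF pd_one]) auto

lemma g_shift_dim: "\<theta> \<in> {-pi..pi} \<Longrightarrow> dim_row (g_shift e \<theta>) = s" "\<theta> \<in> {-pi..pi} \<Longrightarrow> dim_col (g_shift e \<theta>) = s"
  by (simp_all add: g_shift_def)

lemma TG_shift_pd: "0 \<le> e \<Longrightarrow> pd (TG_shift e n)" "dim_row (TG_shift e n) = s * n" "dim_col (TG_shift e n) = s * n"
  unfolding TG_shift_def by (auto intro!: pd_add_psd pd_TG psd_smult pd_psd[OF pd_one])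

lemma g_shift_measurable: "mat_measurable s s (g_shift e)" and f_measurable: "mat_measurable q s f"
  using L1_symbol_measurable g_shift_L1 f by auto

lemma inv_trace_limit:
  assumes e: "0 < e"
  shows "(\<lambda>n. tr (mat_inv (TG_shift e n)) / of_nat n) \<longlonglongrightarrow> 1 / (2 * of_real pi) * (\<integral>\<theta>. tr (mat_inv (g_shift e \<theta>)) \<partial>circ)"
proof -
  define h where "h \<theta> = mat_inv (g_shift e \<theta>)" for \<theta>
  have hb: "bdd_symbol s s h (1 / e)"
    unfolding h_def
    by (intro bdd_symbolI mat_measurable_inv g_shift_measurable)
       (use gdim in \<open>auto simp: g_shift_def intro!: bform_inv_shift pd_psd gpd e\<close>)
  define I where "I n = mat_inv (TG_shift e n)" for n
  have Ip: "I n * TG_shift e n = 1\<^sub>m (s * n)" and Id: "dim_row (I n) = s * n" "dim_col (I n) = s * n" for n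
    using pd_inv[OF TG_shift_pd(1,2), of e n] e by (simp_all add: I_def)
  have lim: "(\<lambda>n. tr (I n * (block_toeplitz s s n (g_shift e) * block_toeplitz s s n h
      - block_toeplitz s s n (\<lambda>\<theta>. g_shift e \<theta> * h \<theta>))) / of_nat n) \<longlonglongrightarrow> 0"
  proof (rule block_asymptotic_multiplicativity[OF g_shift_L1 hb Id])
    show "bform {..<s * n} {..<s * n} (\<lambda>i j. I n $$ (i, j)) (1 / e)" for n
      unfolding I_def TG_shift_def by (rule bform_inv_shift[OF pd_psd[OF pd_TG] _ e]) simp
  qed
  have one: "block_toeplitz s s n (\<lambda>\<theta>. g_shift e \<theta> * h \<theta>) = 1\<^sub>m (s * n)" for n
  proof -
    have "block_toeplitz s s n (\<lambda>\<theta>. g_shift e \<theta> * h \<theta>) = block_toeplitz s s n (\<lambda>\<theta>. 1\<^sub>m s)"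
      by (rule block_toeplitz_cong) (use pd_inv(1)[OF g_shift_pd g_shift_dim(1)] e in \<open>auto simp: h_def\<close>)
    then show ?thesis by (simp add: block_toeplitz_one)
  qed
  have "tr (I n * (block_toeplitz s s n (g_shift e) * block_toeplitz s s n h
      - block_toeplitz s s n (\<lambda>\<theta>. g_shift e \<theta> * h \<theta>))) = tr (block_toeplitz s s n h) - tr (I n)" for n
  proof -
    have "I n * (TG_shift e n * block_toeplitz s s n h - 1\<^sub>m (s * n)) = block_toeplitz s s n h - I n"
      using Id TG_shift_pd(2,3)[of e n] Ip[of n] by (simp add: mm_minus_right flip: mm_assoc)
    then show ?thesis unfolding one g_shift_toeplitz using Id by (simp add: tr_minus[where n = "s * n"])
  qed
  then have "(\<lambda>n. tr (block_toeplitz s s n h) / of_nat n - tr (I n) / of_nat n) \<longlonglongrightarrow> 0"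
    using lim by (simp only: diff_divide_distrib)
  moreover have "(\<lambda>n. tr (block_toeplitz s s n h) / of_nat n) \<longlonglongrightarrow> 1 / (2 * of_real pi) * (\<integral>\<theta>. tr (h \<theta>) \<partial>circ)"
  proof (rule tendsto_eventually, rule eventually_sequentiallyI[of 1])
    fix n :: nat assume "1 \<le> n"
    then show "tr (block_toeplitz s s n h) / of_nat n = 1 / (2 * of_real pi) * (\<integral>\<theta>. tr (h \<theta>) \<partial>circ)"
      by (subst tr_block_toeplitz[OF bdd_symbol_L1[OF hb]]) simp
  qed
  ultimately have "(\<lambda>n. tr (block_toeplitz s s n h) / of_nat n - (tr (block_toeplitz s s n h) / of_nat n - tr (I n) / of_nat n))
     \<longlonglongrightarrow> 1 / (2 * of_real pi) * (\<integral>\<theta>. tr (h \<theta>) \<partial>circ) - 0" by (intro tendsto_diff)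
  then show ?thesis by (simp add: I_def h_def)
qed

text \<open>Write \<open>R\<close>, \<open>V\<close> for the resolvent and its companion for the Toeplitz matrices, and \<open>r\<close>, \<open>v\<close> for the
resolvent of the symbols and the adjoint of its companion, so that \<open>(g + e) v = f\<^sup>* r\<close> and
\<open>f v = 1 - x r\<close>. Then \<open>T(r) - R\<close> equals \<open>-V D\<^sub>1 + V D\<^sub>2 + R D\<^sub>3\<close>, where
\<open>D\<^sub>1\<close>, \<open>D\<^sub>2\<close>, \<open>D\<^sub>3\<close> are the defects of multiplicativity of the products \<open>(g + e) v\<close>, \<open>f\<^sup>* r\<close> and \<open>f v\<close>.\<close>

lemma shifted_resolvent_limit:
  assumes e: "0 < e" and x: "0 < x"
  shows "(\<lambda>n. tr (schur_res x (TG_shift e n) (TF n)) / of_nat n) \<longlonglongrightarrow>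
    1 / (2 * of_real pi) * (\<integral>\<theta>. tr (schur_res x (g_shift e \<theta>) (f \<theta>)) \<partial>circ)"
proof -
  define r where "r \<theta> = schur_res x (g_shift e \<theta>) (f \<theta>)" for \<theta>
  define v where "v \<theta> = mat_adjoint (schur_cross x (g_shift e \<theta>) (f \<theta>))" for \<theta>
  have e0: "0 \<le> e" using e by simp
  note gp = g_shift_pd[OF e0]
  have rb: "bdd_symbol q q r (1 / x)"
    unfolding r_def
    by (rule bdd_symbolI[OF mat_measurable_schur_res[OF g_shift_measurable f_measurable]])
       (rule bform_schur_res[OF gp g_shift_dim(1) fdim x])
  have vb: "bdd_symbol s q v (1 / sqrt (e * x))"
    unfolding v_def
  proof (rule bdd_symbolI[OF mat_measurable_adjoint[OF mat_measurable_schur_cross[OF g_shift_measurable f_measurable]]])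
    fix \<theta> assume th: "\<theta> \<in> {-pi..pi}"
    have "psd (g_shift e \<theta> - of_real e \<cdot>\<^sub>m 1\<^sub>m s)"
      unfolding g_shift_def by (rule psd_shift_diff[OF pd_psd[OF gpd[OF th]] gdim(1)[OF th]])
    from bform_schur_cross[OF gp[OF th] g_shift_dim(1)[OF th] fdim[OF th] x e this]
      schur_aux_dims(6,7)[OF gp[OF th] g_shift_dim(1)[OF th] fdim[OF th] x]
    show "bform {..<s} {..<q} (\<lambda>i j. mat_adjoint (schur_cross x (g_shift e \<theta>) (f \<theta>)) $$ (i, j)) (1 / sqrt (e * x))"
      by (rule bform_adjoint)
  qed
  have fd: "dim_row (TF n) = q * n" "dim_col (TF n) = s * n" for n by simp_all
  note Gp = TG_shift_pd(1)[OF e0] and Gd = TG_shift_pd(2)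
  define R where "R n = schur_res x (TG_shift e n) (TF n)" for n
  define V where "V n = schur_cross x (TG_shift e n) (TF n)" for n
  note Sn = Gp Gd fd x
  have d: "dim_row (R n) = q * n" "dim_col (R n) = q * n" "dim_row (V n) = q * n" "dim_col (V n) = s * n" for n
    using schur_aux_dims(4-7)[OF Sn, of n] by (simp_all add: R_def V_def)
  have Rb: "bform {..<q * n} {..<q * n} (\<lambda>i j. R n $$ (i, j)) (1 / x)" for n
    unfolding R_def by (rule bform_schur_res[OF Sn])
  have Vb: "bform {..<q * n} {..<s * n} (\<lambda>i j. V n $$ (i, j)) (1 / sqrt (e * x))" for n
  proof -
    have "psd (TG_shift e n - of_real e \<cdot>\<^sub>m 1\<^sub>m (s * n))"
      unfolding TG_shift_def by (rule psd_shift_diff[OF pd_psd[OF pd_TG]]) simp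
    then show ?thesis unfolding V_def by (rule bform_schur_cross[OF Sn e])
  qed
  let ?T = "block_toeplitz"
  define E1 where "E1 n = tr (V n * (?T s s n (g_shift e) * ?T s q n v - ?T s q n (\<lambda>\<theta>. g_shift e \<theta> * v \<theta>)))" for n
  define E2 where "E2 n = tr (V n * (?T s q n (\<lambda>\<theta>. mat_adjoint (f \<theta>)) * ?T q q n r
      - ?T s q n (\<lambda>\<theta>. mat_adjoint (f \<theta>) * r \<theta>)))" for n
  define E3 where "E3 n = tr (R n * (?T q s n f * ?T s q n v - ?T q q n (\<lambda>\<theta>. f \<theta> * v \<theta>)))" for n
  have "(\<lambda>n. E1 n / of_nat n) \<longlonglongrightarrow> 0"
    unfolding E1_def by (rule block_asymptotic_multiplicativity[OF g_shift_L1 vb d(3,4) Vb])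
  moreover have "(\<lambda>n. E2 n / of_nat n) \<longlonglongrightarrow> 0"
    unfolding E2_def by (rule block_asymptotic_multiplicativity[OF L1_symbol_adjoint[OF f] rb d(3,4) Vb])
  moreover have "(\<lambda>n. E3 n / of_nat n) \<longlonglongrightarrow> 0"
    unfolding E3_def by (rule block_asymptotic_multiplicativity[OF f vb d(1,2) Rb])
  ultimately have lim: "(\<lambda>n. - (E1 n / of_nat n) + E2 n / of_nat n + E3 n / of_nat n) \<longlonglongrightarrow> - 0 + 0 + 0"
    by (intro tendsto_intros)
  have TF_adj: "?T s q n (\<lambda>\<theta>. mat_adjoint (f \<theta>)) = mat_adjoint (TF n)" for n
    by (rule block_toeplitz_adjoint) (use fdim in \<open>auto intro!: carrier_matI\<close>)
  have gv: "?T s q n (\<lambda>\<theta>. g_shift e \<theta> * v \<theta>) = ?T s q n (\<lambda>\<theta>. mat_adjoint (f \<theta>) * r \<theta>)" for n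
    unfolding v_def r_def by (rule block_toeplitz_cong) (rule G_schur_cross[OF gp g_shift_dim(1) fdim x])
  have fv: "?T q q n (\<lambda>\<theta>. f \<theta> * v \<theta>) = 1\<^sub>m (q * n) - of_real x \<cdot>\<^sub>m ?T q q n r" for n
  proof -
    have rc: "\<And>\<theta>. \<theta> \<in> {-pi..pi} \<Longrightarrow> r \<theta> \<in> carrier_mat q q" using rb by (simp add: bdd_symbol_def)
    have "L1_symbol q q (\<lambda>\<theta>. (- of_real x) \<cdot>\<^sub>m r \<theta>)"
      unfolding L1_symbol_def
    proof (intro conjI ballI allI impI)
      fix \<theta> :: real assume "\<theta> \<in> {-pi..pi}"
      then show "(- of_real x) \<cdot>\<^sub>m r \<theta> \<in> carrier_mat q q" using rc by simp
    next
      fix i j assume l: "i < q" "j < q"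
      have "integrable circ (\<lambda>\<theta>. (- of_real x) * r \<theta> $$ (i, j))"
        using bdd_symbol_L1[OF rb] l by (simp add: L1_symbol_def)
      then show "integrable circ (\<lambda>\<theta>. ((- of_real x) \<cdot>\<^sub>m r \<theta>) $$ (i, j))"
      proof (subst Bochner_Integration.integrable_cong[OF refl])
        fix \<theta> assume "\<theta> \<in> space circ"
        then have "r \<theta> \<in> carrier_mat q q" using rc by simp
        then show "((- of_real x) \<cdot>\<^sub>m r \<theta>) $$ (i, j) = (- of_real x) * r \<theta> $$ (i, j)" using l by simp
      qed
    qed
    note L = this
    have "?T q q n (\<lambda>\<theta>. f \<theta> * v \<theta>) = ?T q q n (\<lambda>\<theta>. 1\<^sub>m q + (- of_real x) \<cdot>\<^sub>m r \<theta>)"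
    proof (rule block_toeplitz_cong)
      fix \<theta> assume th: "\<theta> \<in> {-pi..pi}"
      have "f \<theta> * v \<theta> = 1\<^sub>m q - of_real x \<cdot>\<^sub>m r \<theta>"
        unfolding v_def r_def by (rule F_schur_cross[OF gp[OF th] g_shift_dim(1)[OF th] fdim[OF th] x])
      also have "\<dots> = 1\<^sub>m q + (- of_real x) \<cdot>\<^sub>m r \<theta>"
        using rc[OF th] by (intro mat_lin) auto
      finally show "f \<theta> * v \<theta> = 1\<^sub>m q + (- of_real x) \<cdot>\<^sub>m r \<theta>" .
    qed
    also have "\<dots> = ?T q q n (\<lambda>\<theta>. 1\<^sub>m q) + ?T q q n (\<lambda>\<theta>. (- of_real x) \<cdot>\<^sub>m r \<theta>)"
      by (intro block_toeplitz_add L1_symbol_const L) simp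
    also have "\<dots> = 1\<^sub>m (q * n) - of_real x \<cdot>\<^sub>m ?T q q n r"
      by (subst block_toeplitz_smult[OF rc]) (auto simp: block_toeplitz_one intro!: mat_lin)
    finally show ?thesis .
  qed
  \<comment> \<open>The terms that contain products of Toeplitz matrices cancel by the equations for R and V.\<close>
  have key: "- E1 n + E2 n + E3 n = tr (?T q q n r) - tr (R n)" for n
  proof -
    define Tr where "Tr = ?T q q n r"
    define Tv where "Tv = ?T s q n v"
    define B where "B = ?T s q n (\<lambda>\<theta>. mat_adjoint (f \<theta>) * r \<theta>)"
    have [simp]: "dim_row Tr = q * n" "dim_col Tr = q * n" "dim_row Tv = s * n" "dim_col Tv = q * n"
      "dim_row B = s * n" "dim_col B = q * n" by (simp_all add: Tr_def Tv_def B_def)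
    note [simp] = d TG_shift_pd(2,3)
    have VG: "V n * (TG_shift e n * Tv) = R n * (TF n * Tv)"
      using schur_cross_G[OF Sn, of n, folded R_def V_def] by (simp flip: mm_assoc)
    have VF: "V n * (mat_adjoint (TF n) * Tr) = Tr - of_real x \<cdot>\<^sub>m (R n * Tr)"
    proof -
      have "V n * (mat_adjoint (TF n) * Tr) = V n * mat_adjoint (TF n) * Tr" by (simp add: mm_assoc)
      also have "\<dots> = (1\<^sub>m (q * n) - of_real x \<cdot>\<^sub>m R n) * Tr"
        by (simp only: schur_cross_F'[OF Sn, of n, folded R_def V_def])
      also have "\<dots> = Tr - of_real x \<cdot>\<^sub>m (R n * Tr)" by (simp add: mm_minus_left mm_smult_left)
      finally show ?thesis .
    qed
    have e1: "E1 n = tr (R n * (TF n * Tv)) - tr (V n * B)"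
      unfolding E1_def g_shift_toeplitz gv B_def[symmetric] Tv_def[symmetric]
      by (simp add: mm_minus_right VG tr_minus[where n = "q * n"])
    have e2: "E2 n = tr Tr - of_real x * tr (R n * Tr) - tr (V n * B)"
      unfolding E2_def TF_adj B_def[symmetric] Tr_def[symmetric]
      by (simp add: mm_minus_right VF tr_minus[where n = "q * n"] tr_smult)
    have e3: "E3 n = tr (R n * (TF n * Tv)) - (tr (R n) - of_real x * tr (R n * Tr))"
      unfolding E3_def fv Tr_def[symmetric] Tv_def[symmetric]
      by (simp add: mm_minus_right mm_smult_right tr_minus[where n = "q * n"] tr_smult)
    show ?thesis unfolding e1 e2 e3 Tr_def by simp
  qed
  have "(\<lambda>n. tr (?T q q n r) / of_nat n - tr (R n) / of_nat n) \<longlonglongrightarrow> 0"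
  proof -
    have "- (E1 n / of_nat n) + E2 n / of_nat n + E3 n / of_nat n
        = tr (?T q q n r) / of_nat n - tr (R n) / of_nat n" for n
      unfolding diff_divide_distrib[symmetric] key[symmetric] by (simp add: add_divide_distrib diff_divide_distrib)
    then show ?thesis using lim by simp
  qed
  moreover have "(\<lambda>n. tr (?T q q n r) / of_nat n) \<longlonglongrightarrow> 1 / (2 * of_real pi) * (\<integral>\<theta>. tr (r \<theta>) \<partial>circ)"
  proof (rule tendsto_eventually, rule eventually_sequentiallyI[of 1])
    fix n :: nat assume "1 \<le> n"
    then show "tr (?T q q n r) / of_nat n = 1 / (2 * of_real pi) * (\<integral>\<theta>. tr (r \<theta>) \<partial>circ)"
      by (subst tr_block_toeplitz[OF bdd_symbol_L1[OF rb]]) simp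
  qed
  ultimately have "(\<lambda>n. tr (?T q q n r) / of_nat n - (tr (?T q q n r) / of_nat n - tr (R n) / of_nat n))
     \<longlonglongrightarrow> 1 / (2 * of_real pi) * (\<integral>\<theta>. tr (r \<theta>) \<partial>circ) - 0" by (intro tendsto_diff)
  then show ?thesis by (simp add: R_def r_def)
qed

text \<open>A constant bound, for dominated convergence, and a bound that vanishes with \<open>e\<close>, for pointwise convergence.\<close>

lemma tr_inv_g_shift_le:
  assumes e: "0 < e" and th: "\<theta> \<in> {-pi..pi}"
  shows "0 \<le> e * Re (tr (mat_inv (g_shift e \<theta>)))" "e * Re (tr (mat_inv (g_shift e \<theta>))) \<le> real s"
    "e * Re (tr (mat_inv (g_shift e \<theta>))) \<le> e * Re (tr (mat_inv (g \<theta>)))"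
proof -
  have e0: "0 \<le> e" using e by simp
  note p = g_shift_pd[OF e0 th] and gd = g_shift_dim[OF th, of e]
  note i = pd_inv[OF p gd(1)]
  show "0 \<le> e * Re (tr (mat_inv (g_shift e \<theta>)))" using e psd_tr[OF i(4)] by simp
  have "e * Re (tr (mat_inv (g_shift e \<theta>))) = (\<Sum>j<s. e * Re (mat_inv (g_shift e \<theta>) $$ (j, j)))"
    using i(5) by (simp add: tr_def sum_distrib_left)
  also have "\<dots> \<le> (\<Sum>j<s. 1)"
  proof (rule sum_mono)
    fix j assume "j \<in> {..<s}"
    moreover have "bform {..<s} {..<s} (\<lambda>i j. mat_inv (g_shift e \<theta>) $$ (i, j)) (1 / e)"
      unfolding g_shift_def by (rule bform_inv_shift[OF pd_psd[OF gpd[OF th]] gdim(1)[OF th] e])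
    ultimately have "cmod (mat_inv (g_shift e \<theta>) $$ (j, j)) \<le> 1 / e"
      by (intro bform_entry[of "{..<s}" "{..<s}" "\<lambda>i j. mat_inv (g_shift e \<theta>) $$ (i, j)"]) auto
    then have "Re (mat_inv (g_shift e \<theta>) $$ (j, j)) \<le> 1 / e" using complex_Re_le_cmod order_trans by blast
    then show "e * Re (mat_inv (g_shift e \<theta>) $$ (j, j)) \<le> 1" using e by (simp add: field_simps)
  qed
  finally show "e * Re (tr (mat_inv (g_shift e \<theta>))) \<le> real s" by simp
  have "g_shift e \<theta> - g \<theta> = of_real e \<cdot>\<^sub>m 1\<^sub>m s"
    unfolding g_shift_def using gdim[OF th] by (intro mat_lin) auto
  then have "psd (g_shift e \<theta> - g \<theta>)" using e0 by (simp add: psd_smult pd_psd pd_one)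
  then have "Re (tr (mat_inv (g_shift e \<theta>))) \<le> Re (tr (mat_inv (g \<theta>)))"
    by (rule tr_inv_antimono[OF gpd[OF th] p gdim(1)[OF th] gd(1)])
  then show "e * Re (tr (mat_inv (g_shift e \<theta>))) \<le> e * Re (tr (mat_inv (g \<theta>)))"
    using e0 by (rule mult_left_mono)
qed

lemma tr_schur_res_bounds:
  assumes "0 < x" "\<theta> \<in> {-pi..pi}" "0 \<le> e"
  shows "cmod (tr (schur_res x (g_shift e \<theta>) (f \<theta>))) \<le> real q / x"
proof -
  note S = g_shift_pd[OF assms(3,2)] g_shift_dim(1)[OF assms(2)] fdim[OF assms(2)] assms(1)
  have "cmod (tr (schur_res x (g_shift e \<theta>) (f \<theta>))) \<le> (\<Sum>i<q. cmod (schur_res x (g_shift e \<theta>) (f \<theta>) $$ (i, i)))"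
    unfolding tr_def schur_aux_dims(4)[OF S] by (rule norm_sum)
  also have "\<dots> \<le> (\<Sum>i<q. 1 / x)"
    by (rule sum_mono, rule bform_entry[OF bform_schur_res[OF S]]) auto
  finally show ?thesis by simp
qed

lemma g_shift_0: "\<theta> \<in> {-pi..pi} \<Longrightarrow> g_shift 0 \<theta> = g \<theta>"
  unfolding g_shift_def using gdim by (intro mat_lin) auto

theorem resolvent_trace_limit:
  assumes x: "0 < x"
  shows "(\<lambda>n. Re (tr (schur_res x (TG n) (TF n))) / real n) \<longlonglongrightarrow>
    1 / (2 * pi) * (\<integral>\<theta>. Re (tr (schur_res x (g \<theta>) (f \<theta>))) \<partial>circ)"
proof -
  \<comment> \<open>Regularization along a sequence, as dominated convergence is used for \<open>e \<rightarrow> 0\<close>.\<close>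
  define e where "e k = 1 / real (Suc k)" for k
  have e: "0 < e k" "0 \<le> e k" for k by (simp_all add: e_def)
  have e_lim: "e \<longlonglongrightarrow> 0" unfolding e_def[abs_def] by (rule LIMSEQ_Suc, rule lim_1_over_n)
  define I where "I k = 1 / (2 * pi) * (\<integral>\<theta>. e k * Re (tr (mat_inv (g_shift (e k) \<theta>))) \<partial>circ)" for k
  define L' where "L' k = 1 / (2 * pi) * (\<integral>\<theta>. Re (tr (schur_res x (g_shift (e k) \<theta>) (f \<theta>))) \<partial>circ)" for k
  have Re_scale: "Re (1 / (2 * of_real pi) * z) = 1 / (2 * pi) * Re z" for z
  proof -
    have "1 / (2 * of_real pi) * z = of_real (1 / (2 * pi)) * z" by simp
    then show ?thesis by (simp only: Re_complex_of_real times_complex.sel Im_complex_of_real mult_zero_left diff_0_right)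
  qed
  have Re_nat: "Re (z / of_nat n) = Re z / real n" for z n
    by (metis Re_divide_of_real of_real_of_nat_eq)
  have ti: "integrable circ (\<lambda>\<theta>. tr (schur_res x (g_shift e' \<theta>) (f \<theta>)))" if "0 \<le> e'" for e'
    by (rule integrable_bounded_circ[OF measurable_tr[OF mat_measurable_schur_res[OF g_shift_measurable f_measurable]] tr_schur_res_bounds[OF x _ that]])
  have ii: "integrable circ (\<lambda>\<theta>. tr (mat_inv (g_shift (e k) \<theta>)))"
    and Im: "(\<lambda>\<theta>. e k * Re (tr (mat_inv (g_shift (e k) \<theta>)))) \<in> borel_measurable circ" for k
  proof -
    have m: "(\<lambda>\<theta>. tr (mat_inv (g_shift (e k) \<theta>))) \<in> borel_measurable circ"
      by (rule measurable_tr[OF mat_measurable_inv[OF g_shift_measurable]])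
    then show "(\<lambda>\<theta>. e k * Re (tr (mat_inv (g_shift (e k) \<theta>)))) \<in> borel_measurable circ" by measurable
    show "integrable circ (\<lambda>\<theta>. tr (mat_inv (g_shift (e k) \<theta>)))"
    proof (rule integrable_bounded_circ[OF m])
      fix \<theta> assume th: "\<theta> \<in> {-pi..pi}"
      note i = pd_inv[OF g_shift_pd[OF e(2) th] g_shift_dim(1)[OF th]]
      have B: "bform {..<s} {..<s} (\<lambda>i j. mat_inv (g_shift (e k) \<theta>) $$ (i, j)) (1 / e k)"
        unfolding g_shift_def by (rule bform_inv_shift[OF pd_psd[OF gpd[OF th]] gdim(1)[OF th] e(1)])
      have "cmod (tr (mat_inv (g_shift (e k) \<theta>))) \<le> (\<Sum>j<s. cmod (mat_inv (g_shift (e k) \<theta>) $$ (j, j)))"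
        unfolding tr_def i(5) by (rule norm_sum)
      also have "\<dots> \<le> (\<Sum>j<s. 1 / e k)" by (rule sum_mono, rule bform_entry[OF B]) auto
      finally show "cmod (tr (mat_inv (g_shift (e k) \<theta>))) \<le> (\<Sum>j<s. 1 / e k)" .
    qed
  qed
  show ?thesis
  proof (rule perturbation_limit[where A' = "\<lambda>k n. Re (tr (schur_res x (TG_shift (e k) n) (TF n))) / real n"
        and B = "\<lambda>k n. e k * (Re (tr (mat_inv (TG_shift (e k) n))) / real n)" and L' = L' and I = I, OF x])
    fix k n
    have "(\<lambda>n. Re (tr (schur_res x (TG_shift (e k) n) (TF n)) / of_nat n)) \<longlonglongrightarrow>
       Re (1 / (2 * of_real pi) * (\<integral>\<theta>. tr (schur_res x (g_shift (e k) \<theta>) (f \<theta>)) \<partial>circ))"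
      by (intro tendsto_Re shifted_resolvent_limit e x)
    then show "(\<lambda>n. Re (tr (schur_res x (TG_shift (e k) n) (TF n))) / real n) \<longlonglongrightarrow> L' k"
      unfolding Re_scale Re_nat L'_def integral_Re[OF ti[OF e(2)]] .
    have "(\<lambda>n. e k * Re (tr (mat_inv (TG_shift (e k) n)) / of_nat n)) \<longlonglongrightarrow>
       e k * Re (1 / (2 * of_real pi) * (\<integral>\<theta>. tr (mat_inv (g_shift (e k) \<theta>)) \<partial>circ))"
      by (intro tendsto_mult tendsto_const tendsto_Re inv_trace_limit e)
    then show "(\<lambda>n. e k * (Re (tr (mat_inv (TG_shift (e k) n))) / real n)) \<longlonglongrightarrow> I k"
      unfolding Re_scale Re_nat I_def integral_Re[OF ii, symmetric] by (simp add: ac_simps)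
    have dn: "dim_row (TG n) = s * n" "dim_row (TF n) = q * n" "dim_col (TF n) = s * n" by simp_all
    note sh = tr_schur_res_shift[OF pd_TG dn x e(1), of k, folded TG_shift_def]
    show "Re (tr (schur_res x (TG n) (TF n))) / real n \<le> Re (tr (schur_res x (TG_shift (e k) n) (TF n))) / real n"
      using sh(1) by (rule divide_right_mono) simp
    have "x * (Re (tr (schur_res x (TG_shift (e k) n) (TF n))) - Re (tr (schur_res x (TG n) (TF n)))) / real n
       \<le> e k * Re (tr (mat_inv (TG_shift (e k) n))) / real n"
      using sh(2) by (rule divide_right_mono) simp
    then show "x * (Re (tr (schur_res x (TG_shift (e k) n) (TF n))) / real n - Re (tr (schur_res x (TG n) (TF n))) / real n)
       \<le> e k * (Re (tr (mat_inv (TG_shift (e k) n))) / real n)"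
      by (simp add: diff_divide_distrib right_diff_distrib)
    have shp: "Re (tr (schur_res x (g \<theta>) (f \<theta>))) \<le> Re (tr (schur_res x (g_shift (e k) \<theta>) (f \<theta>)))"
      "x * (Re (tr (schur_res x (g_shift (e k) \<theta>) (f \<theta>))) - Re (tr (schur_res x (g \<theta>) (f \<theta>)))) \<le> e k * Re (tr (mat_inv (g_shift (e k) \<theta>)))"
      if th: "\<theta> \<in> {-pi..pi}" for \<theta>
      using tr_schur_res_shift[OF gpd[OF th] gdim(1)[OF th] fdim[OF th] x e(1), of k] by (simp_all add: g_shift_def)
    have i0: "integrable circ (\<lambda>\<theta>. Re (tr (schur_res x (g \<theta>) (f \<theta>))))"
    proof (rule integrable_Re, subst Bochner_Integration.integrable_cong[OF refl])
      show "tr (schur_res x (g \<theta>) (f \<theta>)) = tr (schur_res x (g_shift 0 \<theta>) (f \<theta>))" if "\<theta> \<in> space circ" for \<theta>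
        using that by (simp add: g_shift_0)
    qed (rule ti, simp)
    have i1: "integrable circ (\<lambda>\<theta>. Re (tr (schur_res x (g_shift (e k) \<theta>) (f \<theta>))))" by (rule integrable_Re[OF ti[OF e(2)]])
    have i2: "integrable circ (\<lambda>\<theta>. e k * Re (tr (mat_inv (g_shift (e k) \<theta>))))" using integrable_Re[OF ii] by simp
    show "1 / (2 * pi) * (\<integral>\<theta>. Re (tr (schur_res x (g \<theta>) (f \<theta>))) \<partial>circ) \<le> L' k"
      unfolding L'_def by (intro mult_left_mono integral_mono i0 i1) (use shp(1) in auto)
    have "(\<integral>\<theta>. x * (Re (tr (schur_res x (g_shift (e k) \<theta>) (f \<theta>))) - Re (tr (schur_res x (g \<theta>) (f \<theta>)))) \<partial>circ)
       \<le> (\<integral>\<theta>. e k * Re (tr (mat_inv (g_shift (e k) \<theta>))) \<partial>circ)"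
      by (intro integral_mono integrable_mult_right Bochner_Integration.integrable_diff i0 i1 i2) (use shp(2) in auto)
    also have "(\<integral>\<theta>. x * (Re (tr (schur_res x (g_shift (e k) \<theta>) (f \<theta>))) - Re (tr (schur_res x (g \<theta>) (f \<theta>)))) \<partial>circ)
       = x * ((\<integral>\<theta>. Re (tr (schur_res x (g_shift (e k) \<theta>) (f \<theta>))) \<partial>circ) - (\<integral>\<theta>. Re (tr (schur_res x (g \<theta>) (f \<theta>))) \<partial>circ))"
      using i0 i1 by (simp add: Bochner_Integration.integral_diff)
    finally have "1 / (2 * pi) * (x * ((\<integral>\<theta>. Re (tr (schur_res x (g_shift (e k) \<theta>) (f \<theta>))) \<partial>circ) - (\<integral>\<theta>. Re (tr (schur_res x (g \<theta>) (f \<theta>))) \<partial>circ))) \<le> I k"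
      unfolding I_def by (rule mult_left_mono) simp
    then show "x * (L' k - 1 / (2 * pi) * (\<integral>\<theta>. Re (tr (schur_res x (g \<theta>) (f \<theta>))) \<partial>circ)) \<le> I k"
      by (simp add: L'_def right_diff_distrib ac_simps)
  next
    have "(\<lambda>k. \<integral>\<theta>. e k * Re (tr (mat_inv (g_shift (e k) \<theta>))) \<partial>circ) \<longlonglongrightarrow> (\<integral>\<theta>. 0 \<partial>circ)"
    proof (rule integral_dominated_convergence[where w = "\<lambda>\<theta>. real s"])
      show "integrable circ (\<lambda>\<theta>. real s)" by (rule finite_measure.integrable_const[OF finite_measure_circ])
      show "AE \<theta> in circ. (\<lambda>k. e k * Re (tr (mat_inv (g_shift (e k) \<theta>)))) \<longlonglongrightarrow> 0"
      proof (rule AE_I2)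
        fix \<theta> assume "\<theta> \<in> space circ"
        then have th: "\<theta> \<in> {-pi..pi}" by simp
        have "(\<lambda>k. e k * Re (tr (mat_inv (g \<theta>)))) \<longlonglongrightarrow> 0 * Re (tr (mat_inv (g \<theta>)))"
          by (intro tendsto_mult e_lim tendsto_const)
        then have u: "(\<lambda>k. e k * Re (tr (mat_inv (g \<theta>)))) \<longlonglongrightarrow> 0" by simp
        show "(\<lambda>k. e k * Re (tr (mat_inv (g_shift (e k) \<theta>)))) \<longlonglongrightarrow> 0"
          by (rule tendsto_sandwich[OF always_eventually always_eventually tendsto_const u])
             (use tr_inv_g_shift_le[OF e(1) th] in auto)
      qed
      show "AE \<theta> in circ. norm (e k * Re (tr (mat_inv (g_shift (e k) \<theta>)))) \<le> real s" for k
        using tr_inv_g_shift_le(1,2)[OF e(1)] by (intro AE_I2) (simp add: abs_of_nonneg del: abs_mult)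
    qed (auto intro: Im)
    then have "(\<lambda>k. 1 / (2 * pi) * (\<integral>\<theta>. e k * Re (tr (mat_inv (g_shift (e k) \<theta>))) \<partial>circ)) \<longlonglongrightarrow> 1 / (2 * pi) * 0"
      by (intro tendsto_mult tendsto_const) simp
    then show "I \<longlonglongrightarrow> 0" unfolding I_def[abs_def] by simp
  qed
qed

end

section \<open>From resolvents to test functions\<close>

text \<open>The test functions for which the spectra of the matrices have the expected limit. Boundedness and
measurability are included to make this class closed under sums and uniform limits.\<close>

definition spectral_limit :: "(nat \<Rightarrow> real multiset) \<Rightarrow> (real \<Rightarrow> real multiset) \<Rightarrow> (real \<Rightarrow> real) \<Rightarrow> bool" where
  "spectral_limit N m \<phi> \<longleftrightarrow> (\<exists>B. \<forall>t\<ge>0. \<bar>\<phi> t\<bar> \<le> B) \<and>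
     (\<lambda>\<theta>. \<Sum>t\<in>#m \<theta>. \<phi> t) \<in> borel_measurable circ \<and>
     (\<lambda>n. (\<Sum>t\<in>#N n. \<phi> t) / real n) \<longlonglongrightarrow> 1 / (2 * pi) * (\<integral>\<theta>. (\<Sum>t\<in>#m \<theta>. \<phi> t) \<partial>circ)"

lemma sum_mset_abs_le:
  assumes "\<And>t. t \<in># M \<Longrightarrow> \<bar>\<phi> t\<bar> \<le> (B :: real)"
  shows "\<bar>\<Sum>t\<in>#M. \<phi> t\<bar> \<le> real (size M) * B"
  using assms
proof (induction M)
  case (add t M)
  have "\<bar>\<phi> t\<bar> \<le> B" "\<bar>\<Sum>t\<in>#M. \<phi> t\<bar> \<le> real (size M) * B" using add by auto
  then have "\<bar>\<phi> t + (\<Sum>t\<in>#M. \<phi> t)\<bar> \<le> B + real (size M) * B" by linarith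
  then show ?case by (simp add: distrib_right)
qed simp

lemma sum_mset_diff: "(\<Sum>t\<in>#M. \<phi> t - \<psi> t) = (\<Sum>t\<in>#M. \<phi> t) - (\<Sum>t\<in>#M. \<psi> t :: real)"
  by (induction M) auto

lemma sum_mset_cmult: "(\<Sum>t\<in>#M. c * \<phi> t) = c * (\<Sum>t\<in>#M. \<phi> t :: real)"
  by (induction M) (auto simp: distrib_left)

lemma sum_mset_plus: "(\<Sum>t\<in>#M. \<phi> t + \<psi> t) = (\<Sum>t\<in>#M. \<phi> t) + (\<Sum>t\<in>#M. \<psi> t :: real)"
  by (induction M) auto

text \<open>The difference quotient in \<open>x\<close> of \<open>(x+t)\<^sup>-\<^sup>k\<close> converges uniformly in \<open>t \<ge> 0\<close>. With \<open>u = 1/(x+t)\<close> and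
\<open>y = h u\<close>, Bernoulli's inequality places \<open>1 - (1+y)\<^sup>-\<^sup>k\<close> between \<open>k y - (k y)\<^sup>2\<close> and \<open>k y\<close>.\<close>

lemma resolvent_power_quotient:
  fixes x t h :: real
  assumes x: "0 < x" and t: "0 \<le> t" and h: "0 < h"
  shows "\<bar>((1 / (x + t)) ^ k - (1 / (x + h + t)) ^ k) / h - real k * (1 / (x + t)) ^ Suc k\<bar>
    \<le> h * ((real k)\<^sup>2 / x ^ (k + 2))"
proof -
  define u where "u = 1 / (x + t)"
  define y where "y = h * u"
  have u: "0 < u" "u \<le> 1 / x" using x t by (auto simp: u_def frac_le)
  have y: "0 < y" using h u by (simp add: y_def)
  define D where "D = (1 + y) ^ k"
  have w: "1 / (x + h + t) = u * (1 / (1 + y))"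
    using x t h by (simp add: u_def y_def divide_simps)
  have wk: "(1 / (x + h + t)) ^ k = u ^ k * (1 / D)"
    unfolding w power_mult_distrib D_def by (simp add: power_divide)
  have D1: "1 + real k * y \<le> D" unfolding D_def using y by (intro Bernoulli_inequality) simp
  have A: "1 - 1 / D \<le> real k * y"
  proof -
    have "1 + real k * (1 / (1 + y) - 1) \<le> (1 + (1 / (1 + y) - 1)) ^ k"
      using y by (intro Bernoulli_inequality) (simp add: field_simps)
    also have "\<dots> = 1 / D" by (simp add: D_def power_divide)
    finally have "1 - 1 / D \<le> real k * (1 - 1 / (1 + y))" by (simp add: algebra_simps)
    also have "1 - 1 / (1 + y) \<le> y" using y by (simp add: field_simps)
    finally show ?thesis by (simp add: mult_left_mono)
  qed
  have B: "real k * y - (real k * y)\<^sup>2 \<le> 1 - 1 / D"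
  proof -
    define z where "z = real k * y"
    have z: "0 \<le> z" using y by (simp add: z_def)
    have "1 / D \<le> 1 / (1 + z)" using D1 z by (intro divide_left_mono) (auto simp: z_def intro!: mult_pos_pos)
    moreover have "1 / (1 + z) \<le> 1 - z + z\<^sup>2"
    proof -
      have "1 \<le> (1 - z + z\<^sup>2) * (1 + z)"
      proof -
        have "(1 - z + z\<^sup>2) * (1 + z) = 1 + z ^ 3" by (simp add: power2_eq_square power3_eq_cube algebra_simps)
        then show ?thesis using z by simp
      qed
      then show ?thesis using z by (simp add: pos_divide_le_eq)
    qed
    ultimately show ?thesis by (simp add: z_def)
  qed
  have "((1 / (x + t)) ^ k - (1 / (x + h + t)) ^ k) / h - real k * (1 / (x + t)) ^ Suc k
      = (u ^ k / h) * ((1 - 1 / D) - real k * y)"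
    unfolding wk u_def[symmetric] using h by (simp add: y_def field_simps)
  also have "\<bar>\<dots>\<bar> = (u ^ k / h) * \<bar>(1 - 1 / D) - real k * y\<bar>"
    using u h by (simp add: abs_mult)
  also have "\<dots> \<le> (u ^ k / h) * (real k * y)\<^sup>2"
    using A B u h by (intro mult_left_mono) auto
  also have "\<dots> = h * ((real k)\<^sup>2 * u ^ (k + 2))"
    using h by (simp add: y_def power_mult_distrib power_add power2_eq_square)
  also have "\<dots> \<le> h * ((real k)\<^sup>2 * (1 / x) ^ (k + 2))"
    using u h by (intro mult_left_mono power_mono) auto
  finally show ?thesis by (simp add: power_divide)
qed

context
  fixes N :: "nat \<Rightarrow> real multiset" and m :: "real \<Rightarrow> real multiset" and q :: nat
  assumes N: "\<And>n. size (N n) = q * n" "\<And>n t. t \<in># N n \<Longrightarrow> 0 \<le> t"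
    and m: "\<And>\<theta>. \<theta> \<in> {-pi..pi} \<Longrightarrow> size (m \<theta>) = q" "\<And>\<theta> t. \<theta> \<in> {-pi..pi} \<Longrightarrow> t \<in># m \<theta> \<Longrightarrow> 0 \<le> t"
begin

lemma spectral_limit_integrable:
  assumes "spectral_limit N m \<phi>" shows "integrable circ (\<lambda>\<theta>. \<Sum>t\<in>#m \<theta>. \<phi> t)"
proof -
  obtain B where B: "\<And>t. 0 \<le> t \<Longrightarrow> \<bar>\<phi> t\<bar> \<le> B" using assms by (auto simp: spectral_limit_def)
  show ?thesis
  proof (rule finite_measure.integrable_const_bound[OF finite_measure_circ])
    show "AE \<theta> in circ. norm (\<Sum>t\<in>#m \<theta>. \<phi> t) \<le> real q * B"
    proof (rule AE_I2)
      fix \<theta> assume "\<theta> \<in> space circ"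
      then have th: "\<theta> \<in> {-pi..pi}" by simp
      show "norm (\<Sum>t\<in>#m \<theta>. \<phi> t) \<le> real q * B"
        using sum_mset_abs_le[of "m \<theta>" \<phi> B] B m[OF th] by simp
    qed
  qed (use assms in \<open>simp add: spectral_limit_def\<close>)
qed

lemma spectral_limit_const: "spectral_limit N m (\<lambda>t. c)"
proof -
  have e: "(\<integral>\<theta>. (\<Sum>t\<in>#m \<theta>. c) \<partial>circ) = (\<integral>\<theta>. real q * c \<partial>circ)"
    by (rule Bochner_Integration.integral_cong) (use m in auto)
  have "(\<lambda>\<theta>. \<Sum>t\<in>#m \<theta>. c) \<in> borel_measurable circ"
    by (subst measurable_cong[of circ _ "\<lambda>\<theta>. real q * c"]) (use m in auto)
  moreover have "(\<lambda>n. (\<Sum>t\<in>#N n. c) / real n) \<longlonglongrightarrow> real q * c"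
    by (rule tendsto_eventually, rule eventually_sequentiallyI[of 1]) (simp add: N)
  ultimately show ?thesis unfolding spectral_limit_def e by (auto simp: measure_circ[simplified])
qed

lemma spectral_limit_cmult:
  assumes "spectral_limit N m \<phi>" shows "spectral_limit N m (\<lambda>t. c * \<phi> t)"
  unfolding spectral_limit_def sum_mset_cmult
proof (intro conjI)
  obtain B where B: "\<And>t. 0 \<le> t \<Longrightarrow> \<bar>\<phi> t\<bar> \<le> B" using assms by (auto simp: spectral_limit_def)
  then show "\<exists>B. \<forall>t\<ge>0. \<bar>c * \<phi> t\<bar> \<le> B"
    by (intro exI[of _ "\<bar>c\<bar> * B"]) (auto simp: abs_mult intro!: mult_left_mono)
  have "(\<lambda>\<theta>. \<Sum>t\<in>#m \<theta>. \<phi> t) \<in> borel_measurable circ"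
    using assms by (simp add: spectral_limit_def)
  then show "(\<lambda>\<theta>. c * (\<Sum>t\<in>#m \<theta>. \<phi> t)) \<in> borel_measurable circ"
    by (rule borel_measurable_times[OF borel_measurable_const])
  have "(\<lambda>n. c * ((\<Sum>t\<in>#N n. \<phi> t) / real n)) \<longlonglongrightarrow> c * (1 / (2 * pi) * (\<integral>\<theta>. (\<Sum>t\<in>#m \<theta>. \<phi> t) \<partial>circ))"
    using assms by (intro tendsto_mult tendsto_const) (simp add: spectral_limit_def)
  then show "(\<lambda>n. c * (\<Sum>t\<in>#N n. \<phi> t) / real n) \<longlonglongrightarrow> 1 / (2 * pi) * (\<integral>\<theta>. c * (\<Sum>t\<in>#m \<theta>. \<phi> t) \<partial>circ)"
    by (simp only: integral_mult_right_zero times_divide_eq_right[symmetric] mult.left_commute[of c])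
qed

lemma spectral_limit_add:
  assumes "spectral_limit N m \<phi>" "spectral_limit N m \<psi>" shows "spectral_limit N m (\<lambda>t. \<phi> t + \<psi> t)"
  unfolding spectral_limit_def sum_mset_plus
proof (intro conjI)
  obtain B C where B: "\<And>t. 0 \<le> t \<Longrightarrow> \<bar>\<phi> t\<bar> \<le> B" and C: "\<And>t. 0 \<le> t \<Longrightarrow> \<bar>\<psi> t\<bar> \<le> C"
    using assms by (auto simp: spectral_limit_def)
  have "\<bar>\<phi> t + \<psi> t\<bar> \<le> B + C" if "0 \<le> t" for t using B[OF that] C[OF that] by linarith
  then show "\<exists>B. \<forall>t\<ge>0. \<bar>\<phi> t + \<psi> t\<bar> \<le> B" by blast
  show "(\<lambda>\<theta>. (\<Sum>t\<in>#m \<theta>. \<phi> t) + (\<Sum>t\<in>#m \<theta>. \<psi> t)) \<in> borel_measurable circ"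
    using assms by (auto simp: spectral_limit_def)
  have "(\<lambda>n. (\<Sum>t\<in>#N n. \<phi> t) / real n + (\<Sum>t\<in>#N n. \<psi> t) / real n) \<longlonglongrightarrow>
      1 / (2 * pi) * (\<integral>\<theta>. (\<Sum>t\<in>#m \<theta>. \<phi> t) \<partial>circ) + 1 / (2 * pi) * (\<integral>\<theta>. (\<Sum>t\<in>#m \<theta>. \<psi> t) \<partial>circ)"
    using assms by (intro tendsto_add) (simp_all add: spectral_limit_def)
  also have "1 / (2 * pi) * (\<integral>\<theta>. (\<Sum>t\<in>#m \<theta>. \<phi> t) \<partial>circ) + 1 / (2 * pi) * (\<integral>\<theta>. (\<Sum>t\<in>#m \<theta>. \<psi> t) \<partial>circ)
     = 1 / (2 * pi) * (\<integral>\<theta>. (\<Sum>t\<in>#m \<theta>. \<phi> t) + (\<Sum>t\<in>#m \<theta>. \<psi> t) \<partial>circ)"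
    using spectral_limit_integrable[OF assms(1)] spectral_limit_integrable[OF assms(2)]
    by (simp only: Bochner_Integration.integral_add distrib_left)
  finally show "(\<lambda>n. ((\<Sum>t\<in>#N n. \<phi> t) + (\<Sum>t\<in>#N n. \<psi> t)) / real n) \<longlonglongrightarrow>
     1 / (2 * pi) * (\<integral>\<theta>. (\<Sum>t\<in>#m \<theta>. \<phi> t) + (\<Sum>t\<in>#m \<theta>. \<psi> t) \<partial>circ)"
    by (simp only: add_divide_distrib)
qed

lemma spectral_limit_sum:
  assumes "finite A" "\<And>a. a \<in> A \<Longrightarrow> spectral_limit N m (\<phi> a)"
  shows "spectral_limit N m (\<lambda>t. \<Sum>a\<in>A. \<phi> a t)"
  using assms
proof (induction A)
  case empty
  then show ?case using spectral_limit_const[of 0] by simp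
next
  case (insert a A)
  then show ?case using spectral_limit_add[of "\<phi> a" "\<lambda>t. \<Sum>a\<in>A. \<phi> a t"] by simp
qed

lemma spectral_limit_uniform:
  assumes "\<And>e. 0 < e \<Longrightarrow> \<exists>\<psi>. spectral_limit N m \<psi> \<and> (\<forall>t\<ge>0. \<bar>\<phi> t - \<psi> t\<bar> \<le> e)"
  shows "spectral_limit N m \<phi>"
proof -
  have Nle: "\<bar>(\<Sum>t\<in>#N n. \<phi> t) / real n - (\<Sum>t\<in>#N n. \<psi> t) / real n\<bar> \<le> real q * e"
    if "\<forall>t\<ge>0. \<bar>\<phi> t - \<psi> t\<bar> \<le> e" "0 < e" for \<psi> e n
  proof (cases "n = 0")
    case False
    have "\<bar>(\<Sum>t\<in>#N n. \<phi> t) - (\<Sum>t\<in>#N n. \<psi> t)\<bar> \<le> real (q * n) * e"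
      using sum_mset_abs_le[of "N n" "\<lambda>t. \<phi> t - \<psi> t" e] N that by (simp add: sum_mset_diff)
    then show ?thesis using False by (simp add: diff_divide_distrib[symmetric] field_simps)
  qed (use that in simp)
  have mle: "\<bar>(\<Sum>t\<in>#m \<theta>. \<phi> t) - (\<Sum>t\<in>#m \<theta>. \<psi> t)\<bar> \<le> real q * e"
    if "\<forall>t\<ge>0. \<bar>\<phi> t - \<psi> t\<bar> \<le> e" "\<theta> \<in> {-pi..pi}" for \<psi> e \<theta>
    using sum_mset_abs_le[of "m \<theta>" "\<lambda>t. \<phi> t - \<psi> t" e] m[OF that(2)] that(1) by (simp add: sum_mset_diff)
  have "\<exists>\<psi>. \<forall>k. spectral_limit N m (\<psi> k) \<and> (\<forall>t\<ge>0. \<bar>\<phi> t - \<psi> k t\<bar> \<le> 1 / real (Suc k))"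
    by (rule choice) (simp add: assms)
  then obtain \<psi> where \<psi>: "\<And>k. spectral_limit N m (\<psi> k)" "\<And>k. \<forall>t\<ge>0. \<bar>\<phi> t - \<psi> k t\<bar> \<le> 1 / real (Suc k)"
    by blast
  have meas: "(\<lambda>\<theta>. \<Sum>t\<in>#m \<theta>. \<phi> t) \<in> borel_measurable circ"
  proof (rule borel_measurable_LIMSEQ_real)
    show "(\<lambda>\<theta>. \<Sum>t\<in>#m \<theta>. \<psi> k t) \<in> borel_measurable circ" for k using \<psi>(1) by (simp add: spectral_limit_def)
    fix \<theta> assume "\<theta> \<in> space circ"
    then have th: "\<theta> \<in> {-pi..pi}" by simp
    have "(\<lambda>k. real q * (1 / real (Suc k))) \<longlonglongrightarrow> real q * 0"
      by (intro tendsto_mult tendsto_const LIMSEQ_Suc lim_1_over_n)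
    then have z: "(\<lambda>k. real q * (1 / real (Suc k))) \<longlonglongrightarrow> 0" by simp
    have "(\<lambda>k. (\<Sum>t\<in>#m \<theta>. \<psi> k t) - (\<Sum>t\<in>#m \<theta>. \<phi> t)) \<longlonglongrightarrow> 0"
    proof (rule Lim_null_comparison[OF always_eventually z], rule allI)
      show "norm ((\<Sum>t\<in>#m \<theta>. \<psi> k t) - (\<Sum>t\<in>#m \<theta>. \<phi> t)) \<le> real q * (1 / real (Suc k))" for k
        using mle[OF \<psi>(2) th, of k] by (simp add: abs_minus_commute)
    qed
    then show "(\<lambda>k. \<Sum>t\<in>#m \<theta>. \<psi> k t) \<longlonglongrightarrow> (\<Sum>t\<in>#m \<theta>. \<phi> t)" by (rule LIM_zero_cancel)
  qed
  obtain B where B: "\<And>t. 0 \<le> t \<Longrightarrow> \<bar>\<psi> 0 t\<bar> \<le> B" using \<psi>(1)[of 0] by (auto simp: spectral_limit_def)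
  have "\<bar>\<phi> t\<bar> \<le> B + 1" if "0 \<le> t" for t
  proof -
    have "\<bar>\<phi> t - \<psi> 0 t\<bar> \<le> 1" using \<psi>(2)[of 0] that by simp
    then show ?thesis using B[OF that] by linarith
  qed
  then have bd: "\<exists>B. \<forall>t\<ge>0. \<bar>\<phi> t\<bar> \<le> B" by blast
  have int: "integrable circ (\<lambda>\<theta>. \<Sum>t\<in>#m \<theta>. \<phi> t)"
  proof (rule finite_measure.integrable_const_bound[OF finite_measure_circ _ meas])
    show "AE \<theta> in circ. norm (\<Sum>t\<in>#m \<theta>. \<phi> t) \<le> real q * (B + 1)"
    proof (rule AE_I2)
      fix \<theta> assume "\<theta> \<in> space circ"
      then have th: "\<theta> \<in> {-pi..pi}" by simp
      show "norm (\<Sum>t\<in>#m \<theta>. \<phi> t) \<le> real q * (B + 1)"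
        using sum_mset_abs_le[of "m \<theta>" \<phi> "B + 1"] \<open>\<And>t. 0 \<le> t \<Longrightarrow> \<bar>\<phi> t\<bar> \<le> B + 1\<close> m[OF th] by simp
    qed
  qed
  have "(\<lambda>n. (\<Sum>t\<in>#N n. \<phi> t) / real n) \<longlonglongrightarrow> 1 / (2 * pi) * (\<integral>\<theta>. (\<Sum>t\<in>#m \<theta>. \<phi> t) \<partial>circ)"
  proof (rule LIMSEQ_I)
    fix r :: real assume r: "0 < r"
    define e where "e = r / (4 * (real q + 1))"
    have e: "0 < e" "real q * e \<le> r / 4"
    proof -
      show "0 < e" using r by (simp add: e_def)
      have "real q * e \<le> (real q + 1) * e" using \<open>0 < e\<close> by simp
      also have "\<dots> = r / 4" by (simp add: e_def field_simps add_eq_0_iff)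
      finally show "real q * e \<le> r / 4" .
    qed
    obtain \<eta> where \<eta>: "spectral_limit N m \<eta>" "\<forall>t\<ge>0. \<bar>\<phi> t - \<eta> t\<bar> \<le> e" using assms[OF e(1)] by blast
    define a where "a n = (\<Sum>t\<in>#N n. \<phi> t) / real n" for n
    define b where "b n = (\<Sum>t\<in>#N n. \<eta> t) / real n" for n
    define La where "La = 1 / (2 * pi) * (\<integral>\<theta>. (\<Sum>t\<in>#m \<theta>. \<phi> t) \<partial>circ)"
    define Lb where "Lb = 1 / (2 * pi) * (\<integral>\<theta>. (\<Sum>t\<in>#m \<theta>. \<eta> t) \<partial>circ)"
    note i\<eta> = spectral_limit_integrable[OF \<eta>(1)]
    have "\<bar>(\<integral>\<theta>. (\<Sum>t\<in>#m \<theta>. \<phi> t) - (\<Sum>t\<in>#m \<theta>. \<eta> t) \<partial>circ)\<bar> \<le> (\<integral>\<theta>. real q * e \<partial>circ)"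
    proof (rule order_trans[OF integral_abs_bound], rule integral_mono)
      show "integrable circ (\<lambda>\<theta>. \<bar>(\<Sum>t\<in>#m \<theta>. \<phi> t) - (\<Sum>t\<in>#m \<theta>. \<eta> t)\<bar>)" using int i\<eta> by auto
      show "integrable circ (\<lambda>\<theta>. real q * e)" by (rule finite_measure.integrable_const[OF finite_measure_circ])
      show "\<And>\<theta>. \<theta> \<in> space circ \<Longrightarrow> \<bar>(\<Sum>t\<in>#m \<theta>. \<phi> t) - (\<Sum>t\<in>#m \<theta>. \<eta> t)\<bar> \<le> real q * e"
        using mle[OF \<eta>(2)] by simp
    qed
    also have "\<dots> = 2 * pi * (real q * e)" by (simp add: measure_circ[simplified])
    finally have "\<bar>(\<integral>\<theta>. (\<Sum>t\<in>#m \<theta>. \<phi> t) \<partial>circ) - (\<integral>\<theta>. (\<Sum>t\<in>#m \<theta>. \<eta> t) \<partial>circ)\<bar> \<le> 2 * pi * (real q * e)"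
      using int i\<eta> by (simp only: Bochner_Integration.integral_diff)
    then have "1 / (2 * pi) * \<bar>(\<integral>\<theta>. (\<Sum>t\<in>#m \<theta>. \<phi> t) \<partial>circ) - (\<integral>\<theta>. (\<Sum>t\<in>#m \<theta>. \<eta> t) \<partial>circ)\<bar> \<le> 1 / (2 * pi) * (2 * pi * (real q * e))"
      by (intro mult_left_mono) auto
    moreover have "\<bar>La - Lb\<bar> = 1 / (2 * pi) * \<bar>(\<integral>\<theta>. (\<Sum>t\<in>#m \<theta>. \<phi> t) \<partial>circ) - (\<integral>\<theta>. (\<Sum>t\<in>#m \<theta>. \<eta> t) \<partial>circ)\<bar>"
      unfolding La_def Lb_def right_diff_distrib[symmetric] abs_mult by simp
    ultimately have L: "\<bar>La - Lb\<bar> \<le> real q * e" by simp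
    have "b \<longlonglongrightarrow> Lb" using \<eta>(1) by (simp add: spectral_limit_def b_def[abs_def] Lb_def)
    from LIMSEQ_D[OF this, of "r / 4"] r obtain n0 where n0: "\<And>n. n \<ge> n0 \<Longrightarrow> \<bar>b n - Lb\<bar> < r / 4" by auto
    have "\<bar>a n - La\<bar> < r" if "n \<ge> n0" for n
      using n0[OF that] L e Nle[OF \<eta>(2) e(1), of n] r unfolding a_def[symmetric] b_def[symmetric] by linarith
    then show "\<exists>no. \<forall>n\<ge>no. norm ((\<Sum>t\<in>#N n. \<phi> t) / real n - 1 / (2 * pi) * (\<integral>\<theta>. (\<Sum>t\<in>#m \<theta>. \<phi> t) \<partial>circ)) < r"
      unfolding a_def[symmetric] La_def[symmetric] by auto
  qed
  then show ?thesis using meas bd by (simp add: spectral_limit_def)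
qed

text \<open>Higher powers of resolvents are, up to a factor, derivatives of lower ones in the parameter \<open>x\<close>.\<close>

lemma spectral_limit_power:
  assumes res: "\<And>x. 0 < x \<Longrightarrow> spectral_limit N m (\<lambda>t. 1 / (x + t))" and x: "0 < x"
  shows "spectral_limit N m (\<lambda>t. (1 / (x + t)) ^ k)"
  using x
proof (induction k arbitrary: x)
  case 0
  then show ?case using spectral_limit_const[of 1] by simp
next
  case (Suc k)
  show ?case
  proof (cases "k = 0")
    case True
    then show ?thesis using res[OF Suc.prems] by simp
  next
    case False
    have "spectral_limit N m (\<lambda>t. real k * (1 / (x + t)) ^ Suc k)"
    proof (rule spectral_limit_uniform)
      fix e :: real assume e: "0 < e"
      define C where "C = (real k)\<^sup>2 / x ^ (k + 2)"
      have C: "0 < C" using False Suc.prems by (simp add: C_def)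
      define h where "h = e / C"
      have h: "0 < h" "h * C = e" using e C by (simp_all add: h_def)
      define \<psi> where "\<psi> t = (1 / h) * (1 / (x + t)) ^ k + (- 1 / h) * (1 / (x + h + t)) ^ k" for t
      have "spectral_limit N m \<psi>"
        unfolding \<psi>_def using Suc h by (intro spectral_limit_add spectral_limit_cmult) auto
      moreover have "\<bar>real k * (1 / (x + t)) ^ Suc k - \<psi> t\<bar> \<le> e" if "0 \<le> t" for t
        using resolvent_power_quotient[OF Suc.prems that h(1), of k]
        unfolding C_def[symmetric] h(2) by (simp add: \<psi>_def abs_minus_commute diff_divide_distrib)
      ultimately show "\<exists>\<psi>. spectral_limit N m \<psi> \<and> (\<forall>t\<ge>0. \<bar>real k * (1 / (x + t)) ^ Suc k - \<psi> t\<bar> \<le> e)" by blast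
    qed
    from spectral_limit_cmult[OF this, of "1 / real k"] show ?thesis using False by simp
  qed
qed

text \<open>The substitution \<open>u = 1/(1+t)\<close> maps \<open>t \<ge> 0\<close> to the interval from 0 to 1; the function \<open>\<psi>\<close> that corresponds to
\<open>\<phi>\<close> vanishes near \<open>u = 0\<close>, hence is continuous there, and is approximated by polynomials in \<open>u\<close>.\<close>

theorem spectral_limit_compact_support:
  assumes res: "\<And>x. 0 < x \<Longrightarrow> spectral_limit N m (\<lambda>t. 1 / (x + t))"
    and cont: "continuous_on UNIV \<phi>" and T: "0 < T" "\<And>t. T \<le> t \<Longrightarrow> \<phi> t = 0"
  shows "spectral_limit N m \<phi>"
proof (rule spectral_limit_uniform)
  fix e :: real assume e: "0 < e"
  \<comment> \<open>Below c the transformed function vanishes, since \<open>u \<le> c\<close> means \<open>t \<ge> T\<close>.\<close>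
  define c where "c = 1 / (1 + T)"
  have c: "0 < c" "c \<le> 1" using T by (simp_all add: c_def)
  define \<psi> where "\<psi> u = (if u \<le> c then 0 else \<phi> (1 / u - 1))" for u
  have "continuous_on ({0..c} \<union> {c..1}) \<psi>"
    unfolding \<psi>_def
  proof (rule continuous_on_If)
    show "continuous_on {c..1} (\<lambda>u. \<phi> (1 / u - 1))"
      by (rule continuous_on_compose2[OF cont]) (use c in \<open>auto intro!: continuous_intros\<close>)
    fix u assume u: "u \<in> {c..1}" "u \<le> c"
    then have "u = c" by simp
    then have "1 / u - 1 = T" by (simp add: c_def)
    then show "0 = \<phi> (1 / u - 1)" using T by simp
  qed auto
  moreover have "{0..c} \<union> {c..1} = {0..1}" using c by auto
  ultimately have "continuous_on {0..1} \<psi>" by simp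
  then obtain p where p: "real_polynomial_function p" "\<And>u. u \<in> {0..1} \<Longrightarrow> \<bar>\<psi> u - p u\<bar> < e"
    using Stone_Weierstrass_real_polynomial_function[OF compact_Icc _ e] by metis
  obtain a n where pa: "p = (\<lambda>u. \<Sum>i\<le>n. a i * u ^ i)" using p(1) real_polynomial_function_iff_sum by auto
  have "spectral_limit N m (\<lambda>t. p (1 / (1 + t)))"
    unfolding pa by (intro spectral_limit_sum spectral_limit_cmult spectral_limit_power res) auto
  moreover have "\<bar>\<phi> t - p (1 / (1 + t))\<bar> \<le> e" if t: "0 \<le> t" for t
  proof -
    have "\<psi> (1 / (1 + t)) = \<phi> t"
    proof (cases "T \<le> t")
      case True
      then have "1 / (1 + t) \<le> c" using T by (simp add: c_def frac_le)
      then show ?thesis using T True by (simp add: \<psi>_def)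
    next
      case False
      then have "\<not> 1 / (1 + t) \<le> c" using T t by (simp add: c_def field_simps)
      then show ?thesis by (simp add: \<psi>_def)
    qed
    moreover have "1 / (1 + t) \<in> {0..1}" using t by simp
    ultimately show ?thesis using p(2)[of "1 / (1 + t)"] by simp
  qed
  ultimately show "\<exists>\<psi>. spectral_limit N m \<psi> \<and> (\<forall>t\<ge>0. \<bar>\<phi> t - \<psi> t\<bar> \<le> e)" by blast
qed

lemma integral_of_parts:
  fixes u v :: "real \<Rightarrow> real"
  assumes "integrable circ u" "integrable circ v"
  shows "(\<integral>\<theta>. of_real (u \<theta>) + \<i> * of_real (v \<theta>) \<partial>circ) = of_real (\<integral>\<theta>. u \<theta> \<partial>circ) + \<i> * of_real (\<integral>\<theta>. v \<theta> \<partial>circ)"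
  using assms by (subst Bochner_Integration.integral_add) auto

theorem complex_test_functions:
  fixes F :: "real \<Rightarrow> complex"
  assumes res: "\<And>x. 0 < x \<Longrightarrow> spectral_limit N m (\<lambda>t. 1 / (x + t))" and q: "0 < q"
    and F: "continuous_on UNIV F" "bounded {t. F t \<noteq> 0}"
  shows "(\<lambda>\<theta>. (\<Sum>t\<in>#m \<theta>. F t) / of_nat q) \<in> borel_measurable circ"
    "(\<lambda>n. 1 / of_nat (q * n) * (\<Sum>t\<in>#N n. F t)) \<longlonglongrightarrow>
      1 / of_real (pi - (- pi)) * (\<integral>\<theta>. (\<Sum>t\<in>#m \<theta>. F t) / of_nat q \<partial>circ)"
proof -
  obtain T0 where T0: "\<And>t. F t \<noteq> 0 \<Longrightarrow> \<bar>t\<bar> \<le> T0" using F(2) by (auto simp: bounded_iff)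
  define T where "T = \<bar>T0\<bar> + 1"
  have T: "0 < T" "\<And>t. T \<le> t \<Longrightarrow> F t = 0" using T0 by (auto simp: T_def) force
  have R: "spectral_limit N m (\<lambda>t. Re (F t))" and I: "spectral_limit N m (\<lambda>t. Im (F t))"
    using F(1) T by (auto intro!: spectral_limit_compact_support[OF res] continuous_intros)
  have split: "(\<Sum>t\<in>#M. F t) = of_real (\<Sum>t\<in>#M. Re (F t)) + \<i> * of_real (\<Sum>t\<in>#M. Im (F t))" for M
  proof -
    have "Re (\<Sum>t\<in>#M. F t) = (\<Sum>t\<in>#M. Re (F t))" "Im (\<Sum>t\<in>#M. F t) = (\<Sum>t\<in>#M. Im (F t))"
      by (induction M) auto
    then show ?thesis using complex_eq[of "\<Sum>t\<in>#M. F t"] by simp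
  qed
  have mR: "(\<lambda>\<theta>. \<Sum>t\<in>#m \<theta>. Re (F t)) \<in> borel_measurable circ"
    and mI: "(\<lambda>\<theta>. \<Sum>t\<in>#m \<theta>. Im (F t)) \<in> borel_measurable circ"
    using R I by (simp_all add: spectral_limit_def)
  show "(\<lambda>\<theta>. (\<Sum>t\<in>#m \<theta>. F t) / of_nat q) \<in> borel_measurable circ"
    unfolding split using mR mI by measurable
  define a where "a n = (\<Sum>t\<in>#N n. Re (F t)) / real n" for n
  define b where "b n = (\<Sum>t\<in>#N n. Im (F t)) / real n" for n
  define La where "La = (\<integral>\<theta>. (\<Sum>t\<in>#m \<theta>. Re (F t)) \<partial>circ)"
  define Lb where "Lb = (\<integral>\<theta>. (\<Sum>t\<in>#m \<theta>. Im (F t)) \<partial>circ)"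
  have lim: "(\<lambda>n. 1 / of_nat q * (of_real (a n) + \<i> * of_real (b n))) \<longlonglongrightarrow>
      1 / of_nat q * (of_real (1 / (2 * pi) * La) + \<i> * of_real (1 / (2 * pi) * Lb))"
    using R I unfolding spectral_limit_def a_def b_def La_def Lb_def
    by (intro tendsto_mult tendsto_add tendsto_of_real tendsto_const) auto
  have "(\<integral>\<theta>. (\<Sum>t\<in>#m \<theta>. F t) \<partial>circ) = of_real La + \<i> * of_real Lb"
    unfolding split La_def Lb_def
    by (rule integral_of_parts[OF spectral_limit_integrable[OF R] spectral_limit_integrable[OF I]])
  then have L: "1 / of_real (pi - (- pi)) * (\<integral>\<theta>. (\<Sum>t\<in>#m \<theta>. F t) / of_nat q \<partial>circ)
     = 1 / of_nat q * (of_real (1 / (2 * pi) * La) + \<i> * of_real (1 / (2 * pi) * Lb))"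
    by (simp add: field_simps)
  have S: "1 / of_nat (q * n) * (\<Sum>t\<in>#N n. F t) = 1 / of_nat q * (of_real (a n) + \<i> * of_real (b n))" for n
  proof -
    have "1 / of_nat (q * n) * (of_real x + \<i> * of_real y) =
        1 / of_nat q * (of_real (x / real n) + \<i> * of_real (y / real n))" for x y :: real
      by (simp add: add_divide_distrib mult.commute)
    then show ?thesis unfolding split a_def b_def .
  qed
  show "(\<lambda>n. 1 / of_nat (q * n) * (\<Sum>t\<in>#N n. F t)) \<longlonglongrightarrow>
      1 / of_real (pi - (- pi)) * (\<integral>\<theta>. (\<Sum>t\<in>#m \<theta>. F t) / of_nat q \<partial>circ)"
    unfolding L S by (rule lim)
qed

end

section \<open>The distribution theorem\<close>

lemma hermitian_pos_def_pd:
  assumes A: "A \<in> carrier_mat n n" and h: "hermitian_pos_def A"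
  shows "pd A"
  unfolding pd_def
proof (intro conjI allI impI)
  have [simp]: "dim_row A = n" "dim_col A = n" using A by auto
  show "dim_row A = dim_col A" by simp
  show "mat_adjoint A = A" using h by (simp add: hermitian_pos_def_def)
  fix w :: "complex mat"
  assume w: "dim_row w = dim_row A \<and> dim_col w = 1 \<and> w \<noteq> 0\<^sub>m (dim_row A) 1"
  then have wd: "dim_row w = n" "dim_col w = 1" and wz: "w \<noteq> 0\<^sub>m n 1" by simp_all
  define v where "v = col w 0"
  have v: "v \<in> carrier_vec n" unfolding v_def using col_dim[of w 0] wd by simp
  have vi: "vec_index v i = w $$ (i, 0)" if "i < n" for i using wd that by (simp add: v_def)
  have "v \<noteq> 0\<^sub>v n"
  proof
    assume "v = 0\<^sub>v n"
    then have "w $$ (i, 0) = 0" if "i < n" for i using vi[OF that] that by simp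
    then have "w = 0\<^sub>m n 1" using wd by (intro eq_matI) auto
    then show False using wz by simp
  qed
  then have "0 < Re ((A *\<^sub>v v) \<bullet>c v)" using h v by (simp add: hermitian_pos_def_def)
  also have "(A *\<^sub>v v) \<bullet>c v = (\<Sum>i<n. (\<Sum>k<n. A $$ (i, k) * w $$ (k, 0)) * cnj (w $$ (i, 0)))"
  proof -
    have dv: "dim_vec v = n" using v by simp
    have "vec_index (A *\<^sub>v v) i = (\<Sum>k<n. A $$ (i, k) * w $$ (k, 0))" if "i < n" for i
    proof -
      have "vec_index (A *\<^sub>v v) i = (\<Sum>k\<in>{0..<n}. vec_index (row A i) k * vec_index v k)"
        using that dv by (simp add: scalar_prod_def)
      also have "\<dots> = (\<Sum>k<n. A $$ (i, k) * w $$ (k, 0))"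
        unfolding lessThan_atLeast0 by (rule sum.cong[OF refl]) (use that vi in simp)
      finally show ?thesis .
    qed
    moreover have "(A *\<^sub>v v) \<bullet>c v = (\<Sum>i\<in>{0..<n}. vec_index (A *\<^sub>v v) i * vec_index (conjugate v) i)"
      using dv by (simp add: scalar_prod_def)
    ultimately show ?thesis
      unfolding lessThan_atLeast0 by (simp only:) (rule sum.cong[OF refl], use vi dv in simp)
  qed
  also have "\<dots> = (\<Sum>i<n. \<Sum>k<n. cnj (w $$ (i, 0)) * A $$ (i, k) * w $$ (k, 0))"
    by (simp add: sum_distrib_right sum_distrib_left ac_simps)
  also have "\<dots> = (\<Sum>k<n. \<Sum>i<n. cnj (w $$ (i, 0)) * A $$ (i, k) * w $$ (k, 0))" by (rule sum.swap)
  also have "\<dots> = qf A w" using wd by (simp add: qf_def mat_mult_index sum_distrib_right)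
  finally show "0 < Re (qf A w)" .
qed

lemma psd_singvals:
  assumes "psd A" "dim_row A = n"
  shows "size (singvals A) = n" "\<And>t. t \<in># singvals A \<Longrightarrow> 0 \<le> t"
    "eigvals A = image_mset of_real (singvals A)"
    "\<And>x R. R \<in> carrier_mat n n \<Longrightarrow> R * (of_real x \<cdot>\<^sub>m 1\<^sub>m n + A) = 1\<^sub>m n \<Longrightarrow> 0 < x \<Longrightarrow>
       Re (tr R) = (\<Sum>t\<in>#singvals A. 1 / (x + t))"
proof -
  obtain ls where ls: "length ls = n" "eigvals A = mset (map of_real ls)" "singvals A = mset ls"
    "\<And>l. l \<in> set ls \<Longrightarrow> 0 \<le> l"
    "\<And>x R. R \<in> carrier_mat n n \<Longrightarrow> R * (of_real x \<cdot>\<^sub>m 1\<^sub>m n + A) = 1\<^sub>m n \<Longrightarrow> 0 < x \<Longrightarrow>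
       tr R = of_real (\<Sum>l\<leftarrow>ls. 1 / (x + l))"
    by (rule psd_spectrum[OF assms]) (rule that; assumption)
  show "size (singvals A) = n" "\<And>t. t \<in># singvals A \<Longrightarrow> 0 \<le> t"
    "eigvals A = image_mset of_real (singvals A)" using ls by auto
  show "Re (tr R) = (\<Sum>t\<in>#singvals A. 1 / (x + t))"
    if "R \<in> carrier_mat n n" "R * (of_real x \<cdot>\<^sub>m 1\<^sub>m n + A) = 1\<^sub>m n" "0 < x" for x R
    using ls(5)[OF that] ls(3) by (simp add: sum_mset_sum_list flip: mset_map)
qed

lemma tr_schur_res_singvals:
  assumes "pd G" "dim_row G = N" "dim_row F = Q" "dim_col F = N" "0 < x"
  shows "Re (tr (schur_res x G F)) = (\<Sum>t\<in>#singvals (schur G F). 1 / (x + t))"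
  by (rule psd_singvals(4)[OF psd_schur])
     (use assms schur_res_eq[OF assms] schur_aux_dims(4,5)[OF assms] in \<open>auto intro!: carrier_matI\<close>)

text \<open>By completeness of Lebesgue measure, a function that agrees with a measurable one off a null set is
measurable.\<close>

lemma null_modification:
  fixes u v :: "real \<Rightarrow> complex"
  assumes Z: "Z \<in> null_sets circ" and eq: "\<And>\<theta>. \<theta> \<in> {-pi..pi} - Z \<Longrightarrow> u \<theta> = v \<theta>"
    and v: "v \<in> borel_measurable circ"
  shows "u \<in> borel_measurable circ" "(\<integral>\<theta>. u \<theta> \<partial>circ) = (\<integral>\<theta>. v \<theta> \<partial>circ)"
proof -
  have "v \<in> borel_measurable (lebesgue_on ({-pi..pi} - Z))"
    using v borel_measurable_diff_null[OF Z, where f = v] by simp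
  then have "u \<in> borel_measurable (lebesgue_on ({-pi..pi} - Z))"
    by (subst measurable_cong[of _ u v]) (use eq in auto)
  then show u: "u \<in> borel_measurable circ" using borel_measurable_diff_null[OF Z, where f = u] by simp
  have "AE \<theta> in circ. u \<theta> = v \<theta>"
    using AE_not_in[OF Z] by (rule AE_mp) (use eq in \<open>auto intro!: AE_I2\<close>)
  then show "(\<integral>\<theta>. u \<theta> \<partial>circ) = (\<integral>\<theta>. v \<theta> \<partial>circ)" by (rule integral_cong_AE[OF u v])
qed

text \<open>On the exceptional null set \<open>g\<close> is replaced by the identity. This changes neither the Toeplitz matrices nor the
integrals, and makes the previous results applicable.\<close>

theorem theorem16:
  fixes s q :: nat and f g :: "real \<Rightarrow> complex mat"
  assumes "0 < q" and "0 < s" and "q < s"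
    and "L1_symbol s s g"
    and "AE \<theta> in lebesgue_on {-pi..pi}. hermitian_pos_def (g \<theta>)"
    and "L1_symbol q s f"
  shows "singval_distributed
           (\<lambda>n. block_toeplitz q s n f * mat_inv (block_toeplitz s s n g) *
                block_toeplitz s q n (\<lambda>\<theta>. mat_adjoint (f \<theta>)))
           q (\<lambda>\<theta>. f \<theta> * mat_inv (g \<theta>) * mat_adjoint (f \<theta>)) (-pi) pi
       \<and> eigval_distributed
           (\<lambda>n. block_toeplitz q s n f * mat_inv (block_toeplitz s s n g) *
                block_toeplitz s q n (\<lambda>\<theta>. mat_adjoint (f \<theta>)))
           q (\<lambda>\<theta>. f \<theta> * mat_inv (g \<theta>) * mat_adjoint (f \<theta>)) (-pi) pi"
proof -
  note g = assms(4) and f = assms(6)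
  have fc: "\<And>\<theta>. \<theta> \<in> {-pi..pi} \<Longrightarrow> f \<theta> \<in> carrier_mat q s" using f by (simp add: L1_symbol_def)
  have gc: "\<And>\<theta>. \<theta> \<in> {-pi..pi} \<Longrightarrow> g \<theta> \<in> carrier_mat s s" using g by (simp add: L1_symbol_def)
  obtain Z where Z: "{\<theta> \<in> space circ. \<not> hermitian_pos_def (g \<theta>)} \<subseteq> Z" "emeasure circ Z = 0" "Z \<in> sets circ"
    using AE_E[OF assms(5)] by blast
  then have Zn: "Z \<in> null_sets circ" by auto
  define g' where "g' \<theta> = (if \<theta> \<in> Z then 1\<^sub>m s else g \<theta>)" for \<theta>
  have g'pd: "pd (g' \<theta>)" if th: "\<theta> \<in> {-pi..pi}" for \<theta>
  proof (cases "\<theta> \<in> Z")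
    case False
    then have "hermitian_pos_def (g \<theta>)" using Z(1) th by auto
    then show ?thesis using False hermitian_pos_def_pd[OF gc[OF th]] by (simp add: g'_def)
  qed (simp add: g'_def pd_one)
  have gi: "integrable circ (\<lambda>\<theta>. g \<theta> $$ (i, j))" if "i < s" "j < s" for i j
    using g that by (simp add: L1_symbol_def)
  have null: "(\<lambda>\<theta>. g' \<theta> $$ (i, j)) \<in> borel_measurable circ"
    "AE \<theta> in circ. g' \<theta> $$ (i, j) = g \<theta> $$ (i, j)" if "i < s" "j < s" for i j
  proof -
    show "(\<lambda>\<theta>. g' \<theta> $$ (i, j)) \<in> borel_measurable circ"
      by (rule null_modification(1)[OF Zn]) (use gi[OF that] in \<open>auto simp: g'_def\<close>)
    show "AE \<theta> in circ. g' \<theta> $$ (i, j) = g \<theta> $$ (i, j)"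
      using AE_not_in[OF Zn] by (rule AE_mp) (auto simp: g'_def intro!: AE_I2)
  qed
  have g': "L1_symbol s s g'"
    unfolding L1_symbol_def
  proof (intro conjI ballI allI impI)
    show "g' \<theta> \<in> carrier_mat s s" if "\<theta> \<in> {-pi..pi}" for \<theta> using gc[OF that] by (simp add: g'_def)
    fix i j assume l: "i < s" "j < s"
    show "integrable circ (\<lambda>\<theta>. g' \<theta> $$ (i, j))"
      using integrable_cong_AE[OF null(1)[OF l] borel_measurable_integrable[OF gi[OF l]] null(2)[OF l]] gi[OF l] by simp
  qed
  have Tg: "block_toeplitz s s n g' = block_toeplitz s s n g" for n
  proof (rule block_matI[where a = s and b = s and n = n])
    fix i \<alpha> j \<beta> assume l: "i < n" "\<alpha> < s" "j < n" "\<beta> < s"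
    have "fc (\<lambda>\<theta>. g' \<theta> $$ (\<alpha>, \<beta>)) (int i - int j) = fc (\<lambda>\<theta>. g \<theta> $$ (\<alpha>, \<beta>)) (int i - int j)"
    proof -
      have "(\<integral>\<theta>. g' \<theta> $$ (\<alpha>, \<beta>) * ek (- (int i - int j)) \<theta> \<partial>circ) = (\<integral>\<theta>. g \<theta> $$ (\<alpha>, \<beta>) * ek (- (int i - int j)) \<theta> \<partial>circ)"
        by (rule null_modification(2)[OF Zn])
           (use borel_measurable_integrable[OF integrable_mult_ek[OF gi[OF l(2,4)]]] in \<open>auto simp: g'_def\<close>)
      then show ?thesis by (simp only: fc_def)
    qed
    then show "block_toeplitz s s n g' $$ (i * s + \<alpha>, j * s + \<beta>) = block_toeplitz s s n g $$ (i * s + \<alpha>, j * s + \<beta>)"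
      using l by (simp add: block_toeplitz_index)
  qed auto
  define A where "A n = block_toeplitz q s n f * mat_inv (block_toeplitz s s n g) *
                block_toeplitz s q n (\<lambda>\<theta>. mat_adjoint (f \<theta>))" for n
  define a where "a \<theta> = f \<theta> * mat_inv (g \<theta>) * mat_adjoint (f \<theta>)" for \<theta>
  have A: "A n = schur (block_toeplitz s s n g') (block_toeplitz q s n f)" for n
    unfolding A_def schur_def Tg by (subst block_toeplitz_adjoint[OF fc]) auto
  define a' where "a' \<theta> = schur (g' \<theta>) (f \<theta>)" for \<theta>
  have aa': "a \<theta> = a' \<theta>" if "\<theta> \<notin> Z" for \<theta> using that by (simp add: a_def a'_def schur_def g'_def)
  have Gp: "pd (block_toeplitz s s n g')" for n by (rule pd_block_toeplitz[OF g' g'pd])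
  have Ad: "dim_row (A n) = q * n" "dim_col (A n) = q * n" for n by (simp_all add: A)
  have Apsd: "psd (A n)" for n unfolding A by (rule psd_schur[OF Gp]) simp
  have gd: "dim_row (g' \<theta>) = s" "dim_row (f \<theta>) = q" "dim_col (f \<theta>) = s" if "\<theta> \<in> {-pi..pi}" for \<theta>
    using gc[OF that] fc[OF that] by (auto simp: g'_def)
  have apsd: "psd (a' \<theta>)" "dim_row (a' \<theta>) = q" if "\<theta> \<in> {-pi..pi}" for \<theta>
    unfolding a'_def using g'pd[OF that] gd[OF that] by (auto intro!: psd_schur)
  note SA = psd_singvals[OF Apsd Ad(1)]
  note Sa = psd_singvals[OF apsd]
  have res: "spectral_limit (\<lambda>n. singvals (A n)) (\<lambda>\<theta>. singvals (a' \<theta>)) (\<lambda>t. 1 / (x + t))" if x: "0 < x" for x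
    unfolding spectral_limit_def
  proof (intro conjI)
    show "\<exists>B. \<forall>t\<ge>0. \<bar>1 / (x + t)\<bar> \<le> B" using x by (intro exI[of _ "1 / x"]) (auto intro!: frac_le)
    have p: "(\<Sum>t\<in>#singvals (a' \<theta>). 1 / (x + t)) = Re (tr (schur_res x (g' \<theta>) (f \<theta>)))" if "\<theta> \<in> space circ" for \<theta>
      unfolding a'_def using that g'pd gd x by (intro tr_schur_res_singvals[symmetric]) auto
    have mm: "mat_measurable s s g'" "mat_measurable q s f" using L1_symbol_measurable g' f by auto
    have "(\<lambda>\<theta>. Re (tr (schur_res x (g' \<theta>) (f \<theta>)))) \<in> borel_measurable circ"
      using measurable_tr[OF mat_measurable_schur_res[OF mm]] by measurable
    then show "(\<lambda>\<theta>. \<Sum>t\<in>#singvals (a' \<theta>). 1 / (x + t)) \<in> borel_measurable circ"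
      by (subst measurable_cong[OF p]) auto
    have i: "(\<integral>\<theta>. (\<Sum>t\<in>#singvals (a' \<theta>). 1 / (x + t)) \<partial>circ) = (\<integral>\<theta>. Re (tr (schur_res x (g' \<theta>) (f \<theta>))) \<partial>circ)"
      by (rule Bochner_Integration.integral_cong[OF refl p])
    have An: "(\<Sum>t\<in>#singvals (A n). 1 / (x + t)) = Re (tr (schur_res x (block_toeplitz s s n g') (block_toeplitz q s n f)))" for n
      unfolding A by (rule tr_schur_res_singvals[OF Gp _ _ _ x, symmetric]) auto
    show "(\<lambda>n. (\<Sum>t\<in>#singvals (A n). 1 / (x + t)) / real n) \<longlonglongrightarrow>
        1 / (2 * pi) * (\<integral>\<theta>. (\<Sum>t\<in>#singvals (a' \<theta>). 1 / (x + t)) \<partial>circ)"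
      unfolding i An by (rule resolvent_trace_limit[OF g' g'pd f x])
  qed
  have core: "(\<lambda>n. 1 / of_nat (dim_row (A n)) * (\<Sum>t\<in>#singvals (A n). F t)) \<longlonglongrightarrow>
      1 / of_real (pi - (- pi)) * (\<integral>\<theta>. (\<Sum>t\<in>#singvals (a \<theta>). F t) / of_nat q \<partial>circ)"
    "(\<lambda>\<theta>. (\<Sum>t\<in>#singvals (a' \<theta>). F t) / of_nat q) \<in> borel_measurable circ"
    "(\<integral>\<theta>. (\<Sum>t\<in>#singvals (a \<theta>). F t) / of_nat q \<partial>circ) = (\<integral>\<theta>. (\<Sum>t\<in>#singvals (a' \<theta>). F t) / of_nat q \<partial>circ)"
    if F: "continuous_on UNIV F" "bounded {t. F t \<noteq> 0}" for F :: "real \<Rightarrow> complex"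
  proof -
    note T = complex_test_functions[OF SA(1,2) Sa(1,2) res assms(1) F]
    show m: "(\<lambda>\<theta>. (\<Sum>t\<in>#singvals (a' \<theta>). F t) / of_nat q) \<in> borel_measurable circ" by (rule T(1))
    show i: "(\<integral>\<theta>. (\<Sum>t\<in>#singvals (a \<theta>). F t) / of_nat q \<partial>circ) = (\<integral>\<theta>. (\<Sum>t\<in>#singvals (a' \<theta>). F t) / of_nat q \<partial>circ)"
      by (rule null_modification(2)[OF Zn _ m]) (simp add: aa')
    show "(\<lambda>n. 1 / of_nat (dim_row (A n)) * (\<Sum>t\<in>#singvals (A n). F t)) \<longlonglongrightarrow>
      1 / of_real (pi - (- pi)) * (\<integral>\<theta>. (\<Sum>t\<in>#singvals (a \<theta>). F t) / of_nat q \<partial>circ)"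
      unfolding i Ad using T(2) .
  qed
  have basic: "\<forall>t\<in>{-pi..pi}. a t \<in> carrier_mat q q"
    "\<forall>i<q. \<forall>j<q. (\<lambda>t. a t $$ (i, j)) \<in> borel_measurable circ"
    "\<forall>n. square_mat (A n)" "filterlim (\<lambda>n. dim_row (A n)) at_top sequentially"
  proof -
    have "mat_measurable q q a"
      using mat_measurable_schur[OF L1_symbol_measurable[OF g] L1_symbol_measurable[OF f]]
      by (simp add: a_def[abs_def] schur_def)
    then show "\<forall>t\<in>{-pi..pi}. a t \<in> carrier_mat q q"
      "\<forall>i<q. \<forall>j<q. (\<lambda>t. a t $$ (i, j)) \<in> borel_measurable circ" by (simp_all add: mat_measurable_def)
    show "\<forall>n. square_mat (A n)" by (simp add: Ad)
    show "filterlim (\<lambda>n. dim_row (A n)) at_top sequentially"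
      unfolding Ad using assms(1) by (intro mult_nat_left_at_top) simp
  qed
  have "distributed_as singvals A q a (- pi) pi"
    unfolding distributed_as_def
  proof (intro conjI basic allI impI)
    fix F :: "real \<Rightarrow> complex" assume "continuous_on UNIV F \<and> compact (closure {x. F x \<noteq> 0})"
    then show "(\<lambda>n. 1 / of_nat (dim_row (A n)) * (\<Sum>x\<in>#singvals (A n). F x)) \<longlonglongrightarrow>
        1 / of_real (pi - (- pi)) * (\<integral>t. (\<Sum>x\<in>#singvals (a t). F x) / of_nat q \<partial>circ)"
      by (intro core(1)) (auto simp: compact_closure)
  qed
  moreover have "distributed_as eigvals A q a (- pi) pi"
    unfolding distributed_as_def
  proof (intro conjI basic allI impI)
    fix F :: "complex \<Rightarrow> complex" assume F: "continuous_on UNIV F \<and> compact (closure {x. F x \<noteq> 0})"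
    define F' where "F' t = F (of_real t)" for t
    have F': "continuous_on UNIV F'"
      unfolding F'_def[abs_def] 
      by (rule continuous_on_compose2[OF conjunct1[OF F]]) (auto intro: continuous_intros)
    have "bounded {x. F x \<noteq> 0}" using F by (simp add: compact_closure)
    then obtain B where B: "\<And>z. F z \<noteq> 0 \<Longrightarrow> cmod z \<le> B" unfolding bounded_iff by blast
    have "norm t \<le> B" if "F' t \<noteq> 0" for t using B[of "of_real t"] that by (simp add: F'_def)
    then have "bounded {t. F' t \<noteq> 0}" by (auto simp: bounded_iff)
    note C = core[OF F' this]
    have eA: "(\<Sum>x\<in>#eigvals (A n). F x) = (\<Sum>t\<in>#singvals (A n). F' t)" for n
      by (simp add: SA(3) F'_def image_mset.compositionality comp_def)
    have ea: "(\<Sum>x\<in>#eigvals (a' \<theta>). F x) = (\<Sum>t\<in>#singvals (a' \<theta>). F' t)" if "\<theta> \<in> {-pi..pi}" for \<theta>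
      unfolding Sa(3)[OF that that] F'_def by (simp add: image_mset.compositionality comp_def)
    have "(\<integral>\<theta>. (\<Sum>x\<in>#eigvals (a \<theta>). F x) / of_nat q \<partial>circ) = (\<integral>\<theta>. (\<Sum>t\<in>#singvals (a' \<theta>). F' t) / of_nat q \<partial>circ)"
      by (rule null_modification(2)[OF Zn _ C(2)]) (use ea in \<open>auto simp: aa'\<close>)
    then show "(\<lambda>n. 1 / of_nat (dim_row (A n)) * (\<Sum>x\<in>#eigvals (A n). F x)) \<longlonglongrightarrow>
        1 / of_real (pi - (- pi)) * (\<integral>t. (\<Sum>x\<in>#eigvals (a t). F x) / of_nat q \<partial>circ)"
      using C(1) by (simp only: eA C(3))
  qed
  ultimately show ?thesis
    unfolding singval_distributed_def eigval_distributed_def A_def[abs_def] a_def[abs_def] by simp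
qed

end
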